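(* Up to isomorphism there are exactly $16$ irreducible $T$-root systems $\Omega$ with $\mathrm{rank}(\Omega)\ge2$ and $d=\frac12|\Omega|\le10$ that correspond to flag manifolds of exceptional compact simple Lie groups. They are: (i) the irreducible $T$-root systems of rank two with $d\le10$, i.e. the $T$-root systems of the flag manifolds $E_6/T^2D_4$ ($d=3$), $E_6/T^2A_4$ ($d=4$), $E_6/T^2A_1A_3$ ($d=5$), $E_6/T^2A_1A_1A_2$ ($d=6$), $E_7/T^2A_1D_4$ ($d=6$), $E_6/T^2A_2A_2$ ($d=6$), $E_7/T^2A_2A_3$ ($d=7$), $E_7/T^2A_1A_2A_2$ ($d=8$), $E_7/T^2A_1A_1A_3$ ($d=8$), $E_7/T^2A_1A_1A_1A_2$ ($d=9$), $E_8/T^2A_1A_5$ ($d=9$), $E_8/T^2A_3A_3$ ($d=10$), $E_8/T^2A_2A_4$ ($d=10$); (ii) the root system of type $C_3$, and the system $C_{3,2}$, that is, $C_3$ without two long opposite roots $\alpha$ and $-\alpha$; (iii) the system $B_3\cup\{\mathbf v,-\mathbf v\}$ of rank $3$, where $B_3$ is the classical root system and $\mathbf v$ is the sum of the three short positive roots of $B_3$.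
   Context: Let $G$ be a compact connected semisimple Lie group with Lie algebra $\mathfrak g$ and a fixed maximal torus $T^\ell$. A flag manifold of $G$ is $M=G/H$ with $H$ the centralizer of a torus; we may take $T^\ell\subset H$, and $H$ matters only up to conjugation. $L/T^kS$ denotes a flag manifold $L/H$ of the compact simple Lie group of type $L$ with $k=\dim Z(H)$ and $[H,H]$ of type $S$. Let $Q_G$ be the root lattice, $Q_H$ the sublattice generated by the roots of $[\mathfrak h,\mathfrak h]$; $Q_G/Q_H$ is a lattice in $\mathbb R^k=\mathbb R\otimes(Q_G/Q_H)$, $k=\dim Z(H)=b_2(M)$. A $T$-root is the image $\alpha+Q_H\ne0$ of a root $\alpha\notin Q_H$; the set of all $T$-roots is the $T$-root system $\Omega_{G/H}\subset\mathbb R^k$, of rank $k$. Two $T$-root systems are isomorphic if related by a linear isomorphism. $\Omega$ is reducible if $\Omega=(\Omega\cap V_1)\cup(\Omega\cap V_2)$ for subspaces $V_1,V_2$ with $V_1\cap V_2=0$ and both $\Omega\cap V_i$ nonempty; otherwise irreducible. *)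

theory Defs
  imports "HOL-Analysis.Analysis" "HOL-Computational_Algebra.Group_Closure"
begin

section \<open>Compact simple Lie algebras, maximal tori and roots\<close>

text \<open>
  Lie groups are represented by their Lie algebras: a compact connected simple group by a
  real simple Lie algebra carrying an invariant inner product, namely the one inherited
  from the ambient Euclidean space. A Lie algebra is a subspace \<open>g\<close> of that space, with a bracket
  whose values outside \<open>g\<close> are irrelevant.
\<close>

locale compact_simple_lie_algebra =
  fixes br :: "'a::euclidean_space \<Rightarrow> 'a \<Rightarrow> 'a" and g :: "'a set"
  assumes subspace: "subspace g"
    and closed: "\<lbrakk>x \<in> g; y \<in> g\<rbrakk> \<Longrightarrow> br x y \<in> g"
    and add_left: "\<lbrakk>x \<in> g; y \<in> g; z \<in> g\<rbrakk> \<Longrightarrow> br (x + y) z = br x z + br y z"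
    and add_right: "\<lbrakk>x \<in> g; y \<in> g; z \<in> g\<rbrakk> \<Longrightarrow> br x (y + z) = br x y + br x z"
    and scale_left: "\<lbrakk>x \<in> g; y \<in> g\<rbrakk> \<Longrightarrow> br (c *\<^sub>R x) y = c *\<^sub>R br x y"
    and scale_right: "\<lbrakk>x \<in> g; y \<in> g\<rbrakk> \<Longrightarrow> br x (c *\<^sub>R y) = c *\<^sub>R br x y"
    and alternating: "x \<in> g \<Longrightarrow> br x x = 0"
    and jacobi: "\<lbrakk>x \<in> g; y \<in> g; z \<in> g\<rbrakk> \<Longrightarrow>
      br x (br y z) + br y (br z x) + br z (br x y) = 0"
    and invariant: "\<lbrakk>x \<in> g; y \<in> g; z \<in> g\<rbrakk> \<Longrightarrow> br x y \<bullet> z = x \<bullet> br y z"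
    and nonabelian: "\<exists>x\<in>g. \<exists>y\<in>g. br x y \<noteq> 0"
    and simple: "\<lbrakk>subspace I; I \<subseteq> g; \<And>x y. x \<in> g \<Longrightarrow> y \<in> I \<Longrightarrow> br x y \<in> I\<rbrakk> \<Longrightarrow>
      I = {0} \<or> I = g"

definition abelian_subalgebra :: "('a::euclidean_space \<Rightarrow> 'a \<Rightarrow> 'a) \<Rightarrow> 'a set \<Rightarrow> 'a set \<Rightarrow> bool" where
  "abelian_subalgebra br g u \<longleftrightarrow> subspace u \<and> u \<subseteq> g \<and> (\<forall>x\<in>u. \<forall>y\<in>u. br x y = 0)"

text \<open>The Lie algebras of maximal tori are the maximal abelian subalgebras.\<close>

definition maximal_torus :: "('a::euclidean_space \<Rightarrow> 'a \<Rightarrow> 'a) \<Rightarrow> 'a set \<Rightarrow> 'a set \<Rightarrow> bool" where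
  "maximal_torus br g t \<longleftrightarrow> abelian_subalgebra br g t \<and>
     (\<forall>u. abelian_subalgebra br g u \<and> t \<subseteq> u \<longrightarrow> u = t)"

text \<open>
  The roots of a \<open>t\<close>-stable subspace \<open>m\<close> are the nonzero weights of \<open>t\<close> on its
  complexification. A weight has the form \<open>h \<mapsto> \<i> (\<alpha> \<bullet> h)\<close> with \<open>\<alpha> \<in> t\<close>, which the inner product
  identifies with a linear functional on \<open>t\<close>. The two equations are the real
  and imaginary parts of \<open>[h, X + \<i> Y] = \<i> (\<alpha> \<bullet> h) (X + \<i> Y)\<close>.
\<close>

definition lie_roots :: "('a::euclidean_space \<Rightarrow> 'a \<Rightarrow> 'a) \<Rightarrow> 'a set \<Rightarrow> 'a set \<Rightarrow> 'a set" where
  "lie_roots br t m = {\<alpha> \<in> t. \<alpha> \<noteq> 0 \<and>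
     (\<exists>X\<in>m. \<exists>Y\<in>m. (X, Y) \<noteq> (0, 0) \<and>
       (\<forall>h\<in>t. br h X = - ((\<alpha> \<bullet> h) *\<^sub>R Y) \<and> br h Y = (\<alpha> \<bullet> h) *\<^sub>R X))}"

definition derived_algebra :: "('a::euclidean_space \<Rightarrow> 'a \<Rightarrow> 'a) \<Rightarrow> 'a set \<Rightarrow> 'a set" where
  "derived_algebra br h = span {br x y | x y. x \<in> h \<and> y \<in> h}"

definition center_algebra :: "('a::euclidean_space \<Rightarrow> 'a \<Rightarrow> 'a) \<Rightarrow> 'a set \<Rightarrow> 'a set" where
  "center_algebra br h = {z \<in> h. \<forall>x\<in>h. br z x = 0}"

text \<open>
  The isotropy algebra \<open>h\<close> of a flag manifold \<open>G/H\<close> with \<open>T \<subseteq> H\<close> is the centralizer of the Lie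
  algebra \<open>s\<close> of a torus \<open>S \<subseteq> T\<close>. Allowing every subspace \<open>s\<close> of \<open>t\<close> gives no more centralizers,
  since \<open>exp s\<close> and its closure, a torus in \<open>T\<close>, have the same centralizer.
\<close>

definition flag_isotropy ::
    "('a::euclidean_space \<Rightarrow> 'a \<Rightarrow> 'a) \<Rightarrow> 'a set \<Rightarrow> 'a set \<Rightarrow> 'a set \<Rightarrow> bool" where
  "flag_isotropy br g t h \<longleftrightarrow>
     (\<exists>s. subspace s \<and> s \<subseteq> t \<and> h = {x \<in> g. \<forall>y\<in>s. br y x = 0})"


section \<open>T-root systems\<close>

text \<open>
  Let \<open>Q\<^sub>G\<close> and \<open>Q\<^sub>H\<close> be the lattices generated by the roots of \<open>g\<close> and of \<open>[h, h]\<close>. A linear map \<open>p\<close>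
  whose kernel on the real span of \<open>Q\<^sub>G\<close> is the real span of \<open>Q\<^sub>H\<close> is the same thing as
  a linear embedding of the real vector space \<open>\<real> \<otimes> (Q\<^sub>G/Q\<^sub>H)\<close>, sending \<open>x + Q\<^sub>H\<close> to \<open>p x\<close>.
  As only linear isomorphism classes matter, a T-root system is the image of
  the T-roots under any such embedding into a fixed Euclidean space; all ranks are at most 8 here.
\<close>

definition T_root_system ::
    "('a::euclidean_space \<Rightarrow> 'a \<Rightarrow> 'a) \<Rightarrow> 'a set \<Rightarrow> 'a set \<Rightarrow> 'a set \<Rightarrow> (real^8) set \<Rightarrow> bool" where
  "T_root_system br g t h \<Omega> \<longleftrightarrow>
     (let R = lie_roots br t g;
          Q\<^sub>G = group_closure R;
          Q\<^sub>H = group_closure (lie_roots br t (derived_algebra br h))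
      in \<exists>p. linear p \<and> (\<forall>x\<in>span Q\<^sub>G. p x = 0 \<longleftrightarrow> x \<in> span Q\<^sub>H) \<and>
             \<Omega> = p ` {\<alpha> \<in> R. \<alpha> \<notin> Q\<^sub>H})"

definition linearly_isomorphic :: "'a::real_vector set \<Rightarrow> 'b::real_vector set \<Rightarrow> bool" where
  "linearly_isomorphic \<Omega> \<Omega>' \<longleftrightarrow> (\<exists>f. linear f \<and> inj_on f (span \<Omega>) \<and> f ` \<Omega> = \<Omega>')"

definition T_iso :: "((real^8) set) rel" where
  "T_iso = {(\<Omega>, \<Omega>'). linearly_isomorphic \<Omega> \<Omega>'}"

definition reducible_system :: "'a::real_vector set \<Rightarrow> bool" where
  "reducible_system \<Omega> \<longleftrightarrow> (\<exists>V\<^sub>1 V\<^sub>2. subspace V\<^sub>1 \<and> subspace V\<^sub>2 \<and> V\<^sub>1 \<inter> V\<^sub>2 = {0} \<and>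
     \<Omega> = (\<Omega> \<inter> V\<^sub>1) \<union> (\<Omega> \<inter> V\<^sub>2) \<and> \<Omega> \<inter> V\<^sub>1 \<noteq> {} \<and> \<Omega> \<inter> V\<^sub>2 \<noteq> {})"

definition half_card :: "'a set \<Rightarrow> real" where
  "half_card \<Omega> = real (card \<Omega>) / 2"


section \<open>Root systems by type\<close>

text \<open>
  Everything is placed in one 8-dimensional space, so \<open>TA n\<close> is meaningful for \<open>n \<le> 7\<close> only, and
  \<open>TB n\<close>, \<open>TC n\<close>, \<open>TD n\<close> for \<open>n \<le> 8\<close> only. The index type \<open>8\<close> has
  the elements 0, ..., 7, so \<open>\<epsilon> 0, ..., \<epsilon> 7\<close> is the standard basis.
\<close>

datatype simple_type = TA nat | TB nat | TC nat | TD nat | TE6 | TE7 | TE8 | TF4 | TG2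

definition exceptional_types :: "simple_type set" where
  "exceptional_types = {TE6, TE7, TE8, TF4, TG2}"

definition \<epsilon> :: "nat \<Rightarrow> real^8" where
  "\<epsilon> i = axis (of_nat i) 1"

definition std_D :: "nat \<Rightarrow> (real^8) set" where
  "std_D n = {a *\<^sub>R \<epsilon> i + b *\<^sub>R \<epsilon> j | a b i j. i < j \<and> j < n \<and> a \<in> {1, -1} \<and> b \<in> {1, -1}}"

definition std_B :: "nat \<Rightarrow> (real^8) set" where
  "std_B n = std_D n \<union> {a *\<^sub>R \<epsilon> i | a i. i < n \<and> a \<in> {1, -1}}"

definition std_C :: "nat \<Rightarrow> (real^8) set" where
  "std_C n = std_D n \<union> {a *\<^sub>R \<epsilon> i | a i. i < n \<and> a \<in> {2, -2}}"

definition std_A :: "nat \<Rightarrow> (real^8) set" where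
  "std_A n = {\<epsilon> i - \<epsilon> j | i j. i \<le> n \<and> j \<le> n \<and> i \<noteq> j}"

definition std_E8 :: "(real^8) set" where
  "std_E8 = std_D 8 \<union> {(\<Sum>i<8. s i *\<^sub>R \<epsilon> i) | s.
     (\<forall>i<8. s i \<in> {1/2, -1/2}) \<and> even (card {i. i < 8 \<and> s i = -1/2})}"

fun std_roots :: "simple_type \<Rightarrow> (real^8) set" where
  "std_roots (TA n) = std_A n"
| "std_roots (TB n) = std_B n"
| "std_roots (TC n) = std_C n"
| "std_roots (TD n) = std_D n"
| "std_roots TE6 = {\<alpha> \<in> std_E8. \<alpha> \<bullet> (\<epsilon> 5 - \<epsilon> 6) = 0 \<and> \<alpha> \<bullet> (\<epsilon> 6 + \<epsilon> 7) = 0}"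
| "std_roots TE7 = {\<alpha> \<in> std_E8. \<alpha> \<bullet> (\<epsilon> 6 + \<epsilon> 7) = 0}"
| "std_roots TE8 = std_E8"
| "std_roots TF4 = std_B 4 \<union> {(\<Sum>i<4. s i *\<^sub>R \<epsilon> i) | s. \<forall>i<4. s i \<in> {1/2, -1/2}}"
| "std_roots TG2 = std_A 2 \<union>
     {a *\<^sub>R (2 *\<^sub>R \<epsilon> i - \<epsilon> j - \<epsilon> k) | a i j k. {i, j, k} = {0, 1, 2} \<and> a \<in> {1, -1}}"

text \<open>Orthogonal unions of simple systems, the list giving the types of the components.\<close>

fun has_type :: "'a::euclidean_space set \<Rightarrow> simple_type list \<Rightarrow> bool" where
  "has_type R [] \<longleftrightarrow> R = {}"
| "has_type R (X # Xs) \<longleftrightarrow> (\<exists>R\<^sub>1 R\<^sub>2. R = R\<^sub>1 \<union> R\<^sub>2 \<and> (\<forall>\<alpha>\<in>R\<^sub>1. \<forall>\<beta>\<in>R\<^sub>2. \<alpha> \<bullet> \<beta> = 0) \<and>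
     linearly_isomorphic R\<^sub>1 (std_roots X) \<and> has_type R\<^sub>2 Xs)"

definition is_compact_simple_of_type ::
    "simple_type \<Rightarrow> ('a::euclidean_space \<Rightarrow> 'a \<Rightarrow> 'a) \<Rightarrow> 'a set \<Rightarrow> 'a set \<Rightarrow> bool" where
  "is_compact_simple_of_type L br g t \<longleftrightarrow> compact_simple_lie_algebra br g \<and>
     maximal_torus br g t \<and> has_type (lie_roots br t g) [L]"

text \<open>\<open>H\<close> is locally \<open>T\<^sup>k S\<close>: \<open>k\<close> is the dimension of its center, \<open>S\<close> the type of \<open>[H, H]\<close>.\<close>

definition isotropy_type ::
    "('a::euclidean_space \<Rightarrow> 'a \<Rightarrow> 'a) \<Rightarrow> 'a set \<Rightarrow> 'a set \<Rightarrow> nat \<Rightarrow> simple_type list \<Rightarrow> bool" where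
  "isotropy_type br t h k S \<longleftrightarrow> dim (center_algebra br h) = k \<and>
     has_type (lie_roots br t (derived_algebra br h)) S"

text \<open>The Weyl group permutes the pairs of opposite long roots of \<open>C\<^sub>3\<close>; we remove \<open>\<plusminus>2\<epsilon>\<^sub>0\<close>.\<close>

definition C3_2 :: "(real^8) set" where
  "C3_2 = std_roots (TC 3) - {2 *\<^sub>R \<epsilon> 0, - (2 *\<^sub>R \<epsilon> 0)}"

definition B3_v :: "(real^8) set" where
  "B3_v = (let v = \<epsilon> 0 + \<epsilon> 1 + \<epsilon> 2 in std_roots (TB 3) \<union> {v, - v})"

end

(* The roots are described by their integer coordinates with respect to a basis of simple roots.
   The roots of the derived algebra of the centralizer of s are the roots orthogonal to s, hence
   the zeros of one generic functional y in s. A chart, i.e. a system of simple roots, on which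
   the value of y at the sum of the positive roots is maximal makes y nonnegative on all
   simple roots; in this chart the zeros of y are the roots supported off a set K of nodes of
   the Dynkin diagram. So the T-root system is the set of nonzero restrictions of the coordinate
   vectors to K, and there are finitely many cases (L, K) to compute: either more than ten pairs
   of opposite restrictions are exhibited, or an explicit matrix identifies the system with one
   of sixteen models, which are told apart by their rank, their cardinality and the number of
   vectors a such that 2a is also a T-root.

   The type of the isotropy algebra is visible to the models as follows. Root spaces show that two
   roots are orthogonal if their sum and difference are neither roots nor zero, which splits the
   roots off K orthogonally. Conversely the number of these roots determines K up to the choice of an
   isomorphic T-root system, except for A3 A3 versus A4 A1 A1 in E8, where the latter
   contains a root that is not a difference of two roots. *)
theory Submission
  imports Defs
begin

section \<open>Root systems of compact Lie algebras with a maximal torus\<close>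

text \<open>The hypothesis on the type provides only a linear isomorphism from the roots onto a
  standard system, not an isometry. The angles of the model therefore say nothing about the inner
  product of \<open>t\<close>, and everything that is transported has to be linear: simple
  reflections are written with Cartan integers, systems are compared by a matrix with a left
  inverse, and only dimension, cardinality and linear relations serve as invariants. The inner
  product of \<open>t\<close> is used directly: \<open>s\<close> provides a functional and
  orthogonal complements in \<open>t\<close>, and the orthogonality of components that a type
  demands is recovered from brackets.

  Two facts are not contained in the list of roots: the roots span \<open>t\<close>, and the center
  of a centralizer is as large as its roots permit. Both rest on one existence statement, that an
  element of \<open>t\<close> acting nontrivially on a centralizer is detected by a root of this
  centralizer. It is proved over the reals, with a symmetric operator on a minimal invariant
  subspace in place of complex eigenvectors.\<close>

lemma symmetric_operator_eigenvector:
  fixes W :: "'a::euclidean_space set"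
  assumes W: "subspace W" "W \<noteq> {0}"
    and A: "linear A" "A ` W \<subseteq> W"
    and sym: "\<And>x y. x \<in> W \<Longrightarrow> y \<in> W \<Longrightarrow> A x \<bullet> y = x \<bullet> A y"
  obtains v \<mu> where "v \<in> W" "v \<noteq> 0" "A v = \<mu> *\<^sub>R v"
proof -
  define S where "S = W \<inter> sphere 0 1"
  obtain w where w: "w \<in> W" "w \<noteq> 0" using W subspace_0 by blast
  have "(1 / norm w) *\<^sub>R w \<in> S" using w W unfolding S_def by (auto simp: subspace_scale)
  then have ne: "S \<noteq> {}" by blast
  have cp: "compact S" unfolding S_def
    by (simp add: closed_Int_compact closed_subspace W)
  have cont: "continuous_on S (\<lambda>x. A x \<bullet> x)"
    by (intro continuous_intros linear_continuous_on) (simp add: A linear_linear)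
  \<comment> \<open>A maximizer of the Rayleigh quotient on the unit sphere is an eigenvector:
    otherwise the component \<open>u\<close> of \<open>A v\<close> orthogonal to \<open>v\<close> is
    a direction in which the quotient grows to first order.\<close>
  obtain v where v: "v \<in> S" and mx: "\<And>y. y \<in> S \<Longrightarrow> A y \<bullet> y \<le> A v \<bullet> v"
    using continuous_attains_sup[OF cp ne cont] by blast
  define \<mu> where "\<mu> = A v \<bullet> v"
  have vW: "v \<in> W" and nv: "norm v = 1" using v by (auto simp: S_def)
  have vv: "v \<bullet> v = 1" using nv by (simp add: norm_eq_sqrt_inner)
  have le: "A y \<bullet> y \<le> \<mu> * (y \<bullet> y)" if "y \<in> W" for y
  proof (cases "y = 0")
    case True then show ?thesis using A by (simp add: linear_0)
  next
    case False
    have "(1 / norm y) *\<^sub>R y \<in> S" using that False W by (auto simp: S_def subspace_scale)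
    from mx[OF this] have "(1 / norm y) * ((1 / norm y) * (A y \<bullet> y)) \<le> \<mu>"
      using A by (simp add: linear_scale \<mu>_def)
    then show ?thesis using False
      by (simp add: field_simps norm_eq_sqrt_inner flip: power2_eq_square)
  qed
  define u where "u = A v - \<mu> *\<^sub>R v"
  have uW: "u \<in> W" unfolding u_def using A W vW by (intro subspace_diff subspace_scale) auto
  have uv: "u \<bullet> v = 0" by (simp add: u_def inner_diff_left vv \<mu>_def)
  have AvU: "A v \<bullet> u = u \<bullet> u" using uv by (simp add: u_def inner_diff_left inner_diff_right algebra_simps inner_commute)
  have "u = 0"
  proof (rule ccontr)
    assume "u \<noteq> 0"
    then have uu: "u \<bullet> u > 0" by simp
    define k where "k = \<bar>A u \<bullet> u\<bar> + \<bar>\<mu>\<bar> * (u \<bullet> u)"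
    \<comment> \<open>With this \<open>e\<close> the first order gain \<open>2 e (u . u)\<close>
      exceeds the second order loss, which is at most \<open>e^2 k\<close>; the summand 1 keeps the
      denominator positive.\<close>
    define e where "e = (u \<bullet> u) / (k + 1)"
    have k0: "k \<ge> 0" using uu by (simp add: k_def)
    have e: "e > 0" using uu k0 by (simp add: e_def)
    have 1: "A (v + e *\<^sub>R u) \<bullet> (v + e *\<^sub>R u) \<le> \<mu> * ((v + e *\<^sub>R u) \<bullet> (v + e *\<^sub>R u))"
      by (rule le) (use uW vW W in \<open>auto intro: subspace_add subspace_scale\<close>)
    have 2: "A (v + e *\<^sub>R u) \<bullet> (v + e *\<^sub>R u) = \<mu> + 2 * e * (u \<bullet> u) + e^2 * (A u \<bullet> u)"
      using A AvU sym[OF uW vW]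
      by (simp add: linear_add linear_scale inner_add_left inner_add_right \<mu>_def power2_eq_square inner_commute algebra_simps)
    have 3: "(v + e *\<^sub>R u) \<bullet> (v + e *\<^sub>R u) = 1 + e^2 * (u \<bullet> u)"
      using vv uv by (simp add: inner_add_left inner_add_right power2_eq_square inner_commute)
    have "2 * e * (u \<bullet> u) + e^2 * (A u \<bullet> u) \<le> e^2 * (\<mu> * (u \<bullet> u))"
      using 1[unfolded 2 3] by (simp add: algebra_simps)
    then have "e * (2 * (u \<bullet> u)) \<le> e * (e * (\<mu> * (u \<bullet> u) - A u \<bullet> u))"
      by (simp add: algebra_simps power2_eq_square)
    then have "2 * (u \<bullet> u) \<le> e * (\<mu> * (u \<bullet> u) - A u \<bullet> u)" using e by simp
    also have "\<dots> \<le> e * k"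
    proof -
      have "\<mu> * (u \<bullet> u) \<le> \<bar>\<mu>\<bar> * (u \<bullet> u)" using uu by (intro mult_right_mono) auto
      then show ?thesis using e unfolding k_def by (intro mult_left_mono) auto
    qed
    also have "\<dots> \<le> u \<bullet> u" unfolding e_def using k0 uu by (simp add: field_simps)
    finally show False using uu by simp
  qed
  moreover have "v \<noteq> 0" using nv by auto
  ultimately show ?thesis using that[of v \<mu>] vW by (simp add: u_def)
qed

locale compact_algebra_with_torus = compact_simple_lie_algebra br g
  for br :: "'a::euclidean_space \<Rightarrow> 'a \<Rightarrow> 'a" and g t :: "'a set" +
  assumes torus: "maximal_torus br g t"
begin

section \<open>Bracket identities and the maximal torus\<close>

abbreviation "R \<equiv> lie_roots br t g"

lemma subspace_t: "subspace t" and t_subset: "t \<subseteq> g" and t_abelian: "x \<in> t \<Longrightarrow> y \<in> t \<Longrightarrow> br x y = 0"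
  using torus by (auto simp: maximal_torus_def abelian_subalgebra_def)

lemma t_in_g: "x \<in> t \<Longrightarrow> x \<in> g" using t_subset by blast

lemma br_zero_left: "x \<in> g \<Longrightarrow> br 0 x = 0"
  using scale_left[of x x 0] by simp

lemma br_zero_right: "x \<in> g \<Longrightarrow> br x 0 = 0"
  using scale_right[of x x 0] by simp

lemma br_anti: assumes "x \<in> g" "y \<in> g" shows "br x y = - br y x"
proof -
  have "br (x + y) (x + y) = 0" using assms by (simp add: alternating subspace_add[OF subspace])
  then have "br x x + br x y + (br y x + br y y) = 0"
    using assms by (simp add: add_left add_right subspace_add[OF subspace] algebra_simps)
  then show ?thesis using assms by (simp add: alternating eq_neg_iff_add_eq_0)
qed

lemma br_uminus_right: "x \<in> g \<Longrightarrow> y \<in> g \<Longrightarrow> br x (- y) = - br x y"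
  using scale_right[of x y "-1"] by simp

lemma br_uminus_left: "x \<in> g \<Longrightarrow> y \<in> g \<Longrightarrow> br (- x) y = - br x y"
  using scale_left[of x y "-1"] by simp

lemma br_derivation: assumes "x \<in> g" "y \<in> g" "z \<in> g"
  shows "br x (br y z) = br (br x y) z + br y (br x z)"
proof -
  have "br x (br y z) + br y (br z x) + br z (br x y) = 0" using assms jacobi by blast
  moreover have "br y (br z x) = - br y (br x z)"
    using br_anti[of z x] br_uminus_right[of y "br x z"] assms closed by simp
  moreover have "br z (br x y) = - br (br x y) z"
    using br_anti[of z "br x y"] assms closed by simp
  ultimately show ?thesis by (simp add: algebra_simps)
qed

lemma br_skew: assumes "h \<in> g" "x \<in> g" "y \<in> g" shows "br h x \<bullet> y = - (x \<bullet> br h y)"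
  using br_anti[of h x] invariant[of x h y] assms by simp

text \<open>Adjoining \<open>x\<close> to \<open>t\<close> yields an abelian subalgebra again, which
  maximality forces to be \<open>t\<close>.\<close>

lemma torus_self_centralizing:
  assumes x: "x \<in> g" and c: "\<And>h. h \<in> t \<Longrightarrow> br h x = 0" shows "x \<in> t"
proof -
  let ?u = "span (insert x t)"
  have dec: "\<exists>k. \<exists>b\<in>t. y = k *\<^sub>R x + b" if yu: "y \<in> ?u" for y
  proof -
    obtain k where "y - k *\<^sub>R x \<in> span t" using yu span_breakdown_eq[of y x t] by blast
    then have "y - k *\<^sub>R x \<in> t" using subspace_t by (metis span_eq_iff)
    then show ?thesis by (intro exI[of _ k] bexI[of _ "y - k *\<^sub>R x"]) auto
  qed
  have c': "br x h = 0" if "h \<in> t" for h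
    using br_anti[of x h] x t_in_g[OF that] c[OF that] by simp
  have "?u \<subseteq> g" using x t_subset subspace span_minimal[of "insert x t" g] by blast
  moreover have "br y z = 0" if yz: "y \<in> ?u" "z \<in> ?u" for y z
  proof -
    obtain k b k' b' where *: "b \<in> t" "y = k *\<^sub>R x + b" "b' \<in> t" "z = k' *\<^sub>R x + b'"
      using dec yz by metis
    have g': "b \<in> g" "b' \<in> g" "k *\<^sub>R x \<in> g" "k' *\<^sub>R x \<in> g" "k' *\<^sub>R x + b' \<in> g"
      using * t_in_g x subspace by (auto intro: subspace_scale subspace_add)
    show ?thesis using * g' x
      by (simp add: add_left add_right scale_left scale_right alternating c c' t_abelian)
  qed
  ultimately have "abelian_subalgebra br g ?u" by (simp add: abelian_subalgebra_def)
  moreover have "t \<subseteq> ?u" by (meson insert_subset span_superset subset_insertI subset_trans)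
  ultimately have "?u = t" using torus by (simp add: maximal_torus_def)
  then show ?thesis using span_base[of x "insert x t"] by simp
qed

section \<open>Centralizers and real root vectors\<close>

definition centr :: "'a set \<Rightarrow> 'a set" where "centr s = {x \<in> g. \<forall>y\<in>s. br y x = 0}"

lemma subspace_centr: assumes "s \<subseteq> t" shows "subspace (centr s)"
  using assms subspace t_in_g unfolding subspace_def centr_def
  by (auto simp: br_zero_right add_right scale_right subset_iff)

lemma t_centr: "s \<subseteq> t \<Longrightarrow> t \<subseteq> centr s"
  using t_abelian t_subset by (auto simp: centr_def)

lemma centr_closed: assumes "s \<subseteq> t" "x \<in> centr s" "y \<in> centr s" shows "br x y \<in> centr s"
  unfolding centr_def
proof (safe)
  show "br x y \<in> g" using assms closed by (auto simp: centr_def)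
  fix z assume z: "z \<in> s"
  then have "z \<in> g" using assms t_in_g by blast
  then show "br z (br x y) = 0"
    using br_derivation[of z x y] assms z by (auto simp: centr_def br_zero_left br_zero_right)
qed

lemma derived_centr: assumes "s \<subseteq> t" shows "derived_algebra br (centr s) \<subseteq> centr s"
  unfolding derived_algebra_def
  by (rule span_minimal) (use assms centr_closed subspace_centr in auto)

text \<open>The real form of a weight vector \<open>X + i Y\<close>. It may be zero here, so that a
  bracket of weight vectors qualifies before anything is known about its weight.\<close>

definition weight_pair :: "'a \<Rightarrow> 'a \<Rightarrow> 'a \<Rightarrow> bool" where
  "weight_pair \<alpha> X Y \<longleftrightarrow> X \<in> g \<and> Y \<in> g \<and>
    (\<forall>h\<in>t. br h X = - ((\<alpha> \<bullet> h) *\<^sub>R Y) \<and> br h Y = (\<alpha> \<bullet> h) *\<^sub>R X)"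

text \<open>Bracketing with the root itself turns \<open>X\<close> into a nonzero multiple of
  \<open>Y\<close> and back, so neither entry of a nonzero pair can vanish.\<close>

lemma lie_rootsE: assumes "\<alpha> \<in> R"
  obtains X Y where "\<alpha> \<in> t" "\<alpha> \<noteq> 0" "weight_pair \<alpha> X Y" "X \<noteq> 0" "Y \<noteq> 0"
proof -
  obtain X Y where *: "\<alpha> \<in> t" "\<alpha> \<noteq> 0" "weight_pair \<alpha> X Y" and nz: "(X, Y) \<noteq> (0, 0)"
    using assms by (auto simp: lie_roots_def weight_pair_def)
  have eq: "br \<alpha> X = - ((\<alpha> \<bullet> \<alpha>) *\<^sub>R Y)" "br \<alpha> Y = (\<alpha> \<bullet> \<alpha>) *\<^sub>R X" "\<alpha> \<in> g" "X \<in> g" "Y \<in> g"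
    using * t_in_g by (auto simp: weight_pair_def)
  have "X \<noteq> 0"
  proof
    assume "X = 0" then show False using eq nz \<open>\<alpha> \<noteq> 0\<close> by (simp add: br_zero_right)
  qed
  moreover have "Y \<noteq> 0"
  proof
    assume "Y = 0" then show False using eq nz \<open>\<alpha> \<noteq> 0\<close> by (simp add: br_zero_right)
  qed
  ultimately show ?thesis using that * by blast
qed

lemma lie_rootsI: assumes "\<alpha> \<in> t" "\<alpha> \<noteq> 0" "weight_pair \<alpha> X Y" "X \<noteq> 0 \<or> Y \<noteq> 0"
  shows "\<alpha> \<in> R"
  using assms by (auto simp: lie_roots_def weight_pair_def)

lemma roots_subset_t: "R \<subseteq> t" and root_nonzero: "0 \<notin> R"
  by (auto simp: lie_roots_def)

text \<open>The root lies in \<open>t\<close>, hence in the centralizer, and bracketing with it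
  reproduces its root vectors up to a nonzero factor.\<close>

lemma weight_pair_in_derived:
  assumes s: "s \<subseteq> t" and a: "\<alpha> \<in> t" "\<alpha> \<noteq> 0" "weight_pair \<alpha> X Y" and perp: "\<forall>y\<in>s. \<alpha> \<bullet> y = 0"
  shows "X \<in> derived_algebra br (centr s)" "Y \<in> derived_algebra br (centr s)"
proof -
  have XY: "X \<in> centr s" "Y \<in> centr s" "\<alpha> \<in> centr s"
    using a perp s t_centr[OF s] by (auto simp: centr_def weight_pair_def subset_iff)
  have "br \<alpha> X = - ((\<alpha> \<bullet> \<alpha>) *\<^sub>R Y)" "br \<alpha> Y = (\<alpha> \<bullet> \<alpha>) *\<^sub>R X"
    using a by (auto simp: weight_pair_def)
  then have eq: "X = (1 / (\<alpha> \<bullet> \<alpha>)) *\<^sub>R br \<alpha> Y" "Y = (- 1 / (\<alpha> \<bullet> \<alpha>)) *\<^sub>R br \<alpha> X"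
    using \<open>\<alpha> \<noteq> 0\<close> by auto
  show "X \<in> derived_algebra br (centr s)"
    unfolding derived_algebra_def by (subst eq(1), intro span_scale span_base) (use XY in blast)
  show "Y \<in> derived_algebra br (centr s)"
    unfolding derived_algebra_def by (subst eq(2), intro span_scale span_base) (use XY in blast)
qed

lemma roots_derived_centr: assumes s: "s \<subseteq> t"
  shows "lie_roots br t (derived_algebra br (centr s)) = {\<alpha> \<in> R. \<forall>y\<in>s. \<alpha> \<bullet> y = 0}"
proof (intro set_eqI iffI)
  fix \<alpha> assume "\<alpha> \<in> lie_roots br t (derived_algebra br (centr s))"
  then obtain X Y where *: "\<alpha> \<in> t" "\<alpha> \<noteq> 0" "X \<in> derived_algebra br (centr s)"
    "Y \<in> derived_algebra br (centr s)" "(X, Y) \<noteq> (0, 0)"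
    "\<And>h. h \<in> t \<Longrightarrow> br h X = - ((\<alpha> \<bullet> h) *\<^sub>R Y) \<and> br h Y = (\<alpha> \<bullet> h) *\<^sub>R X"
    unfolding lie_roots_def by blast
  then have XY: "X \<in> centr s" "Y \<in> centr s" using derived_centr[OF s] by auto
  then have "\<alpha> \<in> R" using * by (auto intro!: lie_rootsI[of \<alpha> X Y] simp: weight_pair_def centr_def)
  moreover have "\<alpha> \<bullet> y = 0" if "y \<in> s" for y
  proof -
    have "br y X = 0" "br y Y = 0" using XY that by (auto simp: centr_def)
    then show ?thesis using *(5) *(6)[of y] that s by auto
  qed
  ultimately show "\<alpha> \<in> {\<alpha> \<in> R. \<forall>y\<in>s. \<alpha> \<bullet> y = 0}" by blast
next
  fix \<alpha> assume a: "\<alpha> \<in> {\<alpha> \<in> R. \<forall>y\<in>s. \<alpha> \<bullet> y = 0}"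
  then obtain X Y where *: "\<alpha> \<in> t" "\<alpha> \<noteq> 0" "weight_pair \<alpha> X Y" "X \<noteq> 0" using lie_rootsE by blast
  then show "\<alpha> \<in> lie_roots br t (derived_algebra br (centr s))"
    using weight_pair_in_derived[OF s *(1-3)] a unfolding lie_roots_def weight_pair_def by blast
qed

text \<open>
  A smallest nonzero \<open>t\<close>-stable subspace of the image of \<open>ad z\<close> is a root plane: on it every
  symmetric operator commuting with \<open>t\<close>, in particular \<open>ad h \<circ> ad z\<close>, is a scalar.
\<close>

lemma perp_roots_central:
  assumes s: "s \<subseteq> t" and z: "z \<in> t"
    and perp: "\<And>\<alpha>. \<alpha> \<in> R \<Longrightarrow> \<forall>y\<in>s. \<alpha> \<bullet> y = 0 \<Longrightarrow> \<alpha> \<bullet> z = 0"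
    and x: "x \<in> centr s"
  shows "br z x = 0"
proof (rule ccontr)
  assume nz: "br z x \<noteq> 0"
  have zg: "z \<in> g" using z t_in_g by blast
  have cg: "y \<in> g" if "y \<in> centr s" for y using that by (simp add: centr_def)
  have tc: "h \<in> centr s" if "h \<in> t" for h using that t_centr[OF s] by blast
  have sc: "subspace (centr s)" by (rule subspace_centr[OF s])
  let ?W0 = "(\<lambda>y. br z y) ` centr s"
  define stable where "stable W \<longleftrightarrow> subspace W \<and> (\<forall>h\<in>t. \<forall>w\<in>W. br h w \<in> W)" for W
  have comm: "br h (br z y) = br z (br h y)" if "h \<in> t" "y \<in> g" for h y
    using br_derivation[of h z y] that z zg t_in_g by (simp add: t_abelian br_zero_left closed)
  have commh: "br h (br h' y) = br h' (br h y)" if "h \<in> t" "h' \<in> t" "y \<in> g" for h h' y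
    using br_derivation[of h h' y] that t_in_g by (simp add: t_abelian br_zero_left closed)
  have W0: "stable ?W0" unfolding stable_def
  proof (intro conjI ballI)
    show "subspace ?W0" unfolding subspace_def
    proof (intro conjI ballI allI)
      show "0 \<in> ?W0" using br_zero_right[OF zg] subspace_0[OF sc] by (auto intro!: image_eqI[of _ _ 0])
    next
      fix a b assume "a \<in> ?W0" "b \<in> ?W0"
      then obtain a' b' where "a' \<in> centr s" "b' \<in> centr s" "a = br z a'" "b = br z b'" by blast
      then show "a + b \<in> ?W0"
        using add_right[of z a' b'] zg cg subspace_add[OF sc] by (auto intro!: image_eqI[of _ _ "a' + b'"])
    next
      fix c a assume "a \<in> ?W0"
      then obtain a' where "a' \<in> centr s" "a = br z a'" by blast
      then show "c *\<^sub>R a \<in> ?W0"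
        using scale_right[of z a' c] zg cg subspace_scale[OF sc] by (auto intro!: image_eqI[of _ _ "c *\<^sub>R a'"])
    qed
    fix h w assume "h \<in> t" "w \<in> ?W0"
    then obtain y where y: "y \<in> centr s" "w = br z y" by blast
    then have "br h w = br z (br h y)" using comm[of h y] \<open>h \<in> t\<close> cg by simp
    moreover have "br h y \<in> centr s" using centr_closed[OF s] tc \<open>h \<in> t\<close> y by blast
    ultimately show "br h w \<in> ?W0" by blast
  qed
  define P where "P W \<longleftrightarrow> stable W \<and> W \<subseteq> ?W0 \<and> W \<noteq> {0}" for W
  have "P ?W0" using W0 nz x by (auto simp: P_def)
  then obtain W where W: "P W" and min: "\<And>W'. P W' \<Longrightarrow> dim W \<le> dim W'"
    using ex_has_least_nat[of P ?W0 dim] by blast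
  have sW: "subspace W" and W0': "W \<subseteq> ?W0" and Wn: "W \<noteq> {0}"
    and st: "\<And>h w. h \<in> t \<Longrightarrow> w \<in> W \<Longrightarrow> br h w \<in> W"
    using W by (auto simp: P_def stable_def)
  have "?W0 \<subseteq> centr s" using centr_closed[OF s tc[OF z]] by blast
  then have Wc: "w \<in> centr s" if "w \<in> W" for w using that W0' by blast
  then have Wg: "w \<in> g" if "w \<in> W" for w using that cg by blast
  have scalar: "\<exists>\<nu>. \<forall>w\<in>W. br h (br z w) = \<nu> *\<^sub>R w" if h: "h \<in> t" for h
  proof -
    have hg: "h \<in> g" using h t_in_g by blast
    let ?B = "\<lambda>w. br h (br z w)"
    \<comment> \<open>\<open>br\<close> is linear on \<open>g\<close> only, while eigenvectors were
      found for maps that are linear on the whole space; hence the extension from a basis of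
      \<open>W\<close>.\<close>
    obtain A where A: "linear A" and AB: "\<And>w. w \<in> W \<Longrightarrow> A w = ?B w"
    proof -
      obtain B where B: "B \<subseteq> W" "independent B" "W \<subseteq> span B" "card B = dim W"
        using basis_exists by blast
      have spB: "span B = W" by (rule span_subspace[OF B(1,3) sW])
      obtain A where A: "linear A" "\<forall>b\<in>B. A b = ?B b"
        using linear_independent_extend[OF B(2), of ?B] by auto
      have "w \<in> span B \<and> A w = ?B w" if "w \<in> span B" for w
        using that
      proof (induction rule: span_induct_alt)
        case base then show ?case using A zg hg by (simp add: linear_0 br_zero_right span_zero)
      next
        case (step c x y)
        then have "x \<in> g" "y \<in> g" "c *\<^sub>R x \<in> g" "c *\<^sub>R x + y \<in> span B"
          using B Wg spB subspace by (auto intro: subspace_scale span_add span_scale span_base)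
        then show ?case using step A zg hg
          by (simp add: linear_add linear_scale add_right scale_right closed subspace_scale[OF subspace])
      qed
      then show ?thesis using that A spB by blast
    qed
    have "A ` W \<subseteq> W" using AB st h z by auto
    moreover have "A u \<bullet> v = u \<bullet> A v" if "u \<in> W" "v \<in> W" for u v
      using that AB br_skew[of h "br z u" v] br_skew[of z u "br h v"] comm[OF h, of v] Wg hg zg
      by (simp add: closed)
    ultimately obtain v \<mu> where v: "v \<in> W" "v \<noteq> 0" "A v = \<mu> *\<^sub>R v"
      using symmetric_operator_eigenvector[OF sW Wn A] by blast
    \<comment> \<open>An eigenspace of an operator commuting with \<open>t\<close> is stable under
      \<open>t\<close>, so minimality turns this one into all of \<open>W\<close>.\<close>
    define U where "U = {w \<in> W. A w = \<mu> *\<^sub>R w}"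
    have sU: "subspace U" using A sW unfolding U_def subspace_def
      by (auto simp: linear_0 linear_add linear_scale algebra_simps)
    have "br h' w \<in> U" if "h' \<in> t" "w \<in> U" for h' w
    proof -
      have w: "w \<in> W" "A w = \<mu> *\<^sub>R w" using that by (auto simp: U_def)
      have "A (br h' w) = br h (br z (br h' w))" using AB st that w by simp
      also have "\<dots> = br h' (br h (br z w))"
        using comm[OF that(1), of w] commh[OF that(1) h, of "br z w"] Wg[OF w(1)] zg by (simp add: closed)
      also have "\<dots> = \<mu> *\<^sub>R br h' w"
        using AB[OF w(1)] w scale_right[of h' w \<mu>] t_in_g[OF that(1)] Wg by simp
      finally show ?thesis using st that w by (simp add: U_def)
    qed
    then have "P U" using sU v W0' by (auto simp: P_def stable_def U_def)
    then have "U = W" using min sU sW by (intro subspace_dim_equal) (auto simp: U_def)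
    then show ?thesis using AB by (intro exI[of _ \<mu>]) (metis (mono_tags, lifting) U_def mem_Collect_eq)
  qed
  then obtain \<nu> where \<nu>: "\<And>h w. h \<in> t \<Longrightarrow> w \<in> W \<Longrightarrow> br h (br z w) = \<nu> h *\<^sub>R w" by metis
  obtain X where X: "X \<in> W" "X \<noteq> 0" using Wn subspace_0[OF sW] by blast
  have Xg: "X \<in> g" using X Wg by blast
  \<comment> \<open>\<open>X\<close> is a value of the skew operator \<open>br z\<close>, and image
    and kernel of a skew operator meet only in zero.\<close>
  have zX: "br z X \<noteq> 0"
  proof
    assume 0: "br z X = 0"
    obtain y where y: "y \<in> centr s" "X = br z y" using X W0' by blast
    have "X \<bullet> X = - (y \<bullet> br z X)" using y br_skew[of z y X] zg cg Xg by simp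
    then show False using 0 X by simp
  qed
  \<comment> \<open>On \<open>W\<close> the square of \<open>br z\<close> is the negative scalar
    \<open>\<nu> z\<close>, so \<open>X\<close> and \<open>br z X / c\<close> are rotated into each
    other with speed \<open>c\<close>.\<close>
  define c where "c = sqrt (- \<nu> z)"
  have "\<nu> z * (X \<bullet> X) = br z (br z X) \<bullet> X" using \<nu>[OF z X(1)] by simp
  also have "\<dots> = - (br z X \<bullet> br z X)" using br_skew[of z "br z X" X] zg Xg closed by simp
  also have "\<dots> < 0" using zX by simp
  finally have "\<nu> z < 0" by (metis inner_ge_zero linorder_not_less mult_less_0_iff)
  then have c: "c > 0" "c * c = - \<nu> z" by (auto simp: c_def)
  define Y where "Y = (1 / c) *\<^sub>R br z X"
  have Yg: "Y \<in> g" unfolding Y_def using closed zg Xg subspace by (simp add: subspace_scale)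
  \<comment> \<open>Invariance represents the form \<open>\<nu>\<close> by a vector:
    \<open>\<nu> h (X . X) = [h, [z, X]] . X = h . [[z, X], X]\<close>. Only the component in
    \<open>t\<close> counts, and up to scaling it is the root sought.\<close>
  define v where "v = br (br z X) X"
  obtain a b where ab: "a \<in> span t" "\<And>w. w \<in> span t \<Longrightarrow> orthogonal b w" "v = a + b"
    using orthogonal_subspace_decomp_exists[of t v] by metis
  have at: "a \<in> t" using ab subspace_t by (metis span_eq_iff)
  have av: "h \<bullet> v = h \<bullet> a" if "h \<in> t" for h
    using ab(2)[of h] that ab(3) by (simp add: span_base orthogonal_def inner_add_right inner_commute)
  have \<nu>a: "\<nu> h * (X \<bullet> X) = h \<bullet> a" if h: "h \<in> t" for h
    using invariant[of h "br z X" X] \<nu>[OF h X(1)] av[OF h] t_in_g[OF h] zg Xg closed by (simp add: v_def)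
  define \<alpha> where "\<alpha> = (1 / (c * (X \<bullet> X))) *\<^sub>R a"
  have \<alpha>h: "\<alpha> \<bullet> h = \<nu> h / c" if h: "h \<in> t" for h
  proof -
    have "\<alpha> \<bullet> h = (\<nu> h * (X \<bullet> X)) / (c * (X \<bullet> X))" using \<nu>a[OF h] by (simp add: \<alpha>_def inner_commute)
    then show ?thesis using X c by simp
  qed
  have \<alpha>t: "\<alpha> \<in> t" using at subspace_t by (simp add: \<alpha>_def subspace_scale)
  have wp: "weight_pair \<alpha> X Y" unfolding weight_pair_def
  proof (intro conjI ballI)
    fix h assume h: "h \<in> t"
    have hg: "h \<in> g" using h t_in_g by blast
    have "br h Y = (1 / c) *\<^sub>R br h (br z X)" unfolding Y_def using scale_right hg closed zg Xg by blast
    also have "\<dots> = (\<alpha> \<bullet> h) *\<^sub>R X" using \<nu>[OF h X(1)] \<alpha>h[OF h] by simp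
    finally show "br h Y = (\<alpha> \<bullet> h) *\<^sub>R X" .
    have "X = (1 / \<nu> z) *\<^sub>R br z (br z X)" using \<nu>[OF z X(1)] \<open>\<nu> z < 0\<close> by simp
    then have "br h X = (1 / \<nu> z) *\<^sub>R br h (br z (br z X))"
      using scale_right[of h "br z (br z X)" "1 / \<nu> z"] hg closed zg Xg by metis
    also have "br h (br z (br z X)) = br z (br h (br z X))" using comm h closed zg Xg by simp
    also have "\<dots> = \<nu> h *\<^sub>R br z X" using \<nu>[OF h X(1)] scale_right zg Xg by simp
    also have "br z X = c *\<^sub>R Y" using c by (simp add: Y_def)
    finally have "br h X = (1 / \<nu> z * \<nu> h * c) *\<^sub>R Y" by simp
    moreover have "\<nu> z = - (c * c)" using c by simp
    then have "1 / \<nu> z * \<nu> h * c = - (\<nu> h / c)" using c(1) by (simp add: field_simps)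
    ultimately show "br h X = - ((\<alpha> \<bullet> h) *\<^sub>R Y)" using \<alpha>h[OF h] by simp
  qed (use Xg Yg in auto)
  have "\<alpha> \<bullet> z \<noteq> 0" using \<alpha>h[OF z] \<open>\<nu> z < 0\<close> c by simp
  then have "\<alpha> \<noteq> 0" by auto
  then have "\<alpha> \<in> R" using lie_rootsI[OF \<alpha>t _ wp] X by blast
  moreover have "\<alpha> \<bullet> y = 0" if "y \<in> s" for y
  proof -
    have yt: "y \<in> t" using that s by blast
    have "Y \<in> centr s" unfolding Y_def using sc Wc st z X by (simp add: subspace_scale)
    then have "br y Y = 0" using that by (simp add: centr_def)
    then show ?thesis using wp yt X by (auto simp: weight_pair_def)
  qed
  ultimately show False using perp \<open>\<alpha> \<bullet> z \<noteq> 0\<close> by blast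
qed

text \<open>A central element commutes with \<open>t\<close>, so it lies in \<open>t\<close>, and it
  annihilates the root vectors of the centralizer. That nothing else obstructs centrality is
  \<open>perp_roots_central\<close>.\<close>

lemma center_centr: assumes s: "s \<subseteq> t"
  shows "center_algebra br (centr s) = {z \<in> t. \<forall>\<alpha>\<in>R. (\<forall>y\<in>s. \<alpha> \<bullet> y = 0) \<longrightarrow> \<alpha> \<bullet> z = 0}"
proof (intro set_eqI iffI)
  fix z assume "z \<in> center_algebra br (centr s)"
  then have z: "z \<in> centr s" "\<And>x. x \<in> centr s \<Longrightarrow> br z x = 0" by (auto simp: center_algebra_def)
  have zg: "z \<in> g" using z by (simp add: centr_def)
  have "br h z = 0" if "h \<in> t" for h
    using br_anti[of h z] zg t_in_g[OF that] z(2)[of h] t_centr[OF s] that by auto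
  then have zt: "z \<in> t" using torus_self_centralizing zg by blast
  have "\<alpha> \<bullet> z = 0" if "\<alpha> \<in> R" and p: "\<forall>y\<in>s. \<alpha> \<bullet> y = 0" for \<alpha>
  proof -
    obtain X Y where *: "\<alpha> \<in> t" "\<alpha> \<noteq> 0" "weight_pair \<alpha> X Y" "X \<noteq> 0" "Y \<noteq> 0" using lie_rootsE \<open>\<alpha> \<in> R\<close> by blast
    have "X \<in> centr s" using weight_pair_in_derived[OF s *(1-3) p] derived_centr[OF s] by blast
    then have "br z X = 0" using z by blast
    then show ?thesis using * zt by (auto simp: weight_pair_def)
  qed
  then show "z \<in> {z \<in> t. \<forall>\<alpha>\<in>R. (\<forall>y\<in>s. \<alpha> \<bullet> y = 0) \<longrightarrow> \<alpha> \<bullet> z = 0}" using zt by blast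
next
  fix z assume "z \<in> {z \<in> t. \<forall>\<alpha>\<in>R. (\<forall>y\<in>s. \<alpha> \<bullet> y = 0) \<longrightarrow> \<alpha> \<bullet> z = 0}"
  then show "z \<in> center_algebra br (centr s)"
    using perp_roots_central[OF s, of z] t_centr[OF s] by (auto simp: center_algebra_def)
qed

text \<open>For empty \<open>s\<close> the centralizer is all of \<open>g\<close>, so such a
  \<open>z\<close> is central in \<open>g\<close>. The center is an ideal different from
  \<open>g\<close>, hence zero by simplicity.\<close>

lemma perp_all_roots: assumes z: "z \<in> t" and p: "\<And>\<alpha>. \<alpha> \<in> R \<Longrightarrow> \<alpha> \<bullet> z = 0" shows "z = 0"
proof -
  have zc: "br z x = 0" if "x \<in> g" for x
    by (rule perp_roots_central[of "{}"]) (use z p that in \<open>auto simp: centr_def\<close>)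
  define I where "I = {z \<in> g. \<forall>x\<in>g. br z x = 0}"
  have "subspace I" using subspace unfolding I_def subspace_def
    by (auto simp: br_zero_left add_left scale_left)
  moreover have "br x y \<in> I" if "x \<in> g" "y \<in> I" for x y
  proof -
    have "br x y = 0" using that br_anti[of x y] by (simp add: I_def)
    then show ?thesis using \<open>subspace I\<close> by (simp add: subspace_0)
  qed
  ultimately have "I = {0} \<or> I = g" using simple[of I] by (auto simp: I_def)
  moreover have "I \<noteq> g" using nonabelian by (auto simp: I_def)
  ultimately show ?thesis using zc z t_in_g by (auto simp: I_def)
qed

lemma span_roots: "span R = t"
proof (rule subspace_dim_equal)
  show "subspace (span R)" "subspace t" using subspace_t by auto
  show "span R \<subseteq> t" using roots_subset_t subspace_t by (simp add: span_minimal)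
  have "{y \<in> t. \<forall>x\<in>span R. orthogonal x y} = {0}"
    using perp_all_roots subspace_0[OF subspace_t] by (auto simp: orthogonal_def span_base)
  then show "dim t \<le> dim (span R)"
    using dim_subspace_orthogonal_to_vectors[OF _ subspace_t \<open>span R \<subseteq> t\<close>] by simp
qed

text \<open>The bracket of \<open>X + i Y\<close> and \<open>X' + i Y'\<close> has weight \<alpha> +
  \<beta> and vanishes if that is neither a root nor zero; the equations are its real and imaginary
  parts. Zero is excluded since vectors of weight zero, such as those of \<open>t\<close>, need not
  vanish.\<close>

lemma weight_pair_sum:
  assumes a: "\<alpha> \<in> t" "weight_pair \<alpha> X Y" and b: "\<beta> \<in> t" "weight_pair \<beta> X' Y'"
    and n: "\<alpha> + \<beta> \<notin> R" "\<alpha> + \<beta> \<noteq> 0"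
  shows "br X X' = br Y Y'" "br X Y' = - br Y X'"
proof -
  let ?U = "br X X' - br Y Y'" and ?V = "br X Y' + br Y X'"
  have g': "X \<in> g" "Y \<in> g" "X' \<in> g" "Y' \<in> g" using a b by (auto simp: weight_pair_def)
  have diff_right: "br x (y - z) = br x y - br x z" if "x \<in> g" "y \<in> g" "z \<in> g" for x y z
    using that add_right[of x y "- z"] br_uminus_right[of x z] subspace by (simp add: subspace_neg)
  have "weight_pair (\<alpha> + \<beta>) ?U ?V" unfolding weight_pair_def
  proof (intro conjI ballI)
    show "?U \<in> g" "?V \<in> g" using g' closed subspace by (auto intro: subspace_diff subspace_add)
    fix h assume h: "h \<in> t"
    have hg: "h \<in> g" using h t_in_g by blast
    have *: "br h X = - ((\<alpha> \<bullet> h) *\<^sub>R Y)" "br h Y = (\<alpha> \<bullet> h) *\<^sub>R X"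
       "br h X' = - ((\<beta> \<bullet> h) *\<^sub>R Y')" "br h Y' = (\<beta> \<bullet> h) *\<^sub>R X'"
      using a b h by (auto simp: weight_pair_def)
    note s = subspace_scale[OF subspace]
    show "br h ?U = - (((\<alpha> + \<beta>) \<bullet> h) *\<^sub>R ?V)"
      using g' hg by (simp add: diff_right closed br_derivation[OF hg] * scale_left scale_right s
          br_uminus_left br_uminus_right inner_add_left algebra_simps)
    show "br h ?V = ((\<alpha> + \<beta>) \<bullet> h) *\<^sub>R ?U"
      using g' hg by (simp add: add_right closed br_derivation[OF hg] * scale_left scale_right s
          br_uminus_left br_uminus_right inner_add_left algebra_simps)
  qed
  moreover have "\<alpha> + \<beta> \<in> t" using a b subspace_t by (simp add: subspace_add)
  ultimately have "?U = 0 \<and> ?V = 0" using n lie_rootsI[of "\<alpha> + \<beta>" ?U ?V] by blast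
  then show "br X X' = br Y Y'" "br X Y' = - br Y X'" by (auto simp: eq_neg_iff_add_eq_0)
qed

text \<open>The root vectors of \<alpha> and \<beta> commute, so \<open>[X, Y]\<close> commutes with
  \<open>X'\<close>; as \<open>[X, Y]\<close> lies in \<open>t\<close>, it is orthogonal to \<beta>.
  By invariance its inner product with \<beta> is also
  \<open>- (\<alpha> . \<beta>) (X . X)\<close>.\<close>

lemma nonadjacent_roots_orthogonal:
  assumes a: "\<alpha> \<in> R" and b: "\<beta> \<in> R"
    and n: "\<alpha> + \<beta> \<notin> R" "\<alpha> + \<beta> \<noteq> 0" "\<alpha> - \<beta> \<notin> R" "\<alpha> - \<beta> \<noteq> 0"
  shows "\<alpha> \<bullet> \<beta> = 0"
proof -
  obtain X Y where A: "\<alpha> \<in> t" "\<alpha> \<noteq> 0" "weight_pair \<alpha> X Y" "X \<noteq> 0" "Y \<noteq> 0" using lie_rootsE a by blast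
  obtain X' Y' where B: "\<beta> \<in> t" "\<beta> \<noteq> 0" "weight_pair \<beta> X' Y'" "X' \<noteq> 0" "Y' \<noteq> 0" using lie_rootsE b by blast
  have g': "X \<in> g" "Y \<in> g" "X' \<in> g" "Y' \<in> g" using A B by (auto simp: weight_pair_def)
  \<comment> \<open>The complex conjugate of a root vector belongs to the opposite root; multiplied
    by \<open>i\<close> it has real part \<open>Y'\<close> and imaginary part
    \<open>X'\<close>.\<close>
  have B': "- \<beta> \<in> t" "weight_pair (- \<beta>) Y' X'" using B subspace_t by (auto simp: weight_pair_def subspace_neg)
  have 1: "br X X' = br Y Y'" "br X Y' = - br Y X'"
    using weight_pair_sum[OF A(1,3) B(1,3)] n by auto
  have 2: "br X Y' = br Y X'" "br X X' = - br Y Y'"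
    using weight_pair_sum[OF A(1,3) B'] n by auto
  have neg: "x = 0" if "x = - x" for x :: 'a
    using that by (simp add: eq_neg_iff_add_eq_0 flip: scaleR_2)
  have 0: "br X X' = 0" "br Y X' = 0" using 1 2 neg[of "br X X'"] neg[of "br Y X'"] by auto
  let ?Z = "br X Y"
  have Zg: "?Z \<in> g" using closed g' by blast
  have "?Z \<in> t"
  proof (rule torus_self_centralizing[OF Zg])
    fix h assume h: "h \<in> t"
    have hg: "h \<in> g" using h t_in_g by blast
    show "br h ?Z = 0" using A(3) h g' hg subspace_scale[OF subspace]
      by (simp add: weight_pair_def br_derivation br_uminus_left scale_left scale_right alternating)
  qed
  moreover have "br ?Z X' = 0" using br_derivation[of X Y X'] g' 0 by (simp add: br_zero_right)
  ultimately have 3: "\<beta> \<bullet> ?Z = 0" using B by (auto simp: weight_pair_def)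
  have "\<beta> \<in> g" using B t_in_g by blast
  then have "?Z \<bullet> \<beta> = X \<bullet> br Y \<beta>" using invariant g' by blast
  also have "\<dots> = - ((\<alpha> \<bullet> \<beta>) * (X \<bullet> X))"
    using br_anti[of Y \<beta>] g' \<open>\<beta> \<in> g\<close> A(3) B(1) by (simp add: weight_pair_def)
  finally show ?thesis using 3 A(4) by (simp add: inner_commute)
qed

end

section \<open>Integer coordinates\<close>

lemma of_nat_8_eq_iff: assumes "i < 8" "j < 8" shows "(of_nat i :: 8) = of_nat j \<longleftrightarrow> i = j"
proof -
  have "i \<in> {0,1,2,3,4,5,6,7}" "j \<in> {0,1,2,3,4,5,6,7}" using assms by auto
  then show ?thesis by auto
qed

lemma UNIV_8: "(UNIV :: 8 set) = of_nat ` {..<8}"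
proof (rule sym, rule card_subset_eq)
  have "inj_on (of_nat :: nat \<Rightarrow> 8) {..<8}" by (auto simp: inj_on_def of_nat_8_eq_iff)
  then show "card ((of_nat :: nat \<Rightarrow> 8) ` {..<8}) = card (UNIV :: 8 set)" by (simp add: card_image)
qed auto

lemma vec8_eqI: assumes "\<And>j. j < 8 \<Longrightarrow> x $ of_nat j = y $ of_nat j" shows "x = (y :: real^8)"
  unfolding vec_eq_iff using assms UNIV_8 by (metis UNIV_I image_iff lessThan_iff)

lemma \<epsilon>_nth: "i < 8 \<Longrightarrow> j < 8 \<Longrightarrow> \<epsilon> i $ of_nat j = (if i = j then 1 else 0)"
  by (simp add: \<epsilon>_def axis_def of_nat_8_eq_iff)

lemma sum_\<epsilon>_nth: assumes "n \<le> 8" "j < 8"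
  shows "(\<Sum>i<n. f i *\<^sub>R \<epsilon> i) $ of_nat j = (if j < n then f j else 0)"
proof -
  have "(\<Sum>i<n. f i *\<^sub>R \<epsilon> i) $ of_nat j = (\<Sum>i<n. f i * (if i = j then 1 else 0))"
    unfolding sum_component by (intro sum.cong) (use assms in \<open>auto simp: \<epsilon>_nth\<close>)
  also have "\<dots> = (if j < n then f j else 0)" by (simp add: if_distrib sum.delta cong: if_cong)
  finally show ?thesis .
qed

lemma vec8_expand: "(x :: real^8) = (\<Sum>i<8. (x $ of_nat i) *\<^sub>R \<epsilon> i)"
  by (rule vec8_eqI) (subst sum_\<epsilon>_nth, auto)

section \<open>Integer lists as vectors and integer matrices as linear maps\<close>

definition cvec :: "int list \<Rightarrow> real^8" where
  "cvec c = (\<Sum>i<8. (if i < length c then of_int (c ! i) else 0) *\<^sub>R \<epsilon> i)"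

lemma cvec_nth: "j < 8 \<Longrightarrow> cvec c $ of_nat j = (if j < length c then of_int (c ! j) else 0)"
  unfolding cvec_def by (subst sum_\<epsilon>_nth) auto

lemma cvec_inj: assumes "length c = length c'" "length c \<le> 8" "cvec c = cvec c'" shows "c = c'"
proof (rule nth_equalityI)
  fix i assume "i < length c"
  then show "c ! i = c' ! i" using assms cvec_nth[of i c] cvec_nth[of i c'] by auto
qed (use assms in auto)

lemma cvec_scale: "cvec (map ((*) d) c) = of_int d *\<^sub>R cvec c"
  by (rule vec8_eqI) (simp add: cvec_nth)

lemma cvec_uminus: "cvec (map uminus c) = - cvec c"
  by (rule vec8_eqI) (simp add: cvec_nth)

lemma cvec_add: "length c = length c' \<Longrightarrow> cvec (map2 (+) c c') = cvec c + cvec c'"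
  by (rule vec8_eqI) (simp add: cvec_nth)

lemma cvec_diff: "length c = length c' \<Longrightarrow> cvec (map2 (-) c c') = cvec c - cvec c'"
  by (rule vec8_eqI) (simp add: cvec_nth)

definition unit_list :: "nat \<Rightarrow> nat \<Rightarrow> int list" where
  "unit_list n i = (replicate n 0)[i := 1]"

lemma cvec_unit: "i < n \<Longrightarrow> n \<le> 8 \<Longrightarrow> cvec (unit_list n i) = \<epsilon> i"
  by (rule vec8_eqI) (auto simp: cvec_nth unit_list_def \<epsilon>_nth nth_list_update)

definition dot :: "int list \<Rightarrow> int list \<Rightarrow> int" where
  "dot r c = sum_list (map2 (*) r c)"

definition mat_app :: "int list list \<Rightarrow> int list \<Rightarrow> int list" where
  "mat_app M c = map (\<lambda>r. dot r c) M"

definition row_form :: "int list \<Rightarrow> real^8 \<Rightarrow> real" where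
  "row_form r x = (\<Sum>j<8. (if j < length r then of_int (r ! j) else 0) * x $ of_nat j)"

definition mat_lin :: "int list list \<Rightarrow> real^8 \<Rightarrow> real^8" where
  "mat_lin M x = (\<Sum>i<8. (if i < length M then row_form (M ! i) x else 0) *\<^sub>R \<epsilon> i)"

lemma dot_sum: "dot r c = (\<Sum>j<min (length r) (length c). r ! j * c ! j)"
  unfolding dot_def sum_list_sum_nth by (simp add: atLeast0LessThan)

lemma row_form_cvec: assumes "length c \<le> 8" shows "row_form r (cvec c) = of_int (dot r c)"
proof -
  have "of_int (dot r c) = (\<Sum>j<min (length r) (length c). of_int (r ! j) * of_int (c ! j) :: real)"
    by (simp add: dot_sum)
  also have "\<dots> = (\<Sum>j<8. (if j < length r then of_int (r ! j) else 0) * (if j < length c then of_int (c ! j) else 0))"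
    by (rule sum.mono_neutral_cong_left) (use assms in auto)
  also have "\<dots> = row_form r (cvec c)" unfolding row_form_def
    by (intro sum.cong) (auto simp: cvec_nth)
  finally show ?thesis by simp
qed

lemma linear_row_form: "linear (row_form r)"
  unfolding row_form_def
  by (rule linearI) (simp_all add: algebra_simps sum.distrib sum_distrib_left)

lemma mat_lin_nth:
  "j < 8 \<Longrightarrow> mat_lin M x $ of_nat j = (if j < length M then row_form (M ! j) x else 0)"
  unfolding mat_lin_def by (subst sum_\<epsilon>_nth) auto

lemma linear_mat_lin: "linear (mat_lin M)"
  by (rule linearI; rule vec8_eqI)
     (simp_all add: mat_lin_nth linear_add[OF linear_row_form] linear_scale[OF linear_row_form])

lemma mat_lin_cvec: assumes "length c \<le> 8" shows "mat_lin M (cvec c) = cvec (mat_app M c)"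
  by (rule vec8_eqI) (simp add: mat_lin_nth cvec_nth mat_app_def row_form_cvec[OF assms])

section \<open>Linear isomorphism and its invariants\<close>

lemma linearly_isomorphic_refl: "linearly_isomorphic X X"
  unfolding linearly_isomorphic_def by (intro exI[of _ id]) (auto simp: linear_id)

lemma linearly_isomorphic_trans:
  assumes "linearly_isomorphic X Y" "linearly_isomorphic Y Z" shows "linearly_isomorphic X Z"
proof -
  obtain f h where f: "linear f" "inj_on f (span X)" "f ` X = Y"
    and h: "linear h" "inj_on h (span Y)" "h ` Y = Z"
    using assms unfolding linearly_isomorphic_def by blast
  have "f ` span X = span Y" using f linear_span_image by blast
  then have "inj_on (h \<circ> f) (span X)" using f h by (simp add: comp_inj_on)
  moreover have "linear (h \<circ> f)" using f h by (simp add: linear_compose)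
  ultimately show ?thesis unfolding linearly_isomorphic_def
    using f h by (intro exI[of _ "h \<circ> f"]) (auto simp: image_comp)
qed

lemma linearly_isomorphic_sym:
  assumes "linearly_isomorphic X Y" shows "linearly_isomorphic Y X"
proof -
  obtain f where f: "linear f" "inj_on f (span X)" "f ` X = Y"
    using assms unfolding linearly_isomorphic_def by blast
  obtain k where k: "linear k" "\<forall>x\<in>span X. k (f x) = x"
    using linear_inj_on_left_inverse[OF f(1,2)] by blast
  have sp: "f ` span X = span Y" using f linear_span_image by blast
  have "inj_on k (span Y)" unfolding sp[symmetric] using k by (auto intro!: inj_onI)
  moreover have "k ` Y = X" using f k by (force simp: span_base image_iff)
  ultimately show ?thesis using k unfolding linearly_isomorphic_def by blast
qed

lemma equiv_T_iso: "equiv UNIV T_iso"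
proof (rule equivI)
  show "refl T_iso" by (auto simp: refl_on_def T_iso_def linearly_isomorphic_refl)
  show "sym T_iso" by (auto simp: sym_def T_iso_def intro: linearly_isomorphic_sym)
  show "trans T_iso" by (auto simp: trans_def T_iso_def intro: linearly_isomorphic_trans)
qed auto

lemma linearly_isomorphic_dim:
  fixes X :: "'a::euclidean_space set" and Y :: "'b::euclidean_space set"
  assumes "linearly_isomorphic X Y" shows "dim Y = dim X"
  using assms dim_image_eq unfolding linearly_isomorphic_def by blast

lemma linearly_isomorphic_inj_on:
  assumes "linearly_isomorphic X Y"
  obtains f where "linear f" "inj_on f (span X)" "f ` X = Y" "inj_on f X"
proof -
  obtain f where "linear f" "inj_on f (span X)" "f ` X = Y"
    using assms unfolding linearly_isomorphic_def by blast
  then show thesis using that[of f] span_superset[of X] inj_on_subset[of f "span X" X] by blast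
qed

lemma linearly_isomorphic_card: assumes "linearly_isomorphic X Y" shows "card Y = card X"
  using assms by (metis linearly_isomorphic_inj_on card_image)

text \<open>Multiples of elements stay in the span, where the isomorphism is injective. This count
  separates models that agree in rank and cardinality.\<close>

lemma linearly_isomorphic_doubles:
  assumes "linearly_isomorphic X Y"
  shows "card {a \<in> Y. 2 *\<^sub>R a \<in> Y} = card {a \<in> X. 2 *\<^sub>R a \<in> X}"
proof -
  obtain f where f: "linear f" "inj_on f (span X)" "f ` X = Y" "inj_on f X"
    using assms linearly_isomorphic_inj_on by blast
  have "2 *\<^sub>R f a \<in> Y \<longleftrightarrow> 2 *\<^sub>R a \<in> X" if "a \<in> X" for a
  proof -
    have "2 *\<^sub>R a \<in> span X" using that by (simp add: span_base span_scale)
    then have "f (2 *\<^sub>R a) \<in> f ` X \<longleftrightarrow> 2 *\<^sub>R a \<in> X"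
      using f(2) span_superset by (metis inj_on_image_mem_iff)
    then show ?thesis using f by (simp add: linear_scale)
  qed
  then have "{a \<in> Y. 2 *\<^sub>R a \<in> Y} = f ` {a \<in> X. 2 *\<^sub>R a \<in> X}" using f(3) by auto
  moreover have "inj_on f {a \<in> X. 2 *\<^sub>R a \<in> X}" using f(4) by (rule inj_on_subset) auto
  ultimately show ?thesis by (simp add: card_image)
qed

lemma linearly_isomorphic_reducible:
  assumes "linearly_isomorphic X Y" "reducible_system X" shows "reducible_system Y"
proof -
  obtain f where f: "linear f" "inj_on f (span X)" "f ` X = Y" "inj_on f X"
    using assms linearly_isomorphic_inj_on by blast
  obtain V1 V2 where V: "subspace V1" "subspace V2" "V1 \<inter> V2 = {0}"
    "X = (X \<inter> V1) \<union> (X \<inter> V2)" "X \<inter> V1 \<noteq> {}" "X \<inter> V2 \<noteq> {}"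
    using assms(2) unfolding reducible_system_def by (elim exE conjE) (rule that)
  have V4: "x \<in> V1 \<or> x \<in> V2" if "x \<in> X" for x using V(4) that by blast
  \<comment> \<open>Injectivity is known on \<open>span X\<close> only, so the subspaces are cut
    down to it before they are mapped.\<close>
  let ?W = "\<lambda>V. f ` (V \<inter> span X)"
  have s: "subspace (?W V)" if "subspace V" for V
    using f that by (simp add: linear_subspace_image subspace_inter)
  have "?W V1 \<inter> ?W V2 = f ` ((V1 \<inter> span X) \<inter> (V2 \<inter> span X))"
    using f(2) by (intro inj_on_image_Int[symmetric]) auto
  also have "(V1 \<inter> span X) \<inter> (V2 \<inter> span X) = {0}" using V(3) span_zero by blast
  finally have "?W V1 \<inter> ?W V2 = {0}" using f by (simp add: linear_0)
  moreover have "Y = (Y \<inter> ?W V1) \<union> (Y \<inter> ?W V2)"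
    using f(3) V4 span_superset[of X] by blast
  moreover have "Y \<inter> ?W V1 \<noteq> {}" "Y \<inter> ?W V2 \<noteq> {}"
    using f(3) V(5,6) span_superset[of X] by blast+
  ultimately show ?thesis unfolding reducible_system_def
    using s[OF V(1)] s[OF V(2)] by (intro exI conjI)
qed

text \<open>Lifting along \<open>p\<close> and then applying \<open>q\<close> is well defined
  because lifts differ by the common kernel. Hence the choice of the projection does not affect the
  isomorphism class of a T-root system.\<close>

lemma same_kernel_isomorphic:
  assumes p: "linear p" and q: "linear q" and X: "X \<subseteq> span S"
    and ker: "\<And>x. x \<in> span S \<Longrightarrow> p x = 0 \<longleftrightarrow> q x = 0"
  shows "linearly_isomorphic (p ` X) (q ` X)"
proof -
  obtain k where k: "range k \<subseteq> span S" "linear k" "\<forall>v\<in>p ` span S. p (k v) = v"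
    using linear_exists_right_inverse_on[OF p subspace_span] by blast
  have eq: "q (k (p x)) = q x" if "x \<in> span S" for x
  proof -
    have "k (p x) - x \<in> span S" using k that by (auto intro: span_diff)
    moreover have "p (k (p x) - x) = 0" using k that by (simp add: linear_diff[OF p])
    ultimately have "q (k (p x) - x) = 0" using ker by blast
    then show ?thesis by (simp add: linear_diff[OF q])
  qed
  have "linear (q \<circ> k)" using k q by (simp add: linear_compose)
  moreover have "inj_on (q \<circ> k) (span (p ` X))"
  proof (rule inj_on_subset)
    show "span (p ` X) \<subseteq> p ` span S"
      by (rule span_minimal) (use X p in \<open>auto simp: linear_subspace_image\<close>)
    show "inj_on (q \<circ> k) (p ` span S)"
    proof (rule inj_onI)
      fix a b assume "a \<in> p ` span S" "b \<in> p ` span S" "(q \<circ> k) a = (q \<circ> k) b"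
      then obtain x y where xy: "a = p x" "b = p y" "x \<in> span S" "y \<in> span S" "q x = q y" using eq by auto
      then have "p (x - y) = 0" using ker[of "x - y"] by (simp add: span_diff linear_diff[OF q])
      then show "a = b" using xy by (simp add: linear_diff[OF p])
    qed
  qed
  moreover have "(q \<circ> k) ` p ` X = q ` X" using eq X by (force simp: image_iff)
  ultimately show ?thesis unfolding linearly_isomorphic_def by blast
qed

text \<open>
  Evaluation by rewriting does not short-circuit conjunctions and disjunctions, but it is lazy in
  the branches of a conditional; hence these versions of equality and membership.
\<close>

fun list_eq :: "'a list \<Rightarrow> 'a list \<Rightarrow> bool" where
  "list_eq [] [] = True"
| "list_eq (x # xs) (y # ys) = (if x = y then list_eq xs ys else False)"
| "list_eq _ _ = False"

lemma list_eq_iff [simp]: "list_eq xs ys \<longleftrightarrow> xs = ys"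
  by (induction xs ys rule: list_eq.induct) auto

fun mem :: "'a list \<Rightarrow> 'a list list \<Rightarrow> bool" where
  "mem x [] = False"
| "mem x (y # ys) = (if list_eq x y then True else mem x ys)"

lemma mem_iff [simp]: "mem x ys \<longleftrightarrow> x \<in> set ys"
  by (induction ys) auto

text \<open>That \<open>N M\<close> is multiplication by \<open>d\<close> is tested on
  \<open>X\<close> alone and extends to its span, where it makes \<open>M\<close> injective without
  any determinant. The bounds 8 exclude truncation by \<open>cvec\<close>.\<close>

definition iso_ok :: "int list list \<times> int list list \<times> int \<Rightarrow> int list list \<Rightarrow> int list list \<Rightarrow> bool" where
  "iso_ok = (\<lambda>(M, N, d) X Y. d \<noteq> 0 \<and> length M \<le> 8 \<and>
     list_all (\<lambda>c. length c \<le> 8 \<and> mat_app N (mat_app M c) = map ((*) d) c) X \<and>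
     (let Z = map (mat_app M) X in list_all (\<lambda>z. mem z Y) Z \<and> list_all (\<lambda>y. mem y Z) Y))"

lemma iso_ok_isomorphic: assumes "iso_ok C X Y"
  shows "linearly_isomorphic (cvec ` set X) (cvec ` set Y)"
proof -
  obtain M N d where C: "C = (M, N, d)" by (cases C) auto
  have d: "d \<noteq> 0" "length M \<le> 8" and Y: "set Y = mat_app M ` set X"
    and c: "\<And>c. c \<in> set X \<Longrightarrow> length c \<le> 8 \<and> mat_app N (mat_app M c) = map ((*) d) c"
    using assms by (auto simp: iso_ok_def C list_all_iff Let_def)
  have M: "mat_lin M (cvec c) = cvec (mat_app M c)" if "c \<in> set X" for c
    using c[OF that] by (intro mat_lin_cvec) auto
  have N: "mat_lin N (mat_lin M x) = of_int d *\<^sub>R x" if "x \<in> span (cvec ` set X)" for x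
    using that
  proof (induction rule: span_induct)
    case base
    show ?case using linear_mat_lin[of M] linear_mat_lin[of N] unfolding subspace_def
      by (auto simp: linear_0 linear_add linear_scale algebra_simps)
  next
    case (step x)
    then obtain c' where c': "c' \<in> set X" "x = cvec c'" by blast
    have "length (mat_app M c') \<le> 8" using d by (simp add: mat_app_def)
    then show ?case using c' c[OF c'(1)] M by (simp add: mat_lin_cvec cvec_scale)
  qed
  have "inj_on (mat_lin M) (span (cvec ` set X))"
    by (rule inj_onI) (metis N d(1) of_int_eq_0_iff real_vector.scale_left_imp_eq)
  moreover have "mat_lin M ` cvec ` set X = cvec ` set Y"
    unfolding Y image_image using M by (intro image_cong) auto
  ultimately show ?thesis unfolding linearly_isomorphic_def using linear_mat_lin by blast
qed

section \<open>Exceptional root systems in a basis of simple roots\<close>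

text \<open>
  Level \<open>k\<close> lists the positive roots of height \<open>k + 1\<close> by their coefficients with respect to
  the simple roots, in Bourbaki's numbering.
\<close>

fun root_levels :: "simple_type \<Rightarrow> int list list list" where
  "root_levels TE6 =
    [[[0,0,0,0,0,1],[0,0,0,0,1,0],[0,0,0,1,0,0],[0,0,1,0,0,0],[0,1,0,0,0,0],[1,0,0,0,0,0]], [[0,0,0,0,1,1],
    [0,0,0,1,1,0],[0,0,1,1,0,0],[0,1,0,1,0,0],[1,0,1,0,0,0]], [[0,0,0,1,1,1],[0,0,1,1,1,0],[0,1,0,1,1,0],
    [0,1,1,1,0,0],[1,0,1,1,0,0]], [[0,0,1,1,1,1],[0,1,0,1,1,1],[0,1,1,1,1,0],[1,0,1,1,1,0],[1,1,1,1,0,0]],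
    [[0,1,1,1,1,1],[0,1,1,2,1,0],[1,0,1,1,1,1],[1,1,1,1,1,0]], [[0,1,1,2,1,1],[1,1,1,1,1,1],[1,1,1,2,1,0]],
    [[0,1,1,2,2,1],[1,1,1,2,1,1],[1,1,2,2,1,0]], [[1,1,1,2,2,1],[1,1,2,2,1,1]], [[1,1,2,2,2,1]], [[1,1,2,3,2,1]],
    [[1,2,2,3,2,1]]]"
|   "root_levels TE7 =
    [[[0,0,0,0,0,0,1],[0,0,0,0,0,1,0],[0,0,0,0,1,0,0],[0,0,0,1,0,0,0],[0,0,1,0,0,0,0],[0,1,0,0,0,0,0],
    [1,0,0,0,0,0,0]], [[0,0,0,0,0,1,1],[0,0,0,0,1,1,0],[0,0,0,1,1,0,0],[0,0,1,1,0,0,0],[0,1,0,1,0,0,0],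
    [1,0,1,0,0,0,0]], [[0,0,0,0,1,1,1],[0,0,0,1,1,1,0],[0,0,1,1,1,0,0],[0,1,0,1,1,0,0],[0,1,1,1,0,0,0],
    [1,0,1,1,0,0,0]], [[0,0,0,1,1,1,1],[0,0,1,1,1,1,0],[0,1,0,1,1,1,0],[0,1,1,1,1,0,0],[1,0,1,1,1,0,0],
    [1,1,1,1,0,0,0]], [[0,0,1,1,1,1,1],[0,1,0,1,1,1,1],[0,1,1,1,1,1,0],[0,1,1,2,1,0,0],[1,0,1,1,1,1,0],
    [1,1,1,1,1,0,0]], [[0,1,1,1,1,1,1],[0,1,1,2,1,1,0],[1,0,1,1,1,1,1],[1,1,1,1,1,1,0],[1,1,1,2,1,0,0]],
    [[0,1,1,2,1,1,1],[0,1,1,2,2,1,0],[1,1,1,1,1,1,1],[1,1,1,2,1,1,0],[1,1,2,2,1,0,0]], [[0,1,1,2,2,1,1],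
    [1,1,1,2,1,1,1],[1,1,1,2,2,1,0],[1,1,2,2,1,1,0]], [[0,1,1,2,2,2,1],[1,1,1,2,2,1,1],[1,1,2,2,1,1,1],
    [1,1,2,2,2,1,0]], [[1,1,1,2,2,2,1],[1,1,2,2,2,1,1],[1,1,2,3,2,1,0]], [[1,1,2,2,2,2,1],[1,1,2,3,2,1,1],
    [1,2,2,3,2,1,0]], [[1,1,2,3,2,2,1],[1,2,2,3,2,1,1]], [[1,1,2,3,3,2,1],[1,2,2,3,2,2,1]], [[1,2,2,3,3,2,1]],
    [[1,2,2,4,3,2,1]], [[1,2,3,4,3,2,1]], [[2,2,3,4,3,2,1]]]"
|   "root_levels TE8 =
    [[[0,0,0,0,0,0,0,1],[0,0,0,0,0,0,1,0],[0,0,0,0,0,1,0,0],[0,0,0,0,1,0,0,0],[0,0,0,1,0,0,0,0],[0,0,1,0,0,0,0,0],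
    [0,1,0,0,0,0,0,0],[1,0,0,0,0,0,0,0]], [[0,0,0,0,0,0,1,1],[0,0,0,0,0,1,1,0],[0,0,0,0,1,1,0,0],
    [0,0,0,1,1,0,0,0],[0,0,1,1,0,0,0,0],[0,1,0,1,0,0,0,0],[1,0,1,0,0,0,0,0]], [[0,0,0,0,0,1,1,1],
    [0,0,0,0,1,1,1,0],[0,0,0,1,1,1,0,0],[0,0,1,1,1,0,0,0],[0,1,0,1,1,0,0,0],[0,1,1,1,0,0,0,0],[1,0,1,1,0,0,0,0]],
    [[0,0,0,0,1,1,1,1],[0,0,0,1,1,1,1,0],[0,0,1,1,1,1,0,0],[0,1,0,1,1,1,0,0],[0,1,1,1,1,0,0,0],[1,0,1,1,1,0,0,0],
    [1,1,1,1,0,0,0,0]], [[0,0,0,1,1,1,1,1],[0,0,1,1,1,1,1,0],[0,1,0,1,1,1,1,0],[0,1,1,1,1,1,0,0],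
    [0,1,1,2,1,0,0,0],[1,0,1,1,1,1,0,0],[1,1,1,1,1,0,0,0]], [[0,0,1,1,1,1,1,1],[0,1,0,1,1,1,1,1],
    [0,1,1,1,1,1,1,0],[0,1,1,2,1,1,0,0],[1,0,1,1,1,1,1,0],[1,1,1,1,1,1,0,0],[1,1,1,2,1,0,0,0]],
    [[0,1,1,1,1,1,1,1],[0,1,1,2,1,1,1,0],[0,1,1,2,2,1,0,0],[1,0,1,1,1,1,1,1],[1,1,1,1,1,1,1,0],[1,1,1,2,1,1,0,0],
    [1,1,2,2,1,0,0,0]], [[0,1,1,2,1,1,1,1],[0,1,1,2,2,1,1,0],[1,1,1,1,1,1,1,1],[1,1,1,2,1,1,1,0],
    [1,1,1,2,2,1,0,0],[1,1,2,2,1,1,0,0]], [[0,1,1,2,2,1,1,1],[0,1,1,2,2,2,1,0],[1,1,1,2,1,1,1,1],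
    [1,1,1,2,2,1,1,0],[1,1,2,2,1,1,1,0],[1,1,2,2,2,1,0,0]], [[0,1,1,2,2,2,1,1],[1,1,1,2,2,1,1,1],
    [1,1,1,2,2,2,1,0],[1,1,2,2,1,1,1,1],[1,1,2,2,2,1,1,0],[1,1,2,3,2,1,0,0]], [[0,1,1,2,2,2,2,1],
    [1,1,1,2,2,2,1,1],[1,1,2,2,2,1,1,1],[1,1,2,2,2,2,1,0],[1,1,2,3,2,1,1,0],[1,2,2,3,2,1,0,0]],
    [[1,1,1,2,2,2,2,1],[1,1,2,2,2,2,1,1],[1,1,2,3,2,1,1,1],[1,1,2,3,2,2,1,0],[1,2,2,3,2,1,1,0]],
    [[1,1,2,2,2,2,2,1],[1,1,2,3,2,2,1,1],[1,1,2,3,3,2,1,0],[1,2,2,3,2,1,1,1],[1,2,2,3,2,2,1,0]],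
    [[1,1,2,3,2,2,2,1],[1,1,2,3,3,2,1,1],[1,2,2,3,2,2,1,1],[1,2,2,3,3,2,1,0]], [[1,1,2,3,3,2,2,1],
    [1,2,2,3,2,2,2,1],[1,2,2,3,3,2,1,1],[1,2,2,4,3,2,1,0]], [[1,1,2,3,3,3,2,1],[1,2,2,3,3,2,2,1],
    [1,2,2,4,3,2,1,1],[1,2,3,4,3,2,1,0]], [[1,2,2,3,3,3,2,1],[1,2,2,4,3,2,2,1],[1,2,3,4,3,2,1,1],
    [2,2,3,4,3,2,1,0]], [[1,2,2,4,3,3,2,1],[1,2,3,4,3,2,2,1],[2,2,3,4,3,2,1,1]], [[1,2,2,4,4,3,2,1],
    [1,2,3,4,3,3,2,1],[2,2,3,4,3,2,2,1]], [[1,2,3,4,4,3,2,1],[2,2,3,4,3,3,2,1]], [[1,2,3,5,4,3,2,1],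
    [2,2,3,4,4,3,2,1]], [[1,3,3,5,4,3,2,1],[2,2,3,5,4,3,2,1]], [[2,2,4,5,4,3,2,1],[2,3,3,5,4,3,2,1]],
    [[2,3,4,5,4,3,2,1]], [[2,3,4,6,4,3,2,1]], [[2,3,4,6,5,3,2,1]], [[2,3,4,6,5,4,2,1]], [[2,3,4,6,5,4,3,1]],
    [[2,3,4,6,5,4,3,2]]]"
|   "root_levels TF4 =
    [[[0,0,0,1],[0,0,1,0],[0,1,0,0],[1,0,0,0]], [[0,0,1,1],[0,1,1,0],[1,1,0,0]], [[0,1,1,1],[0,1,2,0],[1,1,1,0]],
    [[0,1,2,1],[1,1,1,1],[1,1,2,0]], [[0,1,2,2],[1,1,2,1],[1,2,2,0]], [[1,1,2,2],[1,2,2,1]], [[1,2,2,2],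
    [1,2,3,1]], [[1,2,3,2]], [[1,2,4,2]], [[1,3,4,2]], [[2,3,4,2]]]"
|   "root_levels TG2 =
    [[[0,1],[1,0]], [[1,1]], [[2,1]], [[3,1]], [[3,2]]]"
| "root_levels _ = []"

text \<open>Entry \<open>i\<close> of list \<open>j\<close> is the Cartan integer of simple root
  \<open>i\<close> and simple coroot \<open>j\<close>, so list \<open>j\<close> is the linear form
  that occurs in the simple reflection \<open>j\<close>.\<close>

fun cartan_columns :: "simple_type \<Rightarrow> int list list" where
  "cartan_columns TE6 =
    [[2,0,-1,0,0,0],[0,2,0,-1,0,0],[-1,0,2,-1,0,0],[0,-1,-1,2,-1,0],[0,0,0,-1,2,-1],[0,0,0,0,-1,2]]"
|   "cartan_columns TE7 =
    [[2,0,-1,0,0,0,0],[0,2,0,-1,0,0,0],[-1,0,2,-1,0,0,0],[0,-1,-1,2,-1,0,0],[0,0,0,-1,2,-1,0],[0,0,0,0,-1,2,-1],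
    [0,0,0,0,0,-1,2]]"
|   "cartan_columns TE8 =
    [[2,0,-1,0,0,0,0,0],[0,2,0,-1,0,0,0,0],[-1,0,2,-1,0,0,0,0],[0,-1,-1,2,-1,0,0,0],[0,0,0,-1,2,-1,0,0],
    [0,0,0,0,-1,2,-1,0],[0,0,0,0,0,-1,2,-1],[0,0,0,0,0,0,-1,2]]"
|   "cartan_columns TF4 =
    [[2,-1,0,0],[-1,2,-1,0],[0,-2,2,-1],[0,0,-1,2]]"
|   "cartan_columns TG2 =
    [[2,-3],[-1,2]]"
| "cartan_columns _ = []"

text \<open>The sum of the positive roots in simple coordinates. Its pairing with every simple
  coroot is positive, which \<open>root_datum_ok\<close> verifies from the table.\<close>

fun two_rho :: "simple_type \<Rightarrow> int list" where
  "two_rho TE6 = [16, 22, 30, 42, 30, 16]"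
|   "two_rho TE7 = [34, 49, 66, 96, 75, 52, 27]"
|   "two_rho TE8 = [92, 136, 182, 270, 220, 168, 114, 58]"
|   "two_rho TF4 = [16, 30, 42, 22]"
|   "two_rho TG2 = [10, 6]"
| "two_rho _ = []"

text \<open>
  The columns of the first matrix are the simple roots in the standard coordinates, doubled except
  for \<open>G\<^sub>2\<close>; the second matrix is \<open>d\<close> times a left inverse of the first.
\<close>

fun std_coords :: "simple_type \<Rightarrow> int list list \<times> int list list \<times> int" where
  "std_coords TE6 =
    ([[1,2,-2,0,0,0],[-1,2,2,-2,0,0],[-1,0,0,2,-2,0],[-1,0,0,0,2,-2],[-1,0,0,0,0,2],[-1,0,0,0,0,0],[-1,0,0,0,0,0],
    [1,0,0,0,0,0]], [[0,0,0,0,0,-4,-4,4],[3,3,3,3,3,-3,-3,3],[-3,3,3,3,3,-5,-5,5],[0,0,6,6,6,-6,-6,6],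
    [0,0,0,6,6,-4,-4,4],[0,0,0,0,6,-2,-2,2]], 12)"
|   "std_coords TE7 =
    ([[1,2,-2,0,0,0,0],[-1,2,2,-2,0,0,0],[-1,0,0,2,-2,0,0],[-1,0,0,0,2,-2,0],[-1,0,0,0,0,2,-2],[-1,0,0,0,0,0,2],
    [-1,0,0,0,0,0,0],[1,0,0,0,0,0,0]], [[0,0,0,0,0,0,-2,2],[1,1,1,1,1,1,-2,2],[-1,1,1,1,1,1,-3,3],
    [0,0,2,2,2,2,-4,4],[0,0,0,2,2,2,-3,3],[0,0,0,0,2,2,-2,2],[0,0,0,0,0,2,-1,1]], 4)"
|   "std_coords TE8 =
    ([[1,2,-2,0,0,0,0,0],[-1,2,2,-2,0,0,0,0],[-1,0,0,2,-2,0,0,0],[-1,0,0,0,2,-2,0,0],[-1,0,0,0,0,2,-2,0],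
    [-1,0,0,0,0,0,2,-2],[-1,0,0,0,0,0,0,2],[1,0,0,0,0,0,0,0]], [[0,0,0,0,0,0,0,4],[1,1,1,1,1,1,1,5],
    [-1,1,1,1,1,1,1,7],[0,0,2,2,2,2,2,10],[0,0,0,2,2,2,2,8],[0,0,0,0,2,2,2,6],[0,0,0,0,0,2,2,4],
    [0,0,0,0,0,0,2,2]], 4)"
|   "std_coords TF4 =
    ([[0,0,0,1],[2,0,0,-1],[-2,2,0,-1],[0,-2,2,-1],[0,0,0,0],[0,0,0,0],[0,0,0,0],[0,0,0,0]], [[1,1,0,0,0,0,0,0],
    [2,1,1,0,0,0,0,0],[3,1,1,1,0,0,0,0],[2,0,0,0,0,0,0,0]], 2)"
|   "std_coords TG2 =
    ([[1,-2],[-1,1],[0,1],[0,0],[0,0],[0,0],[0,0],[0,0]], [[0,-3,3,0,0,0,0,0],[-1,-1,2,0,0,0,0,0]], 3)"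
| "std_coords _ = ([], [], 0)"

section \<open>Finite checks on the root data\<close>

definition pos_coeffs :: "simple_type \<Rightarrow> int list list" where
  "pos_coeffs L = concat (root_levels L)"

definition coeffs :: "simple_type \<Rightarrow> int list list" where
  "coeffs L = pos_coeffs L @ map (map uminus) (pos_coeffs L)"

definition rk :: "simple_type \<Rightarrow> nat" where "rk L = length (cartan_columns L)"

definition refl_list :: "simple_type \<Rightarrow> nat \<Rightarrow> int list \<Rightarrow> int list" where
  "refl_list L j c = c[j := c ! j - dot (cartan_columns L ! j) c]"

text \<open>A reflected root is sought only in the level of its height: height \<open>h\<close> is
  stored at index \<open>h - 1\<close>. The only positive root that a simple reflection makes
  negative is the simple root itself, which the test with \<open>uminus\<close> covers.\<close>

definition root_datum_ok :: "simple_type \<Rightarrow> bool" where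
  "root_datum_ok L \<longleftrightarrow> (let n = rk L; Ps = root_levels L in n \<le> 8 \<and>
     list_all (list_all (\<lambda>c. length c = n \<and> list_all (\<lambda>x. 0 \<le> x) c \<and> \<not> list_all (\<lambda>x. x = 0) c)) Ps \<and>
     list_all (\<lambda>j. length (cartan_columns L ! j) = n \<and> unit_list n j \<in> set (hd Ps) \<and> cartan_columns L ! j ! j = 2 \<and>
       0 < dot (cartan_columns L ! j) (two_rho L)) [0..<n] \<and> Ps \<noteq> [] \<and>
     list_all (\<lambda>j. list_all (list_all (\<lambda>c. let c' = refl_list L j c in if list_eq c' c then True
        else if list_eq (map uminus c') c then True else mem c' (concat (take 1 (drop (nat (sum_list c' - 1)) Ps))))) Ps) [0..<n])"

definition D_list :: "nat \<Rightarrow> int list list" where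
  "D_list n = [(replicate 8 0)[i := a, j := b]. j \<leftarrow> [0..<n], i \<leftarrow> [0..<j], a \<leftarrow> [1, -1], b \<leftarrow> [1, -1]]"

definition axis_list :: "nat \<Rightarrow> int \<Rightarrow> int list list" where
  "axis_list n b = [(replicate 8 0)[i := a]. i \<leftarrow> [0..<n], a \<leftarrow> [b, - b]]"

definition E8_list :: "int list list" where
  "E8_list = map (map ((*) 2)) (D_list 8) @
     filter (\<lambda>x. even (length (filter (\<lambda>y. y = - 1) x))) (product_lists (replicate 8 [1, - 1]))"

definition A_list :: "nat \<Rightarrow> int list list" where
  "A_list n = [(replicate 8 0)[i := 1, j := - 1]. j \<leftarrow> [0..<Suc n], i \<leftarrow> [0..<Suc n], i \<noteq> j]"

text \<open>All exceptional types but \<open>TG2\<close> are listed with doubled coordinates, which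
  turns half-integral roots into integer lists; the isomorphism class ignores the scaling.\<close>

fun std_list :: "simple_type \<Rightarrow> int list list" where
  "std_list (TA n) = A_list n"
| "std_list (TB n) = D_list n @ axis_list n 1"
| "std_list (TC n) = D_list n @ axis_list n 2"
| "std_list (TD n) = D_list n"
| "std_list TE6 = filter (\<lambda>x. x ! 5 = x ! 6 \<and> x ! 6 + x ! 7 = 0) E8_list"
| "std_list TE7 = filter (\<lambda>x. x ! 6 + x ! 7 = 0) E8_list"
| "std_list TE8 = E8_list"
| "std_list TF4 = map (map ((*) 2)) (D_list 4 @ axis_list 4 1) @
     map (\<lambda>x. x @ replicate 4 0) (product_lists (replicate 4 [1, - 1]))"
| "std_list TG2 = A_list 2 @ map (\<lambda>x. x @ replicate 5 0)
     [[2, -1, -1], [-2, 1, 1], [-1, 2, -1], [1, -2, 1], [-1, -1, 2], [1, 1, -2]]"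

text \<open>Sign vectors are recognised by their parity instead of a search through the 128
  admissible ones; only the remaining vectors are looked up.\<close>

definition is_E8 :: "int list \<Rightarrow> bool" where
  "is_E8 x \<longleftrightarrow> (if length x = 8 \<and> list_all (\<lambda>y. y = 1 \<or> y = - 1) x
     then even (length (filter (\<lambda>y. y = - 1) x)) else mem x (map (map ((*) 2)) (D_list 8)))"

fun std_mem :: "simple_type \<Rightarrow> int list \<Rightarrow> bool" where
  "std_mem TE6 x = (x ! 5 = x ! 6 \<and> x ! 6 + x ! 7 = 0 \<and> is_E8 x)"
| "std_mem TE7 x = (x ! 6 + x ! 7 = 0 \<and> is_E8 x)"
| "std_mem TE8 x = is_E8 x"
| "std_mem L x = mem x (std_list L)"

text \<open>Surjectivity is obtained by counting: the left inverse makes \<open>M\<close> injective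
  on the roots, their images are standard roots, and the standard list is not longer than the list
  of roots.\<close>

definition std_coords_ok :: "simple_type \<Rightarrow> bool" where
  "std_coords_ok L = (case std_coords L of (M, N, d) \<Rightarrow> d \<noteq> 0 \<and> length M \<le> 8 \<and>
     distinct (pos_coeffs L) \<and>
     list_all (\<lambda>c. mat_app N (mat_app M c) = map ((*) d) c \<and> std_mem L (mat_app M c)) (coeffs L) \<and>
     length (std_list L) \<le> 2 * length (pos_coeffs L))"

lemma root_datum_ok: "L \<in> exceptional_types \<Longrightarrow> root_datum_ok L"
proof -
  have "root_datum_ok TE6" by code_simp
  moreover have "root_datum_ok TE7" by code_simp
  moreover have "root_datum_ok TE8" by code_simp
  moreover have "root_datum_ok TF4" by code_simp
  moreover have "root_datum_ok TG2" by code_simp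
  ultimately show "L \<in> exceptional_types \<Longrightarrow> root_datum_ok L" by (auto simp: exceptional_types_def)
qed

lemma std_coords_ok: "L \<in> exceptional_types \<Longrightarrow> std_coords_ok L"
proof -
  have "std_coords_ok TE6" by code_simp
  moreover have "std_coords_ok TE7" by code_simp
  moreover have "std_coords_ok TE8" by code_simp
  moreover have "std_coords_ok TF4" by code_simp
  moreover have "std_coords_ok TG2" by code_simp
  ultimately show "L \<in> exceptional_types \<Longrightarrow> std_coords_ok L" by (auto simp: exceptional_types_def)
qed

section \<open>Integer lists of the standard systems\<close>

lemma cvec_two: assumes "i < 8" "j < 8" "i \<noteq> j"
  shows "cvec ((replicate 8 0)[i := a, j := b]) = of_int a *\<^sub>R \<epsilon> i + of_int b *\<^sub>R \<epsilon> j"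
  by (rule vec8_eqI) (use assms in \<open>auto simp: cvec_nth \<epsilon>_nth nth_list_update\<close>)

lemma cvec_one: assumes "i < 8"
  shows "cvec ((replicate 8 0)[i := a]) = of_int a *\<^sub>R \<epsilon> i"
  by (rule vec8_eqI) (use assms in \<open>auto simp: cvec_nth \<epsilon>_nth nth_list_update\<close>)

lemma cvec_append_zeros: "cvec (x @ replicate n 0) = cvec x"
  by (rule vec8_eqI) (auto simp: cvec_nth nth_append)

lemma D_list_iff: "x \<in> set (D_list n) \<longleftrightarrow>
    (\<exists>i j a b. i < j \<and> j < n \<and> a \<in> {1, -1} \<and> b \<in> {1, -1} \<and> x = (replicate 8 0)[i := a, j := b])"
proof -
  have "set (D_list n) = (\<Union>j\<in>{0..<n}. \<Union>i\<in>{0..<j}. \<Union>a\<in>{1, -1}. \<Union>b\<in>{1, -1}. {(replicate 8 0)[i := a, j := b]})"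
    unfolding D_list_def by (simp add: insert_commute)
  then have "x \<in> set (D_list n) \<longleftrightarrow> (\<exists>j\<in>{0..<n}. \<exists>i\<in>{0..<j}. \<exists>a\<in>{1, -1}. \<exists>b\<in>{1, -1}. x = (replicate 8 0)[i := a, j := b])"
    by (simp only: UN_iff singleton_iff)
  also have "\<dots> \<longleftrightarrow> (\<exists>i j a b. i < j \<and> j < n \<and> a \<in> {1, -1} \<and> b \<in> {1, -1} \<and> x = (replicate 8 0)[i := a, j := b])"
    unfolding Bex_def atLeastLessThan_iff by (intro iffI; elim exE conjE; intro exI conjI; assumption?) simp_all
  finally show ?thesis .
qed

lemma cvec_D_list: assumes "n \<le> 8" shows "cvec ` set (D_list n) = std_D n"
proof (intro set_eqI iffI)
  fix x assume "x \<in> cvec ` set (D_list n)"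
  then obtain y where y: "y \<in> set (D_list n)" "x = cvec y" by blast
  obtain i j a b where *: "i < j" "j < n" "a \<in> {1, -1::int}" "b \<in> {1, -1::int}"
    "y = (replicate 8 0)[i := a, j := b]"
    using y(1)[unfolded D_list_iff] by (elim exE conjE) (rule that)
  have "x = of_int a *\<^sub>R \<epsilon> i + of_int b *\<^sub>R \<epsilon> j" using assms * y by (simp add: cvec_two)
  moreover have "real_of_int a \<in> {1, -1}" "real_of_int b \<in> {1, -1}" using * by auto
  ultimately show "x \<in> std_D n" using * unfolding std_D_def by blast
next
  fix x assume "x \<in> std_D n"
  then obtain a b i j where *: "i < j" "j < n" "a \<in> {1, -1::real}" "b \<in> {1, -1::real}"
    "x = a *\<^sub>R \<epsilon> i + b *\<^sub>R \<epsilon> j" unfolding std_D_def by blast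
  have "\<exists>a'\<in>{1, -1::int}. a = of_int a'" if "a \<in> {1, -1}" for a :: real using that by auto
  then obtain a' b' where ab: "a' \<in> {1, -1::int}" "a = of_int a'" "b' \<in> {1, -1::int}" "b = of_int b'"
    using *(3,4) by metis
  have "(replicate 8 0)[i := a', j := b'] \<in> set (D_list n)"
    unfolding D_list_iff using * ab by (intro exI[of _ i] exI[of _ j] exI[of _ a'] exI[of _ b'] conjI) auto
  moreover have "x = cvec ((replicate 8 0)[i := a', j := b'])" using * ab assms by (simp add: cvec_two)
  ultimately show "x \<in> cvec ` set (D_list n)" by blast
qed

lemma cvec_axis_list: assumes "n \<le> 8"
  shows "cvec ` set (axis_list n b) = {a *\<^sub>R \<epsilon> i | a i. i < n \<and> a \<in> {of_int b, - of_int b}}"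
proof -
  have "cvec ` set (axis_list n b) = (\<Union>i<n. {cvec ((replicate 8 0)[i := b]), cvec ((replicate 8 0)[i := - b])})"
    unfolding axis_list_def by (simp add: image_UN lessThan_atLeast0 insert_commute)
  also have "\<dots> = (\<Union>i<n. {of_int b *\<^sub>R \<epsilon> i, (- of_int b) *\<^sub>R \<epsilon> i})"
    by (intro SUP_cong) (use assms in \<open>auto simp: cvec_one\<close>)
  also have "\<dots> = {a *\<^sub>R \<epsilon> i | a i. i < n \<and> a \<in> {of_int b, - of_int b}}" by blast
  finally show ?thesis .
qed

lemma cvec_A_list: assumes "n \<le> 7" shows "cvec ` set (A_list n) = std_A n"
proof -
  have "set (A_list n) = (\<Union>j\<in>{0..<Suc n}. \<Union>i\<in>{0..<Suc n} \<inter> {i. i \<noteq> j}. {(replicate 8 0)[i := 1, j := -1]})"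
    unfolding A_list_def by (simp del: upt_Suc)
  then have "cvec ` set (A_list n) = {cvec ((replicate 8 0)[i := 1, j := -1]) | i j. i \<le> n \<and> j \<le> n \<and> i \<noteq> j}"
    unfolding atLeast0LessThan lessThan_Suc_atMost by (simp only: image_UN) blast
  also have "\<dots> = std_A n" unfolding std_A_def using assms
    by (intro Collect_cong ex_cong1) (auto simp: cvec_two)
  finally show ?thesis .
qed

lemma cvec_std_B: "n \<le> 8 \<Longrightarrow> cvec ` set (std_list (TB n)) = std_roots (TB n)"
  by (simp add: image_Un cvec_D_list cvec_axis_list std_B_def)

lemma cvec_std_C: "n \<le> 8 \<Longrightarrow> cvec ` set (std_list (TC n)) = std_roots (TC n)"
  by (simp add: image_Un cvec_D_list cvec_axis_list std_C_def)

lemma set_signs: "set (product_lists (replicate n [1, -1::int])) = {x. length x = n \<and> (\<forall>i<n. x ! i \<in> {1, -1})}"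
  by (auto simp: product_lists_set list_all2_conv_all_nth)

lemma half_cvec_sum: assumes "length x = n" "n \<le> 8"
  shows "(1/2) *\<^sub>R cvec x = (\<Sum>i<n. (of_int (x ! i) / 2) *\<^sub>R \<epsilon> i)"
  by (rule vec8_eqI) (subst sum_\<epsilon>_nth, use assms in \<open>auto simp: cvec_nth\<close>)

text \<open>Half-integral vectors are halves of lists of signs. The version that keeps track of the
  parity of minus signs serves \<open>E_8\<close>, the one without it \<open>F_4\<close>.\<close>

lemma half_signs: assumes "n \<le> 8"
  shows "{\<Sum>i<n. s i *\<^sub>R \<epsilon> i | s. (\<forall>i<n. s i \<in> {1/2, -1/2}) \<and> even (card {i. i < n \<and> s i = -1/2})}
     = (\<lambda>x. (1/2) *\<^sub>R cvec x) ` set (filter (\<lambda>x. even (length (filter (\<lambda>y. y = -1) x))) (product_lists (replicate n [1, -1])))"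
    (is "?A = ?B" )
  and "{\<Sum>i<n. s i *\<^sub>R \<epsilon> i | s. (\<forall>i<n. s i \<in> {1/2, -1/2})}
     = (\<lambda>x. (1/2) *\<^sub>R cvec x) ` set (product_lists (replicate n [1, -1]))" (is "?C = ?D")
proof -
  have 1: "\<exists>x. length x = n \<and> (\<forall>i<n. x ! i \<in> {1, -1}) \<and> card {i. i < n \<and> s i = -1/2} = length (filter (\<lambda>y. y = -1) x)
      \<and> (\<Sum>i<n. s i *\<^sub>R \<epsilon> i) = (1/2) *\<^sub>R cvec x" if s: "\<forall>i<n. s i \<in> {1/2, -1/2}" for s :: "nat \<Rightarrow> real"
  proof -
    define x where "x = map (\<lambda>i. if s i = 1/2 then 1 else -1 :: int) [0..<n]"
    have "card {i. i < n \<and> s i = -1/2} = length (filter (\<lambda>y. y = -1) x)"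
      unfolding length_filter_conv_card x_def using s by (intro arg_cong[of _ _ card] Collect_cong) auto
    moreover have "(\<Sum>i<n. s i *\<^sub>R \<epsilon> i) = (1/2) *\<^sub>R cvec x"
      by (subst half_cvec_sum[of x n]) (use s assms in \<open>auto simp: x_def intro!: sum.cong\<close>)
    ultimately show ?thesis by (intro exI[of _ x]) (auto simp: x_def)
  qed
  have 2: "\<exists>s. (\<forall>i<n. s i \<in> {1/2, -1/2}) \<and> card {i. i < n \<and> s i = -1/2} = length (filter (\<lambda>y. y = -1) x)
      \<and> (1/2) *\<^sub>R cvec x = (\<Sum>i<n. s i *\<^sub>R \<epsilon> i)" if x: "length x = n" "\<forall>i<n. x ! i \<in> {1, -1}" for x :: "int list"
  proof (intro exI conjI)
    let ?s = "\<lambda>i. of_int (x ! i) / 2 :: real"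
    show "(1/2) *\<^sub>R cvec x = (\<Sum>i<n. ?s i *\<^sub>R \<epsilon> i)" by (rule half_cvec_sum[OF x(1) assms])
    show "\<forall>i<n. ?s i \<in> {1/2, -1/2}" using x by auto
    have "?s i = -1/2 \<longleftrightarrow> x ! i = -1" for i by (simp add: field_simps) (metis of_int_1 of_int_eq_iff of_int_minus)
    then show "card {i. i < n \<and> ?s i = -1/2} = length (filter (\<lambda>y. y = -1) x)"
      unfolding length_filter_conv_card using x by (intro arg_cong[of _ _ card] Collect_cong) auto
  qed
  show "?A = ?B"
  proof (intro set_eqI iffI)
    fix v assume "v \<in> ?A"
    then obtain s where s: "\<forall>i<n. s i \<in> {1/2, -1/2}" "even (card {i. i < n \<and> s i = -1/2})"
      "v = (\<Sum>i<n. s i *\<^sub>R \<epsilon> i)" by blast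
    obtain x where x: "length x = n" "\<forall>i<n. x ! i \<in> {1, -1}" "even (length (filter (\<lambda>y. y = -1) x))"
      "v = (1/2) *\<^sub>R cvec x" using 1[OF s(1)] s(2,3) by auto
    then have "x \<in> {x \<in> {x. length x = n \<and> (\<forall>i<n. x ! i \<in> {1, -1})}. even (length (filter (\<lambda>y. y = -1) x))}" by blast
    then show "v \<in> ?B" unfolding set_filter set_signs x(4) by (rule imageI)
  next
    fix v assume "v \<in> ?B"
    then obtain x where x: "length x = n" "\<forall>i<n. x ! i \<in> {1, -1}" "even (length (filter (\<lambda>y. y = -1) x))"
      "v = (1/2) *\<^sub>R cvec x" unfolding set_filter set_signs by (elim imageE CollectE conjE) (rule that)
    obtain s where s: "\<forall>i<n. s i \<in> {1/2, -1/2}" "card {i. i < n \<and> s i = -1/2} = length (filter (\<lambda>y. y = -1) x)"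
      "(1/2) *\<^sub>R cvec x = (\<Sum>i<n. s i *\<^sub>R \<epsilon> i)" using 2[OF x(1,2)] by (elim exE conjE) (rule that)
    show "v \<in> ?A" unfolding mem_Collect_eq x(4) s(3) using s x(3) by (intro exI[of _ s]) (simp only: conj_assoc)
  qed
  show "?C = ?D"
  proof (intro set_eqI iffI)
    fix v assume "v \<in> ?C"
    then obtain s where s: "\<forall>i<n. s i \<in> {1/2, -1/2}" "v = (\<Sum>i<n. s i *\<^sub>R \<epsilon> i)" by blast
    obtain x where x: "length x = n" "\<forall>i<n. x ! i \<in> {1, -1}" "v = (1/2) *\<^sub>R cvec x" using 1[OF s(1)] s(2) by auto
    then have "x \<in> {x. length x = n \<and> (\<forall>i<n. x ! i \<in> {1, -1})}" by blast
    then show "v \<in> ?D" unfolding set_signs x(3) by (rule imageI)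
  next
    fix v assume "v \<in> ?D"
    then obtain x where x: "length x = n" "\<forall>i<n. x ! i \<in> {1, -1}"
      "v = (1/2) *\<^sub>R cvec x" unfolding set_signs by (elim imageE CollectE conjE) (rule that)
    obtain s where s: "\<forall>i<n. s i \<in> {1/2, -1/2}"
      "(1/2) *\<^sub>R cvec x = (\<Sum>i<n. s i *\<^sub>R \<epsilon> i)" using 2[OF x(1,2)] by (elim exE conjE) (rule that)
    show "v \<in> ?C" unfolding mem_Collect_eq x(3) s(2) using s(1) by (intro exI[of _ s]) simp
  qed
qed

lemma half_double: "(\<lambda>x. (1/2) *\<^sub>R cvec x) ` set (map (map ((*) 2)) X) = cvec ` set X"
  by (simp add: image_image cvec_scale)

lemma std_E8_list: "std_E8 = (\<lambda>x. (1/2) *\<^sub>R cvec x) ` set E8_list"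
  unfolding std_E8_def E8_list_def set_append image_Un half_double half_signs(1)[OF order.refl]
  by (simp only: cvec_D_list[OF order.refl])

lemma E8_list_length: "x \<in> set E8_list \<Longrightarrow> length x = 8"
  unfolding E8_list_def by (auto simp: D_list_iff set_signs)

lemma inner_\<epsilon>: "x \<bullet> \<epsilon> i = x $ of_nat i" by (simp add: \<epsilon>_def inner_axis)

lemma half_cvec_inner: assumes "x \<in> set E8_list" "i < 8" shows "((1/2) *\<^sub>R cvec x) \<bullet> \<epsilon> i = of_int (x ! i) / 2"
  using assms by (simp add: inner_\<epsilon> cvec_nth E8_list_length del: inner_scaleR_left)

lemma std_exceptional_list: assumes "L \<in> exceptional_types" and that: "k = (if L = TG2 then 1 else 1/2)"
  shows "std_roots L = (\<lambda>x. k *\<^sub>R x) ` cvec ` set (std_list L)"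
proof -
  have E7: "((1/2) *\<^sub>R cvec x) \<bullet> (\<epsilon> 6 + \<epsilon> 7) = 0 \<longleftrightarrow> x ! 6 + x ! 7 = 0" if "x \<in> set E8_list" for x
  proof -
    have "((1/2) *\<^sub>R cvec x) \<bullet> (\<epsilon> 6 + \<epsilon> 7) = of_int (x ! 6 + x ! 7) / 2"
      using half_cvec_inner[OF that, of 6] half_cvec_inner[OF that, of 7] by (simp add: inner_add_right)
    then show ?thesis by (simp del: of_int_add)
  qed
  have E6: "((1/2) *\<^sub>R cvec x) \<bullet> (\<epsilon> 5 - \<epsilon> 6) = 0 \<longleftrightarrow> x ! 5 = x ! 6" if "x \<in> set E8_list" for x
    using half_cvec_inner[OF that, of 5] half_cvec_inner[OF that, of 6] by (simp add: inner_diff_right)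
  have F4: "std_roots TF4 = (\<lambda>x. (1/2) *\<^sub>R cvec x) ` set (std_list TF4)"
  proof -
    have le: "(4::nat) \<le> 8" by simp
    have "std_B 4 = cvec ` set (D_list 4 @ axis_list 4 1)" using cvec_std_B[of 4] by simp
    moreover have "(\<lambda>x. (1/2) *\<^sub>R cvec x) ` set (map (\<lambda>x. x @ replicate 4 0) X) = (\<lambda>x. (1/2) *\<^sub>R cvec x) ` set X" for X
      by (simp add: image_image cvec_append_zeros)
    ultimately show ?thesis
      unfolding std_roots.simps std_list.simps set_append image_Un half_double half_signs(2)[OF le]
      by simp
  qed
  have G2: "std_roots TG2 = cvec ` set (std_list TG2)"
  proof -
    let ?w = "\<lambda>i j k. 2 *\<^sub>R \<epsilon> i - \<epsilon> j - \<epsilon> k"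
    \<comment> \<open>The index condition makes \<open>i, j, k\<close> a permutation, and exchanging
      \<open>j\<close> and \<open>k\<close> changes nothing, so three vectors and their opposites
      remain.\<close>
    have "{a *\<^sub>R (2 *\<^sub>R \<epsilon> i - \<epsilon> j - \<epsilon> k) | a i j k. {i, j, k} = {0, 1, 2} \<and> a \<in> {1, -1::real}}
      = {?w 0 1 2, - ?w 0 1 2, ?w 1 0 2, - ?w 1 0 2, ?w 2 0 1, - ?w 2 0 1}" (is "?A = ?B")
    proof
      show "?A \<subseteq> ?B"
      proof
        fix x assume "x \<in> ?A"
        then obtain a :: real and i j k where *: "x = a *\<^sub>R ?w i j k" "{i, j, k} = {0, 1, 2::nat}" "a \<in> {1, -1}" by blast
        have m: "i \<in> {0, 1, 2}" "j \<in> {0, 1, 2}" "k \<in> {0, 1, 2}"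
          unfolding *(2)[symmetric] by simp_all
        have m': "0 \<in> {i, j, k}" "1 \<in> {i, j, k}" "2 \<in> {i, j, k}"
          unfolding *(2) by simp_all
        have "\<forall>i\<in>{0,1,2}. \<forall>j\<in>{0,1,2}. \<forall>k\<in>{0,1,2::nat}. 0 \<in> {i, j, k} \<longrightarrow> 1 \<in> {i, j, k} \<longrightarrow> 2 \<in> {i, j, k}
          \<longrightarrow> (i, j, k) \<in> {(0,1,2), (0,2,1), (1,0,2), (1,2,0), (2,0,1), (2,1,0)}" by simp
        from this[rule_format, OF m m']
        have "(i, j, k) \<in> {(0,1,2), (0,2,1), (1,0,2), (1,2,0), (2,0,1), (2,1,0)}" .
        moreover have "x = ?w i j k \<or> x = - ?w i j k" using *(1,3) by auto
        moreover have "?w i k j = ?w i j k" for i j k by (simp add: algebra_simps)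
        ultimately show "x \<in> ?B" by (elim insertE emptyE disjE) simp_all
      qed
      have w: "?w i j k \<in> ?A" "- ?w i j k \<in> ?A" if "{i, j, k} = {0, 1, 2}" for i j k
      proof -
        show "?w i j k \<in> ?A" supply [simp] = that
          by (rule CollectI, rule exI[of _ 1], rule exI[of _ i], rule exI[of _ j], rule exI[of _ k])
            simp
        show "- ?w i j k \<in> ?A" supply [simp] = that
          by (rule CollectI, rule exI[of _ "-1"], rule exI[of _ i], rule exI[of _ j], rule exI[of _ k])
            simp
      qed
      have 1: "{1, 0, 2} = {0, 1, 2::nat}" "{2, 0, 1} = {0, 1, 2::nat}" by auto
      show "?B \<subseteq> ?A"
        using w[OF refl] w[OF 1(1)] w[OF 1(2)] by (intro insert_subsetI empty_subsetI)
    qed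
    note B = this
    have c: "cvec [2, -1, -1] = 2 *\<^sub>R \<epsilon> 0 - \<epsilon> 1 - \<epsilon> 2" "cvec [-2, 1, 1] = - (2 *\<^sub>R \<epsilon> 0 - \<epsilon> 1 - \<epsilon> 2)"
      "cvec [-1, 2, -1] = 2 *\<^sub>R \<epsilon> 1 - \<epsilon> 0 - \<epsilon> 2" "cvec [1, -2, 1] = - (2 *\<^sub>R \<epsilon> 1 - \<epsilon> 0 - \<epsilon> 2)"
      "cvec [-1, -1, 2] = 2 *\<^sub>R \<epsilon> 2 - \<epsilon> 0 - \<epsilon> 1" "cvec [1, 1, -2] = - (2 *\<^sub>R \<epsilon> 2 - \<epsilon> 0 - \<epsilon> 1)"
      by (rule vec8_eqI; auto simp: cvec_nth \<epsilon>_nth less_Suc_eq numeral_eq_Suc)+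
    have A: "cvec ` set (A_list 2) = std_A 2" by (rule cvec_A_list) simp
    show ?thesis
      unfolding std_roots.simps std_list.simps set_append image_Un set_map image_image cvec_append_zeros A B
      by (simp only: list.set image_insert image_empty c)
  qed
  have h: "(\<lambda>x. (1/2) *\<^sub>R x) ` cvec ` X = (\<lambda>x. (1/2) *\<^sub>R cvec x) ` X" for X by (simp add: image_image)
  have fi: "{\<alpha> \<in> f ` set X. P \<alpha>} = f ` set (filter Q X)" if "\<And>x. x \<in> set X \<Longrightarrow> P (f x) \<longleftrightarrow> Q x"
    for f :: "int list \<Rightarrow> real^8" and X P Q using that by auto
  have E6': "std_roots TE6 = (\<lambda>x. (1/2) *\<^sub>R cvec x) ` set (std_list TE6)"
    unfolding std_roots.simps std_list.simps std_E8_list by (rule fi) (simp only: E6 E7)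
  have E7': "std_roots TE7 = (\<lambda>x. (1/2) *\<^sub>R cvec x) ` set (std_list TE7)"
    unfolding std_roots.simps std_list.simps std_E8_list by (rule fi) (simp only: E7)
  have E8': "std_roots TE8 = (\<lambda>x. (1/2) *\<^sub>R cvec x) ` set (std_list TE8)"
    unfolding std_roots.simps std_list.simps by (rule std_E8_list)
  show ?thesis
  proof (cases "L = TG2")
    case True
    then show ?thesis using that G2 by simp
  next
    case False
    then have k: "k = 1/2" using that by simp
    have "L \<in> {TE6, TE7, TE8, TF4}" using assms False by (auto simp: exceptional_types_def)
    then have "std_roots L = (\<lambda>x. (1/2) *\<^sub>R cvec x) ` set (std_list L)"
      by (elim insertE emptyE) (use E6' E7' E8' F4 in \<open>simp_all only:\<close>)
    then show ?thesis unfolding k h .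
  qed
qed

lemma scaled_isomorphic: assumes "k \<noteq> 0" shows "linearly_isomorphic ((\<lambda>x. k *\<^sub>R x) ` X) X"
proof (rule linearly_isomorphic_sym)
  show "linearly_isomorphic X ((\<lambda>x. k *\<^sub>R x) ` X)" unfolding linearly_isomorphic_def
    using assms by (intro exI[of _ "\<lambda>x. k *\<^sub>R x"]) (auto intro!: linear_scale_self inj_onI)
qed

lemma is_E8_mem: "is_E8 x \<Longrightarrow> x \<in> set E8_list"
  by (auto simp: is_E8_def E8_list_def set_signs list_all_iff split: if_splits)

lemma std_mem_list: "std_mem L x \<Longrightarrow> x \<in> set (std_list L)"
  by (cases "(L, x)" rule: std_mem.cases) (auto dest: is_E8_mem simp del: E8_list_def)

section \<open>Signs and number of the coefficient vectors\<close>

lemma set_coeffs: "set (coeffs L) = set (pos_coeffs L) \<union> map uminus ` set (pos_coeffs L)"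
  by (simp add: coeffs_def)

lemma pos_coeffs_props: assumes "root_datum_ok L" "c \<in> set (pos_coeffs L)"
  shows "length c = rk L" "\<And>x. x \<in> set c \<Longrightarrow> x \<ge> 0" "\<exists>x\<in>set c. x \<noteq> 0"
  using assms by (auto simp: root_datum_ok_def Let_def pos_coeffs_def list_all_iff)

lemma coeffs_length: "root_datum_ok L \<Longrightarrow> c \<in> set (coeffs L) \<Longrightarrow> length c = rk L"
  using pos_coeffs_props(1) by (auto simp: set_coeffs)

lemma rk_le: "root_datum_ok L \<Longrightarrow> rk L \<le> 8"
  by (simp add: root_datum_ok_def Let_def)

lemma pos_neg_disjoint: assumes "root_datum_ok L"
  shows "set (pos_coeffs L) \<inter> map uminus ` set (pos_coeffs L) = {}"
proof (rule ccontr)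
  assume "\<not> ?thesis"
  then obtain c c' where c: "c \<in> set (pos_coeffs L)" "c' \<in> set (pos_coeffs L)" "c = map uminus c'" by blast
  obtain x where x: "x \<in> set c'" "x \<noteq> 0" using pos_coeffs_props(3)[OF assms c(2)] by blast
  then have "- x \<in> set c" using c by auto
  then show False using x pos_coeffs_props(2)[OF assms c(1)] pos_coeffs_props(2)[OF assms c(2)] by fastforce
qed

lemma map_uminus_uminus [simp]: "map uminus (map uminus (c :: int list)) = c" by (simp add: map_idI)

lemma inj_map_uminus: "inj_on (map (uminus :: int \<Rightarrow> int)) X" by (metis inj_onI map_uminus_uminus)

lemma card_coeffs: assumes "root_datum_ok L" "distinct (pos_coeffs L)"
  shows "card (set (coeffs L)) = 2 * length (pos_coeffs L)" "distinct (coeffs L)"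
proof -
  show "card (set (coeffs L)) = 2 * length (pos_coeffs L)"
    unfolding set_coeffs using pos_neg_disjoint[OF assms(1)] assms(2)
    by (simp add: card_Un_disjoint card_image inj_map_uminus distinct_card)
  then show "distinct (coeffs L)" by (intro card_distinct) (simp add: coeffs_def)
qed

lemma std_roots_coeffs: assumes L: "L \<in> exceptional_types"
  shows "linearly_isomorphic (std_roots L) (cvec ` set (coeffs L))"
proof -
  note rd = root_datum_ok[OF L]
  obtain M N d where C: "std_coords L = (M, N, d)" by (cases "std_coords L") auto
  have ok: "d \<noteq> 0" "length M \<le> 8" "distinct (pos_coeffs L)"
    "\<And>c. c \<in> set (coeffs L) \<Longrightarrow> mat_app N (mat_app M c) = map ((*) d) c \<and> mat_app M c \<in> set (std_list L)"
    "length (std_list L) \<le> 2 * length (pos_coeffs L)"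
    using std_coords_ok[OF L] by (auto simp: std_coords_ok_def C list_all_iff std_mem_list)
  have "inj_on (mat_app M) (set (coeffs L))"
  proof (rule inj_onI)
    fix c c' assume "c \<in> set (coeffs L)" "c' \<in> set (coeffs L)" "mat_app M c = mat_app M c'"
    then have "map ((*) d) c = map ((*) d) c'" using ok(4) by metis
    then show "c = c'" using ok(1) by (metis inj_map_eq_map injI mult_cancel_left)
  qed
  then have "card (mat_app M ` set (coeffs L)) = 2 * length (pos_coeffs L)"
    using card_coeffs[OF rd ok(3)] by (simp add: card_image)
  then have "card (set (std_list L)) \<le> card (mat_app M ` set (coeffs L))"
    using card_length[of "std_list L"] ok(5) by simp
  then have "mat_app M ` set (coeffs L) = set (std_list L)"
    using ok(4) by (intro card_seteq) auto
  then have "iso_ok (M, N, d) (coeffs L) (std_list L)"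
    using ok coeffs_length[OF rd] rk_le[OF rd] by (auto simp: iso_ok_def list_all_iff Let_def)
  then have "linearly_isomorphic (cvec ` set (coeffs L)) (cvec ` set (std_list L))"
    by (rule iso_ok_isomorphic)
  moreover have "linearly_isomorphic (std_roots L) (cvec ` set (std_list L))"
    unfolding std_exceptional_list[OF L refl] by (rule scaled_isomorphic) simp
  ultimately show ?thesis using linearly_isomorphic_trans linearly_isomorphic_sym by blast
qed

section \<open>The systems of projected roots, by computation\<close>

text \<open>
  A mask marks the set \<open>K\<close> of those nodes of the Dynkin diagram whose simple roots are not roots
  of the isotropy algebra.
\<close>

definition sel :: "bool list \<Rightarrow> 'a list \<Rightarrow> 'a list" where
  "sel m xs = map snd (filter fst (zip m xs))"

definition nodes :: "bool list \<Rightarrow> nat" where "nodes m = length (filter id m)"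

definition zero_on :: "bool list \<Rightarrow> int list \<Rightarrow> bool" where
  "zero_on m c \<longleftrightarrow> list_all (\<lambda>x. x = 0) (sel m c)"

definition masks :: "nat \<Rightarrow> bool list list" where
  "masks n = product_lists (replicate n [False, True])"

text \<open>The search stops as soon as \<open>k + 1\<close> restrictions outside
  \<open>seen\<close> have been found, so a large T-root system need not be enumerated in
  full.\<close>

fun many :: "bool list \<Rightarrow> nat \<Rightarrow> int list list \<Rightarrow> int list list \<Rightarrow> bool" where
  "many m k seen [] = False"
| "many m k seen (c # cs) = (let x = sel m c in if mem x seen then many m k seen cs
     else if k = 0 then True else many m (k - 1) (x # seen) cs)"

definition T_root_list :: "simple_type \<Rightarrow> bool list \<Rightarrow> int list list" where
  "T_root_list L m = (let X = fold (\<lambda>c X. let x = sel m c in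
       if list_all (\<lambda>y. y = 0) x then X else if mem x X then X else x # X) (pos_coeffs L) []
     in X @ map (map uminus) X)"

definition levi_list :: "simple_type \<Rightarrow> bool list \<Rightarrow> int list list" where
  "levi_list L m = (let X = filter (zero_on m) (pos_coeffs L) in X @ map (map uminus) X)"
text \<open>Models 0 to 12 are the rank two systems in the order of the flag manifolds in the
  theorem; 0, 1, 4 and 5 are \<open>A_2\<close>, \<open>B_2\<close>, \<open>BC_2\<close> and
  \<open>G_2\<close> in simple coordinates. Models 13, 14 and 15 are \<open>C_3\<close>,
  \<open>C_3\<close> without the roots of first coordinate 2 or -2, and \<open>B_3\<close> with the
  extra pair.\<close>

definition canon :: "int list list list" where
  "canon = (let C = std_list (TC 3); v = [1, 1, 1, 0, 0, 0, 0, 0] in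
    [[[0,1],[1,0],[1,1],[0,-1],[-1,0],[-1,-1]], [[0,1],[1,0],[1,1],[1,2],[0,-1],[-1,0],[-1,-1],[-1,-2]], [[0,1],
    [0,2],[1,0],[1,1],[1,2],[0,-1],[0,-2],[-1,0],[-1,-1],[-1,-2]], [[0,1],[0,2],[1,0],[1,1],[1,2],[1,3],[0,-1],
    [0,-2],[-1,0],[-1,-1],[-1,-2],[-1,-3]], [[0,1],[0,2],[1,0],[1,1],[1,2],[2,2],[0,-1],[0,-2],[-1,0],[-1,-1],
    [-1,-2],[-2,-2]], [[0,1],[1,0],[1,1],[1,2],[1,3],[2,3],[0,-1],[-1,0],[-1,-1],[-1,-2],[-1,-3],[-2,-3]], [[0,1],
    [0,2],[1,0],[1,1],[1,2],[1,3],[2,3],[0,-1],[0,-2],[-1,0],[-1,-1],[-1,-2],[-1,-3],[-2,-3]], [[0,1],[1,0],[1,1],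
    [1,2],[2,1],[2,2],[2,3],[3,3],[0,-1],[-1,0],[-1,-1],[-1,-2],[-2,-1],[-2,-2],[-2,-3],[-3,-3]], [[0,1],[0,2],
    [1,0],[1,1],[1,2],[1,3],[1,4],[2,4],[0,-1],[0,-2],[-1,0],[-1,-1],[-1,-2],[-1,-3],[-1,-4],[-2,-4]], [[0,1],
    [1,0],[1,1],[2,0],[2,1],[2,2],[3,1],[3,2],[4,2],[0,-1],[-1,0],[-1,-1],[-2,0],[-2,-1],[-2,-2],[-3,-1],[-3,-2],
    [-4,-2]], [[0,1],[1,0],[1,1],[1,2],[2,2],[2,3],[2,4],[3,3],[3,4],[0,-1],[-1,0],[-1,-1],[-1,-2],[-2,-2],
    [-2,-3],[-2,-4],[-3,-3],[-3,-4]], [[0,1],[0,2],[1,0],[1,1],[1,2],[1,3],[1,4],[2,3],[2,4],[2,5],[0,-1],[0,-2],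
    [-1,0],[-1,-1],[-1,-2],[-1,-3],[-1,-4],[-2,-3],[-2,-4],[-2,-5]], [[0,1],[1,0],[1,1],[1,2],[1,3],[2,3],[2,4],
    [2,5],[3,5],[3,6],[0,-1],[-1,0],[-1,-1],[-1,-2],[-1,-3],[-2,-3],[-2,-4],[-2,-5],[-3,-5],[-3,-6]]] @
    [C, filter (\<lambda>x. x ! 0 \<noteq> 2 \<and> x ! 0 \<noteq> - 2) C, std_list (TB 3) @ [v, map uminus v]])"

text \<open>
  The entry \<open>(m, j, M, N, d)\<close> says that \<open>M\<close> maps the T-roots for the mask \<open>m\<close> onto the model \<open>j\<close>,
  and that \<open>N M = d\<close>.
\<close>

fun flag_table :: "simple_type \<Rightarrow> (bool list \<times> nat \<times> int list list \<times> int list list \<times> int) list" where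
  "flag_table TE6 =
    [([True,True,False,False,False,False], 1, [[1,0],[0,1]], [[1,0],[0,1]], 1),
     ([True,False,True,False,False,False], 1, [[1,0],[0,1]], [[1,0],[0,1]], 1),
     ([True,False,False,True,False,False], 3, [[1,0],[0,1]], [[1,0],[0,1]], 1),
     ([True,False,False,False,True,False], 2, [[1,0],[0,1]], [[1,0],[0,1]], 1),
     ([True,False,False,False,False,True], 0, [[0,1],[1,0]], [[0,1],[1,0]], 1),
     ([False,True,True,False,False,False], 2, [[1,-1],[0,-1]], [[1,-1],[0,-1]], 1),
     ([False,True,False,True,False,False], 5, [[1,0],[0,1]], [[1,0],[0,1]], 1),
     ([False,True,False,False,True,False], 2, [[1,-1],[0,-1]], [[1,-1],[0,-1]], 1),
     ([False,True,False,False,False,True], 1, [[0,1],[1,0]], [[0,1],[1,0]], 1),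
     ([False,False,True,True,False,False], 3, [[1,-1],[0,-1]], [[1,-1],[0,-1]], 1),
     ([False,False,True,False,True,False], 3, [[1,-1],[1,-2]], [[2,-1],[1,-1]], 1),
     ([False,False,True,False,False,True], 2, [[0,1],[1,0]], [[0,1],[1,0]], 1),
     ([False,False,False,True,True,False], 3, [[1,-1],[1,0]], [[0,1],[-1,1]], 1),
     ([False,False,False,True,False,True], 3, [[0,1],[1,0]], [[0,1],[1,0]], 1),
     ([False,False,False,False,True,True], 1, [[0,1],[1,0]], [[0,1],[1,0]], 1),
     ([True,True,True,False,False,False], 14, [[0,1,-1],[2,0,-1],[0,1,0],[0,0,0],[0,0,0],[0,0,0],[0,0,0],[0,0,0]], [[-1,1,1,0,0,0,0,0],[0,0,2,0,0,0,0,0],[-2,0,2,0,0,0,0,0]], 2),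
     ([True,True,False,True,False,False], 15, [[1,1,-1],[1,-1,0],[1,0,0],[0,0,0],[0,0,0],[0,0,0],[0,0,0],[0,0,0]], [[0,0,1,0,0,0,0,0],[0,-1,1,0,0,0,0,0],[-1,-1,2,0,0,0,0,0]], 1),
     ([True,True,False,False,True,False], 15, [[1,-1,0],[1,0,0],[0,-1,1],[0,0,0],[0,0,0],[0,0,0],[0,0,0],[0,0,0]], [[0,1,0,0,0,0,0,0],[-1,1,0,0,0,0,0,0],[-1,1,1,0,0,0,0,0]], 1),
     ([True,True,False,False,False,True], 14, [[1,0,-1],[1,-1,1],[0,1,0],[0,0,0],[0,0,0],[0,0,0],[0,0,0],[0,0,0]], [[1,1,1,0,0,0,0,0],[0,0,2,0,0,0,0,0],[-1,1,1,0,0,0,0,0]], 2),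
     ([True,False,True,True,False,False], 15, [[1,-1,0],[-1,0,0],[0,1,-1],[0,0,0],[0,0,0],[0,0,0],[0,0,0],[0,0,0]], [[0,-1,0,0,0,0,0,0],[-1,-1,0,0,0,0,0,0],[-1,-1,-1,0,0,0,0,0]], 1),
     ([True,False,True,False,True,False], 15, [[1,-1,0],[-1,0,0],[0,-1,1],[0,0,0],[0,0,0],[0,0,0],[0,0,0],[0,0,0]], [[0,-1,0,0,0,0,0,0],[-1,-1,0,0,0,0,0,0],[-1,-1,1,0,0,0,0,0]], 1),
     ([True,False,True,False,False,True], 14, [[0,0,1],[2,-1,0],[0,1,-1],[0,0,0],[0,0,0],[0,0,0],[0,0,0],[0,0,0]], [[1,1,1,0,0,0,0,0],[2,0,2,0,0,0,0,0],[2,0,0,0,0,0,0,0]], 2),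
     ([True,False,False,False,True,True], 14, [[1,0,0],[1,-1,0],[0,1,-2],[0,0,0],[0,0,0],[0,0,0],[0,0,0],[0,0,0]], [[2,0,0,0,0,0,0,0],[2,-2,0,0,0,0,0,0],[1,-1,-1,0,0,0,0,0]], 2),
     ([False,True,True,True,False,False], 15, [[1,1,-1],[-1,1,0],[0,1,-1],[0,0,0],[0,0,0],[0,0,0],[0,0,0],[0,0,0]], [[1,0,-1,0,0,0,0,0],[1,1,-1,0,0,0,0,0],[1,1,-2,0,0,0,0,0]], 1),
     ([False,True,True,False,False,True], 15, [[1,-1,0],[1,0,-1],[0,0,-1],[0,0,0],[0,0,0],[0,0,0],[0,0,0],[0,0,0]], [[0,1,-1,0,0,0,0,0],[-1,1,-1,0,0,0,0,0],[0,0,-1,0,0,0,0,0]], 1),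
     ([False,True,False,True,True,False], 15, [[1,-1,1],[-1,0,1],[0,-1,1],[0,0,0],[0,0,0],[0,0,0],[0,0,0],[0,0,0]], [[1,0,-1,0,0,0,0,0],[1,1,-2,0,0,0,0,0],[1,1,-1,0,0,0,0,0]], 1),
     ([False,True,False,True,False,True], 15, [[1,-1,1],[-1,0,1],[0,0,1],[0,0,0],[0,0,0],[0,0,0],[0,0,0],[0,0,0]], [[0,-1,1,0,0,0,0,0],[-1,-1,2,0,0,0,0,0],[0,0,1,0,0,0,0,0]], 1),
     ([False,True,False,False,True,True], 14, [[1,-1,0],[1,0,0],[0,1,-2],[0,0,0],[0,0,0],[0,0,0],[0,0,0],[0,0,0]], [[0,2,0,0,0,0,0,0],[-2,2,0,0,0,0,0,0],[-1,1,-1,0,0,0,0,0]], 2),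
     ([False,False,True,False,True,True], 15, [[1,-1,0],[0,-1,1],[0,0,-1],[0,0,0],[0,0,0],[0,0,0],[0,0,0],[0,0,0]], [[1,-1,-1,0,0,0,0,0],[0,-1,-1,0,0,0,0,0],[0,0,-1,0,0,0,0,0]], 1),
     ([False,False,False,True,True,True], 15, [[1,-1,0],[0,1,-1],[0,0,1],[0,0,0],[0,0,0],[0,0,0],[0,0,0],[0,0,0]], [[1,1,1,0,0,0,0,0],[0,1,1,0,0,0,0,0],[0,0,1,0,0,0,0,0]], 1)]"
|   "flag_table TE7 =
    [([True,True,False,False,False,False,False], 2, [[1,-1],[0,-1]], [[1,-1],[0,-1]], 1),
     ([True,False,True,False,False,False,False], 5, [[1,0],[0,1]], [[1,0],[0,1]], 1),
     ([True,False,False,True,False,False,False], 8, [[1,0],[0,1]], [[1,0],[0,1]], 1),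
     ([True,False,False,False,True,False,False], 6, [[1,0],[0,1]], [[1,0],[0,1]], 1),
     ([True,False,False,False,False,True,False], 4, [[1,0],[0,1]], [[1,0],[0,1]], 1),
     ([True,False,False,False,False,False,True], 1, [[0,1],[1,0]], [[0,1],[1,0]], 1),
     ([False,True,True,False,False,False,False], 3, [[1,-1],[0,-1]], [[1,-1],[0,-1]], 1),
     ([False,True,False,True,False,False,False], 6, [[2,-1],[3,-1]], [[-1,1],[-3,2]], 1),
     ([False,True,False,False,True,False,False], 6, [[1,-1],[0,-1]], [[1,-1],[0,-1]], 1),
     ([False,True,False,False,False,True,False], 3, [[1,-1],[1,-2]], [[2,-1],[1,-1]], 1),
     ([False,True,False,False,False,False,True], 2, [[0,1],[1,0]], [[0,1],[1,0]], 1),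
     ([False,False,True,True,False,False,False], 8, [[1,-1],[0,-1]], [[1,-1],[0,-1]], 1),
     ([False,False,True,False,True,False,False], 7, [[1,0],[0,1]], [[1,0],[0,1]], 1),
     ([False,False,True,False,False,True,False], 8, [[1,-1],[2,-1]], [[-1,1],[-2,1]], 1),
     ([False,False,True,False,False,False,True], 3, [[0,1],[1,0]], [[0,1],[1,0]], 1),
     ([False,False,False,True,True,False,False], 7, [[1,-2],[0,-1]], [[1,-2],[0,-1]], 1),
     ([False,False,False,True,False,True,False], 9, [[1,0],[0,1]], [[1,0],[0,1]], 1),
     ([False,False,False,True,False,False,True], 7, [[1,-2],[1,-1]], [[-1,2],[-1,1]], 1),
     ([False,False,False,False,True,True,False], 3, [[1,-1],[1,0]], [[0,1],[-1,1]], 1),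
     ([False,False,False,False,True,False,True], 3, [[0,1],[1,0]], [[0,1],[1,0]], 1),
     ([False,False,False,False,False,True,True], 1, [[0,1],[1,0]], [[0,1],[1,0]], 1),
     ([True,True,True,False,False,False,False], 15, [[1,1,-1],[-1,1,0],[0,1,-1],[0,0,0],[0,0,0],[0,0,0],[0,0,0],[0,0,0]], [[1,0,-1,0,0,0,0,0],[1,1,-1,0,0,0,0,0],[1,1,-2,0,0,0,0,0]], 1),
     ([True,True,False,False,False,False,True], 15, [[1,-1,0],[1,0,-1],[0,0,-1],[0,0,0],[0,0,0],[0,0,0],[0,0,0],[0,0,0]], [[0,1,-1,0,0,0,0,0],[-1,1,-1,0,0,0,0,0],[0,0,-1,0,0,0,0,0]], 1),
     ([True,False,True,False,False,False,True], 15, [[1,-1,1],[-1,0,1],[0,0,1],[0,0,0],[0,0,0],[0,0,0],[0,0,0],[0,0,0]], [[0,-1,1,0,0,0,0,0],[-1,-1,2,0,0,0,0,0],[0,0,1,0,0,0,0,0]], 1),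
     ([True,False,False,False,False,True,True], 13, [[1,-1,0],[1,0,0],[0,1,-2],[0,0,0],[0,0,0],[0,0,0],[0,0,0],[0,0,0]], [[0,2,0,0,0,0,0,0],[-2,2,0,0,0,0,0,0],[-1,1,-1,0,0,0,0,0]], 2),
     ([False,True,False,False,False,True,True], 15, [[1,-1,0],[0,-1,1],[0,0,-1],[0,0,0],[0,0,0],[0,0,0],[0,0,0],[0,0,0]], [[1,-1,-1,0,0,0,0,0],[0,-1,-1,0,0,0,0,0],[0,0,-1,0,0,0,0,0]], 1),
     ([False,False,False,False,True,True,True], 15, [[1,-1,0],[0,1,-1],[0,0,1],[0,0,0],[0,0,0],[0,0,0],[0,0,0],[0,0,0]], [[1,1,1,0,0,0,0,0],[0,1,1,0,0,0,0,0],[0,0,1,0,0,0,0,0]], 1)]"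
|   "flag_table TE8 =
    [([True,True,False,False,False,False,False,False], 6, [[1,-1],[0,-1]], [[1,-1],[0,-1]], 1),
     ([True,False,True,False,False,False,False,False], 6, [[2,-1],[3,-1]], [[-1,1],[-3,2]], 1),
     ([True,False,False,False,True,False,False,False], 11, [[1,0],[0,1]], [[1,0],[0,1]], 1),
     ([True,False,False,False,False,True,False,False], 9, [[0,1],[1,0]], [[0,1],[1,0]], 1),
     ([True,False,False,False,False,False,True,False], 8, [[1,-1],[1,-2]], [[2,-1],[1,-1]], 1),
     ([True,False,False,False,False,False,False,True], 4, [[0,1],[1,0]], [[0,1],[1,0]], 1),
     ([False,True,True,False,False,False,False,False], 10, [[1,0],[0,1]], [[1,0],[0,1]], 1),
     ([False,True,False,True,False,False,False,False], 12, [[1,0],[0,1]], [[1,0],[0,1]], 1),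
     ([False,True,False,False,True,False,False,False], 11, [[1,-1],[0,-1]], [[1,-1],[0,-1]], 1),
     ([False,True,False,False,False,True,False,False], 12, [[1,0],[3,-1]], [[1,0],[3,-1]], 1),
     ([False,True,False,False,False,False,True,False], 10, [[1,0],[2,-1]], [[1,0],[2,-1]], 1),
     ([False,True,False,False,False,False,False,True], 6, [[0,1],[1,0]], [[0,1],[1,0]], 1),
     ([False,False,True,False,False,False,False,True], 10, [[1,-1],[1,0]], [[0,1],[-1,1]], 1),
     ([False,False,False,False,True,True,False,False], 12, [[1,-2],[3,-5]], [[-5,2],[-3,1]], 1),
     ([False,False,False,False,True,False,False,True], 12, [[1,-2],[2,-5]], [[5,-2],[2,-1]], 1),
     ([False,False,False,False,False,True,True,False], 8, [[1,-1],[1,0]], [[0,1],[-1,1]], 1),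
     ([False,False,False,False,False,True,False,True], 8, [[0,1],[1,0]], [[0,1],[1,0]], 1),
     ([False,False,False,False,False,False,True,True], 5, [[0,1],[1,0]], [[0,1],[1,0]], 1)]"
|   "flag_table TF4 =
    [([True,True,False,False], 5, [[1,0],[0,1]], [[1,0],[0,1]], 1),
     ([True,False,True,False], 8, [[1,0],[0,1]], [[1,0],[0,1]], 1),
     ([True,False,False,True], 4, [[1,0],[0,1]], [[1,0],[0,1]], 1),
     ([False,True,True,False], 8, [[1,-1],[0,-1]], [[1,-1],[0,-1]], 1),
     ([False,True,False,True], 8, [[1,-1],[2,-1]], [[-1,1],[-2,1]], 1),
     ([False,False,True,True], 9, [[1,0],[0,1]], [[1,0],[0,1]], 1)]"
|   "flag_table TG2 =
    [([True,True], 5, [[0,1],[1,0]], [[0,1],[1,0]], 1)]"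
| "flag_table _ = []"

text \<open>
  For each class of rank two: its number, the type of the algebra, and the components of an
  isotropy algebra, given by their types and by their nodes in the order of the simple roots of the standard system.
\<close>

definition rank_two_flags :: "(nat \<times> simple_type \<times> (nat list \<times> simple_type) list) list" where
  "rank_two_flags =
    [(0, TE6, [([1,3,2,4], TD 4)]),
     (1, TE6, [([2,3,4,5], TA 4)]),
     (2, TE6, [([5], TA 1), ([1,3,2], TA 3)]),
     (3, TE6, [([1], TA 1), ([2], TA 1), ([4,5], TA 2)]),
     (4, TE7, [([6], TA 1), ([1,3,2,4], TD 4)]),
     (5, TE6, [([0,2], TA 2), ([4,5], TA 2)]),
     (6, TE7, [([5,6], TA 2), ([1,3,2], TA 3)]),
     (7, TE7, [([0], TA 1), ([1,3], TA 2), ([5,6], TA 2)]),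
     (8, TE7, [([1], TA 1), ([2], TA 1), ([4,5,6], TA 3)]),
     (9, TE7, [([1], TA 1), ([4], TA 1), ([6], TA 1), ([0,2], TA 2)]),
     (10, TE8, [([0], TA 1), ([3,4,5,6,7], TA 5)]),
     (11, TE8, [([1,3,2], TA 3), ([5,6,7], TA 3)]),
     (12, TE8, [([0,2], TA 2), ([4,5,6,7], TA 4)])]"

definition table_ok :: "simple_type \<Rightarrow> bool" where
  "table_ok L \<longleftrightarrow> list_all (\<lambda>(m, j, C). j < 16 \<and> nodes m = (if j < 13 then 2 else 3) \<and>
     iso_ok C (T_root_list L m) (canon ! j)) (flag_table L)"

text \<open>The zero restriction counts as seen from the start, so the roots of the isotropy algebra
  are ignored. Eleven further restrictions of positive roots exceed the bound ten on pairs of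
  opposite T-roots.\<close>

definition table_complete :: "simple_type \<Rightarrow> bool" where
  "table_complete L \<longleftrightarrow> (let ms = map fst (flag_table L); cs = rev (pos_coeffs L) in
     list_all (\<lambda>m. if mem m ms then True else many m 10 [replicate (nodes m) 0] cs)
       (filter (\<lambda>m. 2 \<le> nodes m) (masks (rk L))))"

definition isolated :: "int list list \<Rightarrow> bool" where
  "isolated X \<longleftrightarrow> list_ex (\<lambda>c. list_all (\<lambda>c'. \<not> mem (map2 (+) c c') X) X) X"

definition masks_of_class :: "simple_type \<Rightarrow> nat \<Rightarrow> bool list list" where
  "masks_of_class L j = map fst (filter (\<lambda>(_, i, _). i = j) (flag_table L))"

text \<open>\<open>k\<close> is the number of roots of type \<open>S\<close>. Outside the masks of
  class \<open>j\<close> this number recurs only for \<open>A_3 A_3\<close> in \<open>E_8\<close>,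
  whose 24 roots are matched by the 20 + 2 + 2 roots of \<open>A_4 A_1 A_1\<close>; there the
  isolated root of a summand \<open>A_1\<close> decides.\<close>

definition type_unique :: "nat \<Rightarrow> simple_type \<Rightarrow> simple_type list \<Rightarrow> bool" where
  "type_unique j L S \<longleftrightarrow> (let ms = masks_of_class L j; k = sum_list (map (\<lambda>T. length (std_list T)) S) in
     list_all (\<lambda>m. if mem m ms then True else let X = levi_list L m in
       if length X \<noteq> k then True else if S = [TA 3, TA 3] then isolated X else False)
       (filter (\<lambda>m. nodes m = 2) (masks (rk L))))"

fun std_simple :: "simple_type \<Rightarrow> int list list" where
  "std_simple (TA n) = map (\<lambda>k. (replicate 8 0)[k := 1, Suc k := - 1]) [0..<n]"
| "std_simple (TD n) = map (\<lambda>k. (replicate 8 0)[k := 1, Suc k := - 1]) [0..<n - 1] @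
     [(replicate 8 0)[n - 2 := 1, n - 1 := 1]]"
| "std_simple _ = []"

text \<open>Twice the coefficients of a root with respect to \<open>std_simple\<close>, as linear forms.\<close>

fun std_coefficient_forms :: "simple_type \<Rightarrow> int list list" where
  "std_coefficient_forms (TA n) = map (\<lambda>k. replicate (Suc k) 2 @ replicate (7 - k) 0) [0..<n]"
| "std_coefficient_forms (TD n) = map (\<lambda>k. replicate (Suc k) 2 @ replicate (7 - k) 0) [0..<n - 2] @
     [replicate (n - 1) 1 @ [- 1] @ replicate (8 - n) 0, replicate n 1 @ replicate (8 - n) 0]"
| "std_coefficient_forms _ = []"

type_synonym component_cert = "bool list \<times> simple_type \<times> int list list \<times> int list list \<times> int"

text \<open>Nonadjacency of nodes is expressed by sums and differences of simple roots, the form in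
  which \<open>nonadjacent_roots_orthogonal\<close> applies to the roots of an algebra.\<close>

definition orth_masks :: "simple_type \<Rightarrow> bool list \<Rightarrow> bool list \<Rightarrow> bool" where
  "orth_masks L I J \<longleftrightarrow> (let n = rk L; cs = coeffs L in
     list_all (\<lambda>i. list_all (\<lambda>j. i \<noteq> j \<and> \<not> mem (map2 (+) (unit_list n i) (unit_list n j)) cs \<and>
         \<not> mem (map2 (-) (unit_list n i) (unit_list n j)) cs)
       (filter ((!) J) [0..<n])) (filter ((!) I) [0..<n]))"

fun orth_ok :: "simple_type \<Rightarrow> bool list list \<Rightarrow> bool" where
  "orth_ok L [] = True"
| "orth_ok L (I # Is) = (list_all (orth_masks L I) Is \<and> orth_ok L Is)"

text \<open>The first matrix sends the simple roots of the component to the standard simple roots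
  and all others to zero; the second reads off doubled coefficients, hence the final 2.\<close>

definition component_cert :: "nat \<Rightarrow> nat list \<times> simple_type \<Rightarrow> component_cert" where
  "component_cert n = (\<lambda>(p, T).
     (map (\<lambda>i. i \<in> set p) [0..<n], T,
      map (\<lambda>r. map (\<lambda>i. case map_of (zip p (std_simple T)) i of None \<Rightarrow> 0 | Some v \<Rightarrow> v ! r) [0..<n]) [0..<8],
      map (\<lambda>i. case map_of (zip p (std_coefficient_forms T)) i of None \<Rightarrow> replicate 8 0 | Some w \<Rightarrow> w) [0..<n], 2))"

definition rank_two_certs :: "(nat \<times> simple_type \<times> bool list \<times> component_cert list) list" where
  "rank_two_certs = map (\<lambda>(j, L, ps).
     (j, L, map (\<lambda>i. i \<notin> set (concat (map fst ps))) [0..<rk L], map (component_cert (rk L)) ps)) rank_two_flags"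

text \<open>The roots selected by a mask have zero coefficients at the marked nodes, so those
  supported on a set \<open>I\<close> of nodes belong to the mask \<open>map Not I\<close>.\<close>

definition comps_ok :: "simple_type \<Rightarrow> bool list \<Rightarrow> component_cert list \<Rightarrow> bool" where
  "comps_ok L m comps \<longleftrightarrow>
     (let X = levi_list L m; Y = concat (map (\<lambda>(I, _). levi_list L (map Not I)) comps) in
        list_all (\<lambda>x. mem x Y) X \<and> list_all (\<lambda>y. mem y X) Y) \<and>
     orth_ok L (map fst comps) \<and>
     list_all (\<lambda>(I, T, C). length I = rk L \<and> iso_ok C (levi_list L (map Not I)) (std_list T)) comps"

definition rank_two_ok :: "nat \<times> simple_type \<times> bool list \<times> component_cert list \<Rightarrow> bool" where
  "rank_two_ok = (\<lambda>(j, L, m, comps). mem m (masks_of_class L j) \<and> length m = rk L \<and> comps_ok L m comps \<and>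
     type_unique j L (map (\<lambda>(_, T, _). T) comps))"

text \<open>One round of spreading along the relation that joins two vectors when their sum is in
  \<open>Y\<close> or zero.\<close>

definition grow :: "int list list \<Rightarrow> int list list \<Rightarrow> int list list" where
  "grow Y S = filter (\<lambda>x. if mem x S then True else if mem (map uminus x) S then True
     else list_ex (\<lambda>y. mem (map2 (+) x y) Y) S) Y"

definition doubled :: "int list list \<Rightarrow> int list list" where
  "doubled Y = filter (\<lambda>c. mem (map ((*) 2) c) Y) Y"

definition canon_inv :: "nat \<Rightarrow> nat \<times> nat \<times> nat" where
  "canon_inv j = (let Y = canon ! j in (if j < 13 then 2 else 3, length Y, length (doubled Y)))"

text \<open>Four rounds of \<open>grow\<close> from the first vector exhaust each of the sixteen
  models.\<close>

definition canon_ok :: "nat \<Rightarrow> bool" where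
  "canon_ok j \<longleftrightarrow> (let Y = canon ! j; k = (if j < 13 then 2 else 8) in
     Y \<noteq> [] \<and> distinct Y \<and> length Y \<le> 20 \<and>
     list_all (\<lambda>c. length c = k \<and> \<not> list_all (\<lambda>x. x = 0) c) Y \<and>
     (let S = grow Y (grow Y (grow Y (grow Y [hd Y]))) in list_all (\<lambda>y. mem y S) Y))"

section \<open>Evaluation of the finite checks\<close>

lemma table_ok: "L \<in> exceptional_types \<Longrightarrow> table_ok L"
proof -
  have "table_ok TE6" by code_simp
  moreover have "table_ok TE7" by code_simp
  moreover have "table_ok TE8" by code_simp
  moreover have "table_ok TF4" by code_simp
  moreover have "table_ok TG2" by code_simp
  ultimately show "L \<in> exceptional_types \<Longrightarrow> table_ok L" by (auto simp: exceptional_types_def)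
qed

lemma table_complete: "L \<in> exceptional_types \<Longrightarrow> table_complete L"
proof -
  have "table_complete TE6" by code_simp
  moreover have "table_complete TE7" by code_simp
  moreover have "table_complete TE8" by code_simp
  moreover have "table_complete TF4" by code_simp
  moreover have "table_complete TG2" by code_simp
  ultimately show "L \<in> exceptional_types \<Longrightarrow> table_complete L" by (auto simp: exceptional_types_def)
qed

lemma canon_ok: "j < 16 \<Longrightarrow> canon_ok j"
proof -
  have "list_all canon_ok [0..<16]" by code_simp
  then show "j < 16 \<Longrightarrow> canon_ok j" by (simp add: list_all_iff)
qed

lemma canon_inv_list: "map canon_inv [0..<16] =
  [(2, 6, 0), (2, 8, 0), (2, 10, 2), (2, 12, 2), (2, 12, 4), (2, 12, 0), (2, 14, 2), (2, 16, 2), (2, 16, 4),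
   (2, 18, 6), (2, 18, 4), (2, 20, 4), (2, 20, 2), (3, 18, 0), (3, 16, 0), (3, 20, 0)]"
  by code_simp

lemma rank_two_ok: "e \<in> set rank_two_certs \<Longrightarrow> rank_two_ok e"
proof -
  have "rank_two_ok (rank_two_certs ! 0)" by code_simp
  moreover have "rank_two_ok (rank_two_certs ! 1)" by code_simp
  moreover have "rank_two_ok (rank_two_certs ! 2)" by code_simp
  moreover have "rank_two_ok (rank_two_certs ! 3)" by code_simp
  moreover have "rank_two_ok (rank_two_certs ! 4)" by code_simp
  moreover have "rank_two_ok (rank_two_certs ! 5)" by code_simp
  moreover have "rank_two_ok (rank_two_certs ! 6)" by code_simp
  moreover have "rank_two_ok (rank_two_certs ! 7)" by code_simp
  moreover have "rank_two_ok (rank_two_certs ! 8)" by code_simp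
  moreover have "rank_two_ok (rank_two_certs ! 9)" by code_simp
  moreover have "rank_two_ok (rank_two_certs ! 10)" by code_simp
  moreover have "rank_two_ok (rank_two_certs ! 11)" by code_simp
  moreover have "rank_two_ok (rank_two_certs ! 12)" by code_simp
  moreover have "length rank_two_certs = 13" by code_simp
  ultimately have "\<forall>i<length rank_two_certs. rank_two_ok (rank_two_certs ! i)"
    by (auto simp: less_Suc_eq numeral_eq_Suc)
  then show "e \<in> set rank_two_certs \<Longrightarrow> rank_two_ok e" by (auto simp: in_set_conv_nth)
qed

section \<open>Dominant charts and Levi subsystems\<close>

text \<open>If the new functional vanishes at \<open>y\<close> but not on \<open>s\<close>, a
  multiple \<open>e z\<close> with nonzero value is added to \<open>y\<close>. Nonzero
  \<open>e\<close> serves the new functional, and each earlier one forbids at most one further value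
  of \<open>e\<close>.\<close>

lemma inner_generic_vector:
  fixes s :: "'a::real_inner set"
  assumes "finite F" "subspace s"
  shows "\<exists>y\<in>s. \<forall>\<alpha>\<in>F. \<alpha> \<bullet> y = 0 \<longrightarrow> (\<forall>x\<in>s. \<alpha> \<bullet> x = 0)"
  using assms(1)
proof (induction F)
  case empty
  then show ?case using subspace_0[OF assms(2)] by blast
next
  case (insert \<alpha> F)
  then obtain y where y: "y \<in> s" "\<And>\<beta>. \<beta> \<in> F \<Longrightarrow> \<beta> \<bullet> y = 0 \<Longrightarrow> \<forall>x\<in>s. \<beta> \<bullet> x = 0" by blast
  show ?case
  proof (cases "\<alpha> \<bullet> y = 0 \<longrightarrow> (\<forall>x\<in>s. \<alpha> \<bullet> x = 0)")
    case True
    then show ?thesis using y by blast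
  next
    case False
    then obtain z where z: "z \<in> s" "\<alpha> \<bullet> z \<noteq> 0" and \<alpha>y: "\<alpha> \<bullet> y = 0" by blast
    have "finite (insert 0 ((\<lambda>\<beta>. - (\<beta> \<bullet> y) / (\<beta> \<bullet> z)) ` F))" using insert by simp
    then obtain e where e: "e \<notin> insert 0 ((\<lambda>\<beta>. - (\<beta> \<bullet> y) / (\<beta> \<bullet> z)) ` F)"
      using ex_new_if_finite[OF infinite_UNIV_char_0] by blast
    have "\<forall>x\<in>s. \<beta> \<bullet> x = 0" if b: "\<beta> \<in> F" "\<beta> \<bullet> (y + e *\<^sub>R z) = 0" for \<beta>
    proof (cases "\<beta> \<bullet> z = 0")
      case True
      then show ?thesis using b y by (simp add: inner_add_right)
    next
      case False
      then have "e = - (\<beta> \<bullet> y) / (\<beta> \<bullet> z)" using b by (simp add: inner_add_right field_simps)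
      then show ?thesis using e b by blast
    qed
    moreover have "\<alpha> \<bullet> (y + e *\<^sub>R z) \<noteq> 0" using z \<alpha>y e by (simp add: inner_add_right)
    moreover have "y + e *\<^sub>R z \<in> s" using y z assms(2) by (simp add: subspace_add subspace_scale)
    ultimately show ?thesis by blast
  qed
qed

section \<open>Restriction of coordinates to the marked nodes\<close>

lemma sel_map: "sel m (map f xs) = map f (sel m xs)"
  unfolding sel_def by (induction m xs rule: list_induct2') auto

lemma length_sel: "length m = length xs \<Longrightarrow> length (sel m xs) = nodes m"
  unfolding sel_def nodes_def by (induction m xs rule: list_induct2) auto

lemma set_sel_upt: "length m = n \<Longrightarrow> set (sel m [0..<n]) = {i. i < n \<and> m ! i}"
  unfolding sel_def by (force simp: in_set_zip image_iff)

lemma distinct_sel: "length m = length xs \<Longrightarrow> distinct xs \<Longrightarrow> distinct (sel m xs)"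
proof (induction m xs rule: list_induct2)
  case (Cons b m x xs)
  have "set (sel m xs) \<subseteq> set xs" unfolding sel_def by (auto dest: set_zip_rightD)
  then show ?case using Cons by (auto simp: sel_def)
qed (simp add: sel_def)

lemma sel_nth: "length m = length c \<Longrightarrow> sel m c = map ((!) c) (sel m [0..<length c])"
  by (metis map_nth sel_map)

definition masked :: "bool list \<Rightarrow> (real^8) set" where
  "masked m = {v. \<forall>i<length m. m ! i \<longrightarrow> v $ of_nat i = 0}"

lemma subspace_masked: "subspace (masked m)"
  by (auto simp: subspace_def masked_def)

lemma cvec_masked: assumes "length c = length m" "length m \<le> 8"
  shows "cvec c \<in> masked m \<longleftrightarrow> zero_on m c"
proof -
  have "zero_on m c \<longleftrightarrow> (\<forall>i\<in>set (sel m [0..<length c]). c ! i = 0)"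
    unfolding zero_on_def using sel_nth[of m c] assms by (simp add: list_all_iff)
  then show ?thesis using assms by (auto simp: set_sel_upt masked_def cvec_nth)
qed

text \<open>The linear extension of \<open>sel m\<close> to real vectors: the marked coordinates
  move into the first \<open>nodes m\<close> places.\<close>

definition node_proj :: "bool list \<Rightarrow> real^8 \<Rightarrow> real^8" where
  "node_proj m v = (\<Sum>j<8. (if j < nodes m then v $ of_nat (sel m [0..<length m] ! j) else 0) *\<^sub>R \<epsilon> j)"

lemma node_proj_nth: "j < 8 \<Longrightarrow> node_proj m v $ of_nat j =
    (if j < nodes m then v $ of_nat (sel m [0..<length m] ! j) else 0)"
  unfolding node_proj_def by (subst sum_\<epsilon>_nth) auto

lemma linear_node_proj: "linear (node_proj m)"
  by (rule linearI; rule vec8_eqI) (simp_all add: node_proj_nth)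

lemma nodes_le: "nodes m \<le> length m"
  by (simp add: nodes_def)

lemma sel_upt_nth: assumes "j < nodes m"
  shows "sel m [0..<length m] ! j < length m" "m ! (sel m [0..<length m] ! j)"
proof -
  have "sel m [0..<length m] ! j \<in> set (sel m [0..<length m])"
    using assms length_sel[of m "[0..<length m]"] by simp
  then show "sel m [0..<length m] ! j < length m" "m ! (sel m [0..<length m] ! j)"
    by (simp_all add: set_sel_upt)
qed

lemma node_proj_cvec: assumes "length c = length m" "length m \<le> 8"
  shows "node_proj m (cvec c) = cvec (sel m c)"
proof (rule vec8_eqI)
  fix j :: nat assume j: "j < 8"
  have "length (sel m c) = nodes m" using assms by (simp add: length_sel)
  moreover have "sel m c ! j = c ! (sel m [0..<length m] ! j)" if "j < nodes m"
    using that sel_nth[of m c] length_sel[of m "[0..<length m]"] assms by simp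
  ultimately show "node_proj m (cvec c) $ of_nat j = cvec (sel m c) $ of_nat j"
    using j sel_upt_nth[of j m] assms by (auto simp: node_proj_nth cvec_nth)
qed

lemma node_proj_eq_0: assumes "length m \<le> 8" shows "node_proj m v = 0 \<longleftrightarrow> v \<in> masked m"
proof
  assume 0: "node_proj m v = 0"
  show "v \<in> masked m" unfolding masked_def
  proof safe
    fix i assume i: "i < length m" "m ! i"
    then have "i \<in> set (sel m [0..<length m])" by (simp add: set_sel_upt)
    then obtain j where j: "j < nodes m" "sel m [0..<length m] ! j = i"
      using length_sel[of m "[0..<length m]"] by (metis diff_zero in_set_conv_nth length_upt)
    then have "j < 8" using nodes_le[of m] assms by simp
    then show "v $ of_nat i = 0" using node_proj_nth[of j m v] j 0 by simp
  qed
next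
  assume "v \<in> masked m"
  then show "node_proj m v = 0"
    by (intro vec8_eqI) (use sel_upt_nth in \<open>auto simp: node_proj_nth masked_def\<close>)
qed

lemma set_levi_list: "set (levi_list L m) = {c \<in> set (coeffs L). zero_on m c}"
proof -
  have "zero_on m (map uminus c) = zero_on m c" for c
    by (simp add: zero_on_def sel_map list_all_iff)
  then show ?thesis by (auto simp: levi_list_def set_coeffs Let_def)
qed

lemma set_T_root_list: "set (T_root_list L m) = sel m ` {c \<in> set (coeffs L). \<not> zero_on m c}"
proof -
  have "set (fold (\<lambda>c X. let x = sel m c in
       if list_all (\<lambda>y. y = 0) x then X else if mem x X then X else x # X) cs X)
     = set X \<union> sel m ` {c \<in> set cs. \<not> zero_on m c}" for cs X
    by (induction cs arbitrary: X) (auto simp: Let_def zero_on_def)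
  then have "set (T_root_list L m) = sel m ` {c \<in> set (pos_coeffs L). \<not> zero_on m c}
      \<union> map uminus ` sel m ` {c \<in> set (pos_coeffs L). \<not> zero_on m c}"
    by (simp add: T_root_list_def Let_def)
  moreover have "zero_on m (map uminus c) = zero_on m c" for c
    by (simp add: zero_on_def sel_map list_all_iff)
  then have "{c \<in> set (coeffs L). \<not> zero_on m c} = {c \<in> set (pos_coeffs L). \<not> zero_on m c}
    \<union> map uminus ` {c \<in> set (pos_coeffs L). \<not> zero_on m c}"
    by (auto simp: set_coeffs)
  ultimately show ?thesis by (simp add: image_Un image_image sel_map)
qed

lemma dim_coordinate_set:
  assumes "I \<subseteq> {..<8}" "\<epsilon> ` I \<subseteq> S" "\<And>v j. v \<in> S \<Longrightarrow> j < 8 \<Longrightarrow> j \<notin> I \<Longrightarrow> v $ of_nat j = 0"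
  shows "dim S = card I"
proof -
  have inj: "inj_on \<epsilon> I"
  proof (rule inj_onI)
    fix i j assume ij: "i \<in> I" "j \<in> I" "\<epsilon> i = \<epsilon> j"
    moreover have "i < 8" "j < 8" using ij assms(1) by auto
    ultimately show "i = j" using \<epsilon>_nth[of i i] \<epsilon>_nth[of j i] by (metis zero_neq_one)
  qed
  have "\<epsilon> ` I \<subseteq> Basis" by (auto simp: \<epsilon>_def Basis_vec_def)
  then have ind: "independent (\<epsilon> ` I)" using independent_Basis independent_mono by blast
  have "S \<subseteq> span (\<epsilon> ` I)"
  proof
    fix v assume v: "v \<in> S"
    have "v = (\<Sum>i<8. (v $ of_nat i) *\<^sub>R \<epsilon> i)" by (rule vec8_expand)
    also have "\<dots> = (\<Sum>i\<in>I. (v $ of_nat i) *\<^sub>R \<epsilon> i)"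
      by (rule sum.mono_neutral_right) (use assms(1) assms(3)[OF v] in auto)
    also have "\<dots> \<in> span (\<epsilon> ` I)" by (intro span_sum span_scale span_base) blast
    finally show "v \<in> span (\<epsilon> ` I)" .
  qed
  then have "dim S = card (\<epsilon> ` I)" using assms(2) ind by (intro dim_unique) auto
  then show ?thesis using inj by (simp add: card_image)
qed

section \<open>Charts and their simple reflections\<close>

locale charted_roots =
  fixes L :: simple_type and R :: "'a::euclidean_space set"
  assumes L: "L \<in> exceptional_types"
begin

abbreviation "n \<equiv> rk L"

definition charts :: "('a \<Rightarrow> real^8) set" where
  "charts = {\<kappa>. linear \<kappa> \<and> inj_on \<kappa> (span R) \<and> \<kappa> ` R = cvec ` set (coeffs L)}"

definition simple_root :: "('a \<Rightarrow> real^8) \<Rightarrow> nat \<Rightarrow> 'a" where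
  "simple_root \<kappa> i = inv_into R \<kappa> (\<epsilon> i)"

lemmas ok = root_datum_ok[OF L]

lemma n_le: "n \<le> 8" using rk_le[OF ok] .

lemma ok_props:
  shows "j < n \<Longrightarrow> length (cartan_columns L ! j) = n"
    and "j < n \<Longrightarrow> cartan_columns L ! j ! j = 2"
    and "j < n \<Longrightarrow> unit_list n j \<in> set (pos_coeffs L)"
    and "j < n \<Longrightarrow> 0 < dot (cartan_columns L ! j) (two_rho L)"
    and refl_list_coeffs_pos: "j < n \<Longrightarrow> c \<in> set (pos_coeffs L) \<Longrightarrow> refl_list L j c \<in> set (coeffs L)"
proof -
  assume j: "j < n"
  have *: "length (cartan_columns L ! j) = n \<and> unit_list n j \<in> set (hd (root_levels L)) \<and> cartan_columns L ! j ! j = 2 \<and>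
       0 < dot (cartan_columns L ! j) (two_rho L)" "root_levels L \<noteq> []"
    using ok j by (auto simp: root_datum_ok_def Let_def list_all_iff)
  then show "length (cartan_columns L ! j) = n" "cartan_columns L ! j ! j = 2"
    "0 < dot (cartan_columns L ! j) (two_rho L)" by auto
  show "unit_list n j \<in> set (pos_coeffs L)"
    using * hd_in_set[of "root_levels L"] unfolding pos_coeffs_def by auto
next
  assume j: "j < n" and c: "c \<in> set (pos_coeffs L)"
  let ?c' = "refl_list L j c" and ?k = "nat (sum_list (refl_list L j c) - 1)"
  have "?c' = c \<or> map uminus ?c' = c \<or> ?c' \<in> set (concat (take 1 (drop ?k (root_levels L))))"
  proof -
    obtain Q where Q: "Q \<in> set (root_levels L)" "c \<in> set Q" using c by (auto simp: pos_coeffs_def)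
    have "\<forall>j\<in>set [0..<n]. \<forall>Q\<in>set (root_levels L). \<forall>c\<in>set Q. if refl_list L j c = c then True
       else if map uminus (refl_list L j c) = c then True
       else refl_list L j c \<in> set (concat (take 1 (drop (nat (sum_list (refl_list L j c) - 1)) (root_levels L))))"
      using ok unfolding root_datum_ok_def Let_def list_all_iff list_eq_iff mem_iff by (elim conjE) assumption
    then have "if ?c' = c then True else if map uminus ?c' = c then True
       else ?c' \<in> set (concat (take 1 (drop ?k (root_levels L))))"
      using j Q by (metis atLeastLessThan_iff le0 set_upt)
    then show ?thesis by (meson)
  qed
  moreover have "?c' \<in> set (coeffs L)" if "map uminus ?c' = c"
  proof -
    have "?c' = map uminus c" using that map_uminus_uminus by metis
    then show ?thesis using c by (simp add: set_coeffs)
  qed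
  moreover have "set (concat (take 1 (drop ?k (root_levels L)))) \<subseteq> set (coeffs L)"
    unfolding set_coeffs pos_coeffs_def using set_take_subset set_drop_subset by fastforce
  ultimately show "refl_list L j c \<in> set (coeffs L)" using c by (auto simp: set_coeffs)
qed

lemma refl_list_uminus: assumes "j < n" "length c = n"
  shows "refl_list L j (map uminus c) = map uminus (refl_list L j c)"
proof -
  have "dot r (map uminus c) = - dot r c" for r
    by (simp add: dot_sum sum_negf flip: sum_distrib_left)
  then show ?thesis using assms by (auto simp: refl_list_def map_update intro!: nth_equalityI simp: nth_list_update)
qed

lemma refl_list_coeffs: assumes "j < n" "c \<in> set (coeffs L)" shows "refl_list L j c \<in> set (coeffs L)"
proof -
  have u: "map uminus c \<in> set (coeffs L)" if "c \<in> set (coeffs L)" for c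
    using that by (auto simp: set_coeffs)
  consider "c \<in> set (pos_coeffs L)" | c' where "c' \<in> set (pos_coeffs L)" "c = map uminus c'"
    using assms(2) by (auto simp: set_coeffs)
  then show ?thesis
  proof cases
    case 1
    then show ?thesis using refl_list_coeffs_pos assms(1) by blast
  next
    case 2
    then have "refl_list L j c = map uminus (refl_list L j c')"
      using refl_list_uminus[OF assms(1), of c'] pos_coeffs_props(1)[OF ok] by simp
    then show ?thesis using u refl_list_coeffs_pos[OF assms(1) 2(1)] by simp
  qed
qed

text \<open>A reflection of coordinates and not of \<open>R\<close>: it is built from the Cartan
  integers alone and acts on charts by composition, so the metric of \<open>R\<close> does not
  enter.\<close>

definition simple_refl :: "nat \<Rightarrow> real^8 \<Rightarrow> real^8" where
  "simple_refl j v = v - row_form (cartan_columns L ! j) v *\<^sub>R \<epsilon> j"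

lemma linear_simple_refl: "linear (simple_refl j)"
  unfolding simple_refl_def
  by (rule linearI) (simp_all add: linear_add[OF linear_row_form] linear_scale[OF linear_row_form] algebra_simps)

lemma row_form_\<epsilon>: assumes "j < n" "i < n" shows "row_form (cartan_columns L ! j) (\<epsilon> i) = of_int (cartan_columns L ! j ! i)"
proof -
  have "row_form (cartan_columns L ! j) (\<epsilon> i) = (\<Sum>k<8. if k = i then of_int (cartan_columns L ! j ! i) else 0)"
    unfolding row_form_def using assms n_le ok_props(1) by (intro sum.cong) (auto simp: \<epsilon>_nth)
  then show ?thesis using assms n_le by simp
qed

lemma refl_refl: assumes "j < n" shows "simple_refl j (simple_refl j v) = v"
  using row_form_\<epsilon>[OF assms assms] ok_props(2)[OF assms]
  by (simp add: simple_refl_def linear_diff[OF linear_row_form] linear_scale[OF linear_row_form] algebra_simps)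

lemma refl_cvec: assumes "j < n" "length c = n" shows "simple_refl j (cvec c) = cvec (refl_list L j c)"
proof (rule vec8_eqI)
  fix k :: nat assume "k < 8"
  then show "simple_refl j (cvec c) $ of_nat k = cvec (refl_list L j c) $ of_nat k"
    using assms n_le row_form_cvec[of c "cartan_columns L ! j"]
    by (auto simp: simple_refl_def refl_list_def cvec_nth \<epsilon>_nth nth_list_update)
qed

lemma refl_image: assumes "j < n" shows "simple_refl j ` cvec ` set (coeffs L) = cvec ` set (coeffs L)"
proof -
  have sub: "simple_refl j ` cvec ` set (coeffs L) \<subseteq> cvec ` set (coeffs L)"
    using refl_cvec[OF assms] refl_list_coeffs[OF assms] coeffs_length[OF ok] by auto
  then have "simple_refl j ` simple_refl j ` cvec ` set (coeffs L) \<subseteq> simple_refl j ` cvec ` set (coeffs L)" by (rule image_mono)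
  then show ?thesis using sub refl_refl[OF assms] by (simp add: image_image)
qed

lemma \<epsilon>_coeffs: "i < n \<Longrightarrow> \<epsilon> i \<in> cvec ` set (coeffs L)"
  using ok_props(3)[of i] cvec_unit[of i n] n_le by (auto simp: set_coeffs image_iff intro!: bexI[of _ "unit_list n i"])

lemma simple_root: assumes "\<kappa> \<in> charts" "i < n"
  shows "simple_root \<kappa> i \<in> R" "\<kappa> (simple_root \<kappa> i) = \<epsilon> i"
proof -
  have "\<epsilon> i \<in> \<kappa> ` R" using assms \<epsilon>_coeffs by (simp add: charts_def)
  then show "simple_root \<kappa> i \<in> R" "\<kappa> (simple_root \<kappa> i) = \<epsilon> i"
    unfolding simple_root_def by (auto intro: inv_into_into f_inv_into_f)
qed

lemma chart_support: assumes "\<kappa> \<in> charts" "x \<in> span R" "j < 8" "n \<le> j" shows "\<kappa> x $ of_nat j = 0"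
proof -
  have lin: "linear \<kappa>" using assms by (simp add: charts_def)
  show ?thesis using assms(2)
  proof (induction rule: span_induct)
    case base
    show ?case using lin by (auto simp: subspace_def linear_0 linear_add linear_scale)
  next
    case (step x)
    then obtain c where "c \<in> set (coeffs L)" "\<kappa> x = cvec c" using assms(1) by (auto simp: charts_def)
    then show ?case using coeffs_length[OF ok] assms(3,4) by (simp add: cvec_nth)
  qed
qed

lemma chart_expand: assumes "\<kappa> \<in> charts" "x \<in> span R"
  shows "x = (\<Sum>i<n. (\<kappa> x $ of_nat i) *\<^sub>R simple_root \<kappa> i)" (is "_ = ?y")
proof -
  have lin: "linear \<kappa>" and inj: "inj_on \<kappa> (span R)" using assms by (auto simp: charts_def)
  have "?y \<in> span R" by (intro span_sum span_scale span_base) (use simple_root[OF assms(1)] in auto)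
  moreover have "\<kappa> ?y = (\<Sum>i<n. (\<kappa> x $ of_nat i) *\<^sub>R \<epsilon> i)"
    using simple_root[OF assms(1)] by (simp add: linear_sum[OF lin] linear_scale[OF lin])
  then have "\<kappa> ?y = \<kappa> x"
    by (intro vec8_eqI) (use chart_support[OF assms] n_le in \<open>auto simp: sum_\<epsilon>_nth simp del: sum_component\<close>)
  ultimately show ?thesis using inj assms(2) by (metis inj_onD)
qed

lemma refl_chart: assumes "\<kappa> \<in> charts" "j < n" shows "simple_refl j \<circ> \<kappa> \<in> charts"
proof -
  have inj: "inj_on (simple_refl j) X" for X using refl_refl[OF assms(2)] by (metis inj_onI)
  have \<kappa>: "linear \<kappa>" "inj_on \<kappa> (span R)" "\<kappa> ` R = cvec ` set (coeffs L)" using assms(1) by (auto simp: charts_def)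
  have "(simple_refl j \<circ> \<kappa>) ` R = simple_refl j ` cvec ` set (coeffs L)" unfolding \<kappa>(3)[symmetric] by (rule image_comp[symmetric])
  then show ?thesis using \<kappa> linear_simple_refl inj refl_image[OF assms(2)]
    by (simp add: charts_def linear_compose comp_inj_on)
qed

text \<open>Both sides have image \<open>\<epsilon> i\<close> under the reflected chart, which is
  injective on the span of the roots.\<close>

lemma simple_root_refl: assumes "\<kappa> \<in> charts" "j < n" "i < n"
  shows "simple_root (simple_refl j \<circ> \<kappa>) i = simple_root \<kappa> i - of_int (cartan_columns L ! j ! i) *\<^sub>R simple_root \<kappa> j" (is "?u = ?v")
proof -
  note ch = refl_chart[OF assms(1,2)]
  have inj: "inj_on (simple_refl j \<circ> \<kappa>) (span R)" and lin: "linear \<kappa>" using ch assms by (auto simp: charts_def)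
  have "?u \<in> span R" using simple_root(1)[OF ch assms(3)] by (rule span_base)
  moreover have "?v \<in> span R"
    using simple_root(1)[OF assms(1)] assms by (intro span_diff span_scale span_base)
  moreover have "(simple_refl j \<circ> \<kappa>) ?v = \<epsilon> i"
    using simple_root[OF assms(1)] assms(2,3) row_form_\<epsilon> ok_props(2)[OF assms(2)]
    by (simp add: linear_diff[OF lin] linear_scale[OF lin] simple_refl_def linear_diff[OF linear_row_form]
        linear_scale[OF linear_row_form] algebra_simps)
  ultimately show ?thesis using simple_root(2)[OF ch assms(3)] inj by (metis inj_onD)
qed

text \<open>
  The simple reflection at a simple root on which \<open>l\<close> is negative increases the value of \<open>l\<close>
  on the sum of the positive roots, which takes only finitely many values.
\<close>

lemma dominant_chart:
  assumes ne: "\<kappa>\<^sub>0 \<in> charts" and fin: "finite R" and l: "linear (l :: 'a \<Rightarrow> real)"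
  obtains \<kappa> where "\<kappa> \<in> charts" "\<And>i. i < n \<Longrightarrow> 0 \<le> l (simple_root \<kappa> i)"
proof -
  \<comment> \<open>The minimum reproduces the truncation in \<open>dot\<close>, with which
    \<open>F\<close> is compared below.\<close>
  define k where "k = min n (length (two_rho L))"
  define F where "F \<kappa> = (\<Sum>i<k. of_int (two_rho L ! i) * l (simple_root \<kappa> i))" for \<kappa>
  \<comment> \<open>Values of \<open>F\<close> depend only on the tuple of simple roots, whose
    entries come from the finite set \<open>R\<close>.\<close>
  have "F ` charts \<subseteq> (\<lambda>f. \<Sum>i<k. of_int (two_rho L ! i) * l (f i)) ` (PiE {..<k} (\<lambda>_. R))"
  proof
    fix y assume "y \<in> F ` charts"
    then obtain \<kappa> where \<kappa>: "\<kappa> \<in> charts" "y = F \<kappa>" by blast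
    let ?f = "restrict (simple_root \<kappa>) {..<k}"
    have "?f \<in> PiE {..<k} (\<lambda>_. R)" using simple_root(1)[OF \<kappa>(1)] by (auto simp: k_def)
    moreover have "y = (\<Sum>i<k. of_int (two_rho L ! i) * l (?f i))" by (simp add: \<kappa>(2) F_def)
    ultimately show "y \<in> (\<lambda>f. \<Sum>i<k. of_int (two_rho L ! i) * l (f i)) ` (PiE {..<k} (\<lambda>_. R))" by blast
  qed
  then have finF: "finite (F ` charts)" using fin by (meson finite_PiE finite_imageI finite_lessThan finite_subset)
  then have "Max (F ` charts) \<in> F ` charts" using ne by (intro Max_in) auto
  then obtain \<kappa> where \<kappa>: "\<kappa> \<in> charts" "F \<kappa> = Max (F ` charts)" by auto
  have "0 \<le> l (simple_root \<kappa> j)" if j: "j < n" for j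
  proof (rule ccontr)
    assume neg: "\<not> 0 \<le> l (simple_root \<kappa> j)"
    have "F (simple_refl j \<circ> \<kappa>) = (\<Sum>i<k. of_int (two_rho L ! i) * (l (simple_root \<kappa> i) - of_int (cartan_columns L ! j ! i) * l (simple_root \<kappa> j)))"
      unfolding F_def by (intro sum.cong) (use simple_root_refl[OF \<kappa>(1) j] in \<open>auto simp: k_def linear_diff[OF l] linear_scale[OF l]\<close>)
    also have "\<dots> = F \<kappa> - (\<Sum>i<k. of_int (cartan_columns L ! j ! i) * of_int (two_rho L ! i)) * l (simple_root \<kappa> j)"
      unfolding F_def by (simp add: algebra_simps sum_subtractf sum_distrib_left sum_distrib_right)
    also have "(\<Sum>i<k. of_int (cartan_columns L ! j ! i) * of_int (two_rho L ! i)) = real_of_int (dot (cartan_columns L ! j) (two_rho L))"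
      using ok_props(1)[OF j] by (simp add: dot_sum k_def)
    finally have "F (simple_refl j \<circ> \<kappa>) = F \<kappa> - real_of_int (dot (cartan_columns L ! j) (two_rho L)) * l (simple_root \<kappa> j)" .
    moreover have "real_of_int (dot (cartan_columns L ! j) (two_rho L)) * l (simple_root \<kappa> j) < 0"
      using neg ok_props(4)[OF j] by (intro mult_pos_neg) auto
    ultimately have "F (simple_refl j \<circ> \<kappa>) > F \<kappa>" by linarith
    moreover have "F (simple_refl j \<circ> \<kappa>) \<le> F \<kappa>" unfolding \<kappa>(2) using finF refl_chart[OF \<kappa>(1) j] by (intro Max_ge) auto
    ultimately show False by simp
  qed
  then show ?thesis using that \<kappa>(1) by blast
qed

section \<open>Levi subsystems and T-roots in a chart\<close>

definition levi :: "('a \<Rightarrow> real^8) \<Rightarrow> bool list \<Rightarrow> 'a set" where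
  "levi \<kappa> m = {\<alpha> \<in> R. \<kappa> \<alpha> \<in> masked m}"

text \<open>The simple coefficients of a root have one sign, so the terms of
  \<open>l \<alpha>\<close> cannot cancel: it vanishes if and only if the root has coefficient zero
  at every node where \<open>l\<close> is positive.\<close>

lemma kernel_levi:
  assumes \<kappa>: "\<kappa> \<in> charts" and l: "linear (l :: 'a \<Rightarrow> real)" and nn: "\<And>i. i < n \<Longrightarrow> 0 \<le> l (simple_root \<kappa> i)"
  shows "{\<alpha> \<in> R. l \<alpha> = 0} = levi \<kappa> (map (\<lambda>i. l (simple_root \<kappa> i) \<noteq> 0) [0..<n])"
proof -
  have "l \<alpha> = 0 \<longleftrightarrow> (\<forall>i<n. l (simple_root \<kappa> i) \<noteq> 0 \<longrightarrow> \<kappa> \<alpha> $ of_nat i = 0)" if \<alpha>: "\<alpha> \<in> R" for \<alpha>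
  proof -
    have lin: "linear \<kappa>" using \<kappa> by (simp add: charts_def)
    have "\<kappa> \<alpha> \<in> cvec ` set (coeffs L)" using \<kappa> \<alpha> by (auto simp: charts_def)
    then obtain c s where c: "c \<in> set (pos_coeffs L)" "s \<in> {1, -1::real}" "\<kappa> \<alpha> = s *\<^sub>R cvec c"
      by (force simp: set_coeffs cvec_uminus)
    have len: "length c = n" using c pos_coeffs_props(1)[OF ok] by blast
    have cp: "c ! i \<ge> 0" if "i < n" for i using c that len pos_coeffs_props(2)[OF ok] by simp
    have co: "\<kappa> \<alpha> $ of_nat i = s * of_int (c ! i)" if "i < n" for i
      using that len n_le c(3) by (simp add: cvec_nth)
    have "l \<alpha> = (\<Sum>i<n. \<kappa> \<alpha> $ of_nat i * l (simple_root \<kappa> i))"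
      by (subst chart_expand[OF \<kappa> span_base[OF \<alpha>]]) (simp add: linear_sum[OF l] linear_scale[OF l])
    also have "\<dots> = s * (\<Sum>i<n. of_int (c ! i) * l (simple_root \<kappa> i))"
      using co by (simp add: sum_distrib_left mult.assoc)
    finally have "l \<alpha> = 0 \<longleftrightarrow> (\<Sum>i<n. of_int (c ! i) * l (simple_root \<kappa> i)) = 0" using c(2) by auto
    also have "\<dots> \<longleftrightarrow> (\<forall>i\<in>{..<n}. of_int (c ! i) * l (simple_root \<kappa> i) = 0)"
      by (rule sum_nonneg_eq_0_iff) (use cp nn in auto)
    also have "\<dots> \<longleftrightarrow> (\<forall>i<n. l (simple_root \<kappa> i) \<noteq> 0 \<longrightarrow> \<kappa> \<alpha> $ of_nat i = 0)" using co c(2) by auto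
    finally show ?thesis .
  qed
  then show ?thesis by (auto simp: levi_def masked_def)
qed

text \<open>Vectors with vanishing marked coordinates are combinations of unmarked simple roots. So
  the real span of the Levi roots contains no further roots, and no root outside the Levi subsystem
  projects to zero.\<close>

lemma span_levi: assumes \<kappa>: "\<kappa> \<in> charts" and m: "length m = n"
  shows "span (levi \<kappa> m) = {x \<in> span R. \<kappa> x \<in> masked m}"
proof
  have lin: "linear \<kappa>" using \<kappa> by (simp add: charts_def)
  have "subspace {x \<in> span R. \<kappa> x \<in> masked m}"
    using subspace_masked[of m] lin unfolding subspace_def
    by (auto simp: span_zero span_add span_scale linear_0 linear_add linear_scale)
  then show "span (levi \<kappa> m) \<subseteq> {x \<in> span R. \<kappa> x \<in> masked m}"
    by (intro span_minimal) (auto simp: levi_def span_base)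
  show "{x \<in> span R. \<kappa> x \<in> masked m} \<subseteq> span (levi \<kappa> m)"
  proof safe
    fix x assume x: "x \<in> span R" "\<kappa> x \<in> masked m"
    have "(\<Sum>i<n. (\<kappa> x $ of_nat i) *\<^sub>R simple_root \<kappa> i) \<in> span (levi \<kappa> m)"
    proof (rule span_sum)
      fix i assume "i \<in> {..<n}"
      then have i: "i < n" by simp
      show "(\<kappa> x $ of_nat i) *\<^sub>R simple_root \<kappa> i \<in> span (levi \<kappa> m)"
      proof (cases "m ! i")
        case True
        then have "\<kappa> x $ of_nat i = 0" using x i m by (simp add: masked_def)
        then show ?thesis by (simp add: span_zero)
      next
        case False
        then have "simple_root \<kappa> i \<in> levi \<kappa> m"
          using simple_root[OF \<kappa> i] i m n_le by (auto simp: levi_def masked_def \<epsilon>_nth)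
        then show ?thesis by (simp add: span_base span_scale)
      qed
    qed
    then show "x \<in> span (levi \<kappa> m)" using chart_expand[OF \<kappa> x(1)] by simp
  qed
qed

lemma levi_image: assumes \<kappa>: "\<kappa> \<in> charts" and m: "length m = n"
  shows "\<kappa> ` levi \<kappa> m = cvec ` set (levi_list L m)"
proof -
  have "\<kappa> ` levi \<kappa> m = \<kappa> ` R \<inter> masked m" by (auto simp: levi_def)
  also have "\<dots> = (cvec ` set (coeffs L)) \<inter> masked m"
    using \<kappa> by (simp add: charts_def)
  also have "\<dots> = cvec ` set (levi_list L m)"
    using cvec_masked[of _ m] coeffs_length[OF ok] m n_le by (auto simp: set_levi_list)
  finally show ?thesis .
qed

lemma levi_isomorphic: assumes \<kappa>: "\<kappa> \<in> charts" and m: "length m = n"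
  shows "linearly_isomorphic (levi \<kappa> m) (cvec ` set (levi_list L m))"
proof -
  have sub: "levi \<kappa> m \<subseteq> R" by (auto simp: levi_def)
  have inj: "inj_on \<kappa> (span R)" and lin: "linear \<kappa>" using \<kappa> by (auto simp: charts_def)
  show ?thesis unfolding linearly_isomorphic_def
    using lin inj_on_subset[OF inj span_mono[OF sub]] levi_image[OF assms] by (intro exI[of _ \<kappa>] conjI)
qed

lemma node_proj_image: assumes \<kappa>: "\<kappa> \<in> charts" and m: "length m = n"
  shows "(node_proj m \<circ> \<kappa>) ` (R - levi \<kappa> m) = cvec ` set (T_root_list L m)"
proof -
  have "\<kappa> ` (R - levi \<kappa> m) = \<kappa> ` R - masked m" by (auto simp: levi_def)
  also have "\<dots> = cvec ` set (coeffs L) - masked m"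
    using \<kappa> by (simp add: charts_def)
  also have "\<dots> = cvec ` {c \<in> set (coeffs L). \<not> zero_on m c}"
    using cvec_masked[of _ m] coeffs_length[OF ok] m n_le by auto
  finally have "(node_proj m \<circ> \<kappa>) ` (R - levi \<kappa> m) = node_proj m ` cvec ` {c \<in> set (coeffs L). \<not> zero_on m c}"
    by (simp only: image_comp[symmetric])
  also have "\<dots> = cvec ` sel m ` {c \<in> set (coeffs L). \<not> zero_on m c}"
    unfolding image_image using coeffs_length[OF ok] m n_le by (intro image_cong) (auto simp: node_proj_cvec)
  finally show ?thesis by (simp add: set_T_root_list)
qed

lemma proj_kernel: assumes \<kappa>: "\<kappa> \<in> charts" and m: "length m = n" and x: "x \<in> span R"
  shows "(node_proj m \<circ> \<kappa>) x = 0 \<longleftrightarrow> x \<in> span (levi \<kappa> m)"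
  using span_levi[OF \<kappa> m] x node_proj_eq_0[of m] m n_le by auto

text \<open>The restriction of a marked simple root is a standard basis vector, and all
  \<open>nodes m\<close> of them arise in this way.\<close>

lemma dim_T_roots: assumes m: "length m = n"
  shows "dim (cvec ` set (T_root_list L m)) = nodes m"
proof -
  have len: "length x = nodes m" if "x \<in> set (T_root_list L m)" for x
    using that coeffs_length[OF ok] m by (auto simp: set_T_root_list length_sel)
  have nm: "nodes m \<le> 8" using nodes_le[of m] m n_le by simp
  have "dim (cvec ` set (T_root_list L m)) = card {..<nodes m}"
  proof (rule dim_coordinate_set)
    show "{..<nodes m} \<subseteq> {..<8}" using nm by auto
    show "\<epsilon> ` {..<nodes m} \<subseteq> cvec ` set (T_root_list L m)"
    proof safe
      fix j assume j: "j < nodes m"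
      let ?i = "sel m [0..<length m] ! j"
      have i: "?i < n" "m ! ?i" using sel_upt_nth[OF j] m by auto
      let ?c = "unit_list n ?i"
      have lc: "length ?c = n" by (simp add: unit_list_def)
      have sl: "sel m ?c = map ((!) ?c) (sel m [0..<n])" using sel_nth[of m ?c] lc m by simp
      have ls: "length (sel m [0..<n]) = nodes m" using length_sel[of m "[0..<n]"] m by simp
      have "sel m ?c = unit_list (nodes m) j"
      proof (rule nth_equalityI)
        show "length (sel m ?c) = length (unit_list (nodes m) j)" using sl ls by (simp add: unit_list_def)
        fix k assume "k < length (sel m ?c)"
        then have k: "k < nodes m" using sl ls by simp
        have "sel m [0..<n] ! k = ?i \<longleftrightarrow> k = j"
          using distinct_sel[of m "[0..<n]"] m ls j k by (auto simp: nth_eq_iff_index_eq)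
        then show "sel m ?c ! k = unit_list (nodes m) j ! k"
          using sl ls k i sel_upt_nth[OF k] m by (auto simp: unit_list_def nth_list_update)
      qed
      moreover have "\<not> zero_on m ?c"
      proof -
        have "sel m ?c ! j = 1" using calculation j by (simp add: unit_list_def)
        then have "1 \<in> set (sel m ?c)" using j sl ls by (metis length_map nth_mem)
        then show ?thesis unfolding zero_on_def list_all_iff by (metis zero_neq_one)
      qed
      moreover have "?c \<in> set (coeffs L)" using ok_props(3)[OF i(1)] by (simp add: set_coeffs)
      ultimately have "unit_list (nodes m) j \<in> set (T_root_list L m)"
        unfolding set_T_root_list by (intro image_eqI[of _ _ ?c]) auto
      then show "\<epsilon> j \<in> cvec ` set (T_root_list L m)" using cvec_unit[OF j nm] by (metis imageI)
    qed
    fix v k assume "v \<in> cvec ` set (T_root_list L m)" "k < 8" "k \<notin> {..<nodes m}"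
    then show "v $ of_nat k = 0" using len by (auto simp: cvec_nth)
  qed
  then show ?thesis by simp
qed

lemma dim_levi: assumes \<kappa>: "\<kappa> \<in> charts" and m: "length m = n"
  shows "dim (levi \<kappa> m) + nodes m = dim R"
proof -
  have le: "n \<le> 8" by (rule n_le)
  let ?I = "{i. i < n \<and> \<not> m ! i}"
  have "linearly_isomorphic R (cvec ` set (coeffs L))"
    unfolding linearly_isomorphic_def using \<kappa> by (intro exI[of _ \<kappa>]) (simp add: charts_def)
  then have "dim R = dim (cvec ` set (coeffs L))" by (rule linearly_isomorphic_dim[symmetric])
  also have "\<dots> = card {..<n}"
    by (rule dim_coordinate_set) (use le \<epsilon>_coeffs coeffs_length[OF ok] in \<open>auto simp: cvec_nth\<close>)
  finally have 1: "dim R = n" by simp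
  have "dim (levi \<kappa> m) = dim (\<kappa> ` levi \<kappa> m)"
    using linearly_isomorphic_dim[OF levi_isomorphic[OF assms]] levi_image[OF assms] by simp
  also have "\<dots> = card ?I"
  proof (rule dim_coordinate_set)
    show "?I \<subseteq> {..<8}" using le by auto
    show "\<epsilon> ` ?I \<subseteq> \<kappa> ` levi \<kappa> m"
    proof safe
      fix i assume i: "i < n" "\<not> m ! i"
      then have "simple_root \<kappa> i \<in> levi \<kappa> m"
        using simple_root[OF \<kappa> i(1)] m le by (auto simp: levi_def masked_def \<epsilon>_nth)
      then show "\<epsilon> i \<in> \<kappa> ` levi \<kappa> m" using simple_root[OF \<kappa> i(1)] by (metis imageI)
    qed
    fix v j assume v: "v \<in> \<kappa> ` levi \<kappa> m" "j < 8" "j \<notin> ?I"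
    then obtain \<alpha> where a: "\<alpha> \<in> R" "v = \<kappa> \<alpha>" "\<kappa> \<alpha> \<in> masked m" by (auto simp: levi_def)
    show "v $ of_nat j = 0"
    proof (cases "j < n")
      case True then show ?thesis using v a m by (auto simp: masked_def)
    next
      case False then show ?thesis using chart_support[OF \<kappa> span_base[OF a(1)]] v(2) a(2) by simp
    qed
  qed
  finally have 2: "dim (levi \<kappa> m) = card ?I" .
  have "nodes m = card {i. i < n \<and> m ! i}"
    unfolding nodes_def length_filter_conv_card using m by simp
  moreover have "card ?I + card {i. i < n \<and> m ! i} = card {..<n}"
  proof -
    have U: "?I \<union> {i. i < n \<and> m ! i} = {..<n}" by auto
    have "card (?I \<union> {i. i < n \<and> m ! i}) = card ?I + card {i. i < n \<and> m ! i}"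
      by (rule card_Un_disjoint) auto
    then show ?thesis unfolding U by (rule sym)
  qed
  ultimately show ?thesis using 1 2 by simp
qed

end

section \<open>Flag manifolds of an exceptional algebra\<close>

lemma group_closure_subset_span: "group_closure S \<subseteq> span (S :: 'a::real_vector set)"
proof
  fix x assume "x \<in> group_closure S"
  then show "x \<in> span S" by induction (auto intro: span_base span_zero span_diff)
qed

lemma subset_group_closure: "S \<subseteq> group_closure S"
  by (auto intro: group_closure.base)

lemma span_group_closure: "span (group_closure S) = span (S :: 'a::real_vector set)"
  using group_closure_subset_span subset_group_closure span_mono span_minimal subspace_span
  by (metis subset_antisym)

locale exceptional_algebra = compact_algebra_with_torus br g t + charted_roots L "lie_roots br t g"
  for br :: "'a::euclidean_space \<Rightarrow> 'a \<Rightarrow> 'a" and g t L +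
  assumes type_L: "has_type (lie_roots br t g) [L]"
begin

lemma roots_isomorphic: "linearly_isomorphic R (cvec ` set (coeffs L))"
proof -
  have "linearly_isomorphic R (std_roots L)" using type_L by auto
  then show ?thesis using std_roots_coeffs[OF L] linearly_isomorphic_trans by blast
qed

lemma chart_exists: "\<exists>\<kappa>. \<kappa> \<in> charts"
  using roots_isomorphic by (auto simp: linearly_isomorphic_def charts_def)

lemma finite_roots: "finite R"
proof -
  obtain f :: "'a \<Rightarrow> real^8" where "f ` R = cvec ` set (coeffs L)" "inj_on f R"
    using roots_isomorphic linearly_isomorphic_inj_on by metis
  then show ?thesis by (metis List.finite_set finite_imageI finite_imageD)
qed

lemma perp_roots_levi: assumes s: "subspace s" "s \<subseteq> t"
  obtains \<kappa> m where "\<kappa> \<in> charts" "length m = n" "{\<alpha> \<in> R. \<forall>y\<in>s. \<alpha> \<bullet> y = 0} = levi \<kappa> m"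
proof -
  obtain y where y: "y \<in> s" "\<And>\<alpha>. \<alpha> \<in> R \<Longrightarrow> \<alpha> \<bullet> y = 0 \<Longrightarrow> \<forall>x\<in>s. \<alpha> \<bullet> x = 0"
    using inner_generic_vector[OF finite_roots s(1)] by blast
  let ?l = "\<lambda>x. x \<bullet> y"
  have l: "linear ?l" by (rule linearI) (simp_all add: inner_add_left)
  obtain \<kappa>\<^sub>0 where "\<kappa>\<^sub>0 \<in> charts" using chart_exists by blast
  then obtain \<kappa> where \<kappa>: "\<kappa> \<in> charts" "\<And>i. i < n \<Longrightarrow> 0 \<le> ?l (simple_root \<kappa> i)"
    using dominant_chart[OF _ finite_roots l] by blast
  let ?m = "map (\<lambda>i. ?l (simple_root \<kappa> i) \<noteq> 0) [0..<n]"
  have "{\<alpha> \<in> R. \<forall>y\<in>s. \<alpha> \<bullet> y = 0} = {\<alpha> \<in> R. ?l \<alpha> = 0}" using y by blast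
  also have "\<dots> = levi \<kappa> ?m" by (rule kernel_levi[OF \<kappa>(1) l \<kappa>(2)])
  finally show ?thesis using that[of \<kappa> ?m] \<kappa>(1) by simp
qed

text \<open>Every mask occurs: \<open>s\<close> is the complement of the Levi roots in
  \<open>t\<close>. If a root is orthogonal to \<open>s\<close>, its component orthogonal to the
  Levi roots lies in \<open>s\<close> and is orthogonal to itself, so the root lies in their span
  and is a Levi root by \<open>span_levi\<close>.\<close>

lemma levi_perp_roots: assumes \<kappa>: "\<kappa> \<in> charts" and m: "length m = n"
  obtains s where "subspace s" "s \<subseteq> t" "{\<alpha> \<in> R. \<forall>y\<in>s. \<alpha> \<bullet> y = 0} = levi \<kappa> m"
proof -
  define s where "s = {y \<in> t. \<forall>\<alpha>\<in>levi \<kappa> m. \<alpha> \<bullet> y = 0}"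
  have "subspace s" using subspace_t unfolding subspace_def s_def by (auto simp: inner_add_right)
  moreover have "{\<alpha> \<in> R. \<forall>y\<in>s. \<alpha> \<bullet> y = 0} = levi \<kappa> m"
  proof (intro equalityI subsetI)
    fix \<alpha> assume "\<alpha> \<in> levi \<kappa> m"
    then show "\<alpha> \<in> {\<alpha> \<in> R. \<forall>y\<in>s. \<alpha> \<bullet> y = 0}" by (auto simp: s_def levi_def)
  next
    fix \<alpha> assume "\<alpha> \<in> {\<alpha> \<in> R. \<forall>y\<in>s. \<alpha> \<bullet> y = 0}"
    then have \<alpha>: "\<alpha> \<in> R" "\<And>y. y \<in> s \<Longrightarrow> \<alpha> \<bullet> y = 0" by auto
    obtain a b where ab: "a \<in> span (levi \<kappa> m)" "\<And>w. w \<in> span (levi \<kappa> m) \<Longrightarrow> orthogonal b w" "\<alpha> = a + b"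
      using orthogonal_subspace_decomp_exists[of "levi \<kappa> m" \<alpha>] by metis
    have "levi \<kappa> m \<subseteq> t" using roots_subset_t by (auto simp: levi_def)
    then have "a \<in> t" using ab(1) subspace_t by (meson span_minimal subsetD)
    moreover have "\<alpha> \<in> t" using \<alpha>(1) roots_subset_t by blast
    moreover have "b = \<alpha> - a" using ab(3) by simp
    ultimately have "b \<in> t" using subspace_t by (simp add: subspace_diff)
    then have "b \<in> s" using ab(2) by (auto simp: s_def orthogonal_def span_base inner_commute)
    then have "(a + b) \<bullet> b = 0" using \<alpha>(2) ab(3) by blast
    moreover have "a \<bullet> b = 0" using ab(1,2) by (simp add: orthogonal_def inner_commute)
    ultimately have "b = 0" by (simp add: inner_add_left)
    then have "\<alpha> \<in> span (levi \<kappa> m)" using ab by simp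
    then show "\<alpha> \<in> levi \<kappa> m" using span_levi[OF \<kappa> m] \<alpha>(1) by (auto simp: levi_def)
  qed
  ultimately show ?thesis using that by (auto simp: s_def)
qed

text \<open>The interface to the finite checks: once this holds, the dimension of the center of
  \<open>h\<close> and its T-roots are read off from the mask, and its type from the Levi
  roots.\<close>

definition modelled :: "'a set \<Rightarrow> ('a \<Rightarrow> real^8) \<Rightarrow> bool list \<Rightarrow> bool" where
  "modelled h \<kappa> m \<longleftrightarrow> flag_isotropy br g t h \<and> \<kappa> \<in> charts \<and> length m = n \<and>
     lie_roots br t (derived_algebra br h) = levi \<kappa> m"

lemma flag_isotropy_iff: "flag_isotropy br g t h \<longleftrightarrow> (\<exists>s. subspace s \<and> s \<subseteq> t \<and> h = centr s)"
  by (simp add: flag_isotropy_def centr_def)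

lemma flag_modelled: assumes "flag_isotropy br g t h" shows "\<exists>\<kappa> m. modelled h \<kappa> m"
proof -
  obtain s where s: "subspace s" "s \<subseteq> t" "h = centr s" using assms flag_isotropy_iff by blast
  obtain \<kappa> m where "\<kappa> \<in> charts" "length m = n" "{\<alpha> \<in> R. \<forall>y\<in>s. \<alpha> \<bullet> y = 0} = levi \<kappa> m"
    using perp_roots_levi[OF s(1,2)] by blast
  then show ?thesis using roots_derived_centr[OF s(2)] assms s(3) unfolding modelled_def by auto
qed

lemma modelled_exists: assumes "length m = n" shows "\<exists>h \<kappa>. modelled h \<kappa> m"
proof -
  obtain \<kappa> where \<kappa>: "\<kappa> \<in> charts" using chart_exists by blast
  obtain s where s: "subspace s" "s \<subseteq> t" "{\<alpha> \<in> R. \<forall>y\<in>s. \<alpha> \<bullet> y = 0} = levi \<kappa> m"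
    using levi_perp_roots[OF \<kappa> assms] by blast
  have "modelled (centr s) \<kappa> m"
    using roots_derived_centr[OF s(2)] s \<kappa> assms flag_isotropy_iff unfolding modelled_def by auto
  then show ?thesis by blast
qed

text \<open>The center is the orthogonal complement of the Levi roots in \<open>t\<close>, and
  \<open>t\<close> is spanned by the roots, so its dimension is the number of simple roots outside
  the Levi subsystem.\<close>

lemma center_dim: assumes "modelled h \<kappa> m" shows "dim (center_algebra br h) = nodes m"
proof -
  obtain s where s: "subspace s" "s \<subseteq> t" "h = centr s"
    using assms flag_isotropy_iff unfolding modelled_def by blast
  have lv: "{\<alpha> \<in> R. \<forall>y\<in>s. \<alpha> \<bullet> y = 0} = levi \<kappa> m"
    using assms roots_derived_centr[OF s(2)] s(3) unfolding modelled_def by simp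
  have "center_algebra br h = {z \<in> t. \<forall>\<alpha>\<in>levi \<kappa> m. \<alpha> \<bullet> z = 0}"
    unfolding s(3) center_centr[OF s(2)] lv[symmetric] by blast
  also have "\<dots> = {z \<in> t. \<forall>x\<in>span (levi \<kappa> m). orthogonal x z}"
  proof -
    have "\<forall>x\<in>span (levi \<kappa> m). orthogonal x z" if "\<forall>\<alpha>\<in>levi \<kappa> m. \<alpha> \<bullet> z = 0" for z
    proof
      fix x assume "x \<in> span (levi \<kappa> m)"
      then show "orthogonal x z"
        by (induction rule: span_induct) (use that in \<open>auto simp: orthogonal_def subspace_def inner_add_left\<close>)
    qed
    then show ?thesis by (auto simp: orthogonal_def span_base)
  qed
  finally have eq: "center_algebra br h = {z \<in> t. \<forall>x\<in>span (levi \<kappa> m). orthogonal x z}" .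
  have sub: "span (levi \<kappa> m) \<subseteq> t"
    using roots_subset_t subspace_t by (intro span_minimal) (auto simp: levi_def)
  have "dim (center_algebra br h) + dim (levi \<kappa> m) = dim t"
    using dim_subspace_orthogonal_to_vectors[OF subspace_span subspace_t sub] by (simp add: eq)
  moreover have "dim t = dim R" using span_roots by (metis dim_span)
  ultimately show ?thesis using dim_levi[of \<kappa> m] assms by (simp add: modelled_def)
qed

lemma T_root_system_iff: assumes "modelled h \<kappa> m"
  shows "T_root_system br g t h \<Omega> \<longleftrightarrow> linearly_isomorphic (cvec ` set (T_root_list L m)) \<Omega>"
proof -
  let ?Q = "lie_roots br t (derived_algebra br h)"
  have lv: "?Q = levi \<kappa> m" and \<kappa>: "\<kappa> \<in> charts" and m: "length m = n" using assms by (auto simp: modelled_def)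
  let ?q = "node_proj m \<circ> \<kappa>"
  have q: "linear ?q" using \<kappa> linear_node_proj by (auto simp: charts_def linear_compose)
  \<comment> \<open>The lattice of the Levi roots lies in their real span, which contains no other
    root.\<close>
  have mem: "\<alpha> \<in> group_closure ?Q \<longleftrightarrow> \<alpha> \<in> levi \<kappa> m" if "\<alpha> \<in> R" for \<alpha>
  proof
    assume "\<alpha> \<in> group_closure ?Q"
    then have "\<alpha> \<in> span (levi \<kappa> m)" using group_closure_subset_span[of ?Q] unfolding lv by blast
    then show "\<alpha> \<in> levi \<kappa> m" using span_levi[OF \<kappa> m] that by (auto simp: levi_def)
  qed (use subset_group_closure lv in blast)
  have X: "{\<alpha> \<in> R. \<alpha> \<notin> group_closure ?Q} = R - levi \<kappa> m" using mem by blast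
  have img: "?q ` (R - levi \<kappa> m) = cvec ` set (T_root_list L m)" by (rule node_proj_image[OF \<kappa> m])
  have eq: "T_root_system br g t h \<Omega> \<longleftrightarrow> (\<exists>p. linear p \<and> (\<forall>x\<in>span R. p x = 0 \<longleftrightarrow> x \<in> span (levi \<kappa> m)) \<and>
      \<Omega> = p ` (R - levi \<kappa> m))"
    unfolding T_root_system_def Let_def span_group_closure X unfolding lv ..
  show ?thesis
  proof
    assume "T_root_system br g t h \<Omega>"
    then obtain p where p: "linear p" "\<And>x. x \<in> span R \<Longrightarrow> p x = 0 \<longleftrightarrow> x \<in> span (levi \<kappa> m)"
      "\<Omega> = p ` (R - levi \<kappa> m)" using eq by blast
    have "linearly_isomorphic (?q ` (R - levi \<kappa> m)) (p ` (R - levi \<kappa> m))"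
    proof (rule same_kernel_isomorphic[OF q p(1)])
      show "R - levi \<kappa> m \<subseteq> span R" using span_superset by blast
      show "?q x = 0 \<longleftrightarrow> p x = 0" if "x \<in> span R" for x using proj_kernel[OF \<kappa> m that] p(2)[OF that] by blast
    qed
    then show "linearly_isomorphic (cvec ` set (T_root_list L m)) \<Omega>" using img p(3) by simp
  next
    assume "linearly_isomorphic (cvec ` set (T_root_list L m)) \<Omega>"
    then obtain f where f: "linear f" "inj_on f (span (cvec ` set (T_root_list L m)))"
      "f ` cvec ` set (T_root_list L m) = \<Omega>" unfolding linearly_isomorphic_def by blast
    \<comment> \<open>The isomorphism \<open>f\<close> is injective on the span of the T-roots only,
      so the projection of the whole span of the roots has to stay inside it.\<close>
    have sp: "?q x \<in> span (cvec ` set (T_root_list L m))" if "x \<in> span R" for x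
      using that
    proof (induction rule: span_induct)
      case base
      show ?case using subspace_span[of "cvec ` set (T_root_list L m)"] q
        by (auto simp: subspace_def linear_0[OF q, simplified] linear_add[OF q, simplified] linear_scale[OF q, simplified])
    next
      case (step x)
      show ?case
      proof (cases "x \<in> levi \<kappa> m")
        case True
        then have "?q x = 0" using proj_kernel[OF \<kappa> m span_base[OF step]] span_base by blast
        then show ?thesis by (simp add: span_zero)
      next
        case False
        then have "?q x \<in> ?q ` (R - levi \<kappa> m)" using step by blast
        then show ?thesis using img span_base by metis
      qed
    qed
    have "linear (f \<circ> ?q)" using f q linear_compose by blast
    moreover have "(f \<circ> ?q) x = 0 \<longleftrightarrow> x \<in> span (levi \<kappa> m)" if "x \<in> span R" for x
    proof -
      have "(f \<circ> ?q) x = 0 \<longleftrightarrow> f (?q x) = f 0" using f(1) by (simp add: linear_0)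
      also have "\<dots> \<longleftrightarrow> ?q x = 0" using inj_on_eq_iff[OF f(2) sp[OF that] span_zero] by blast
      finally show ?thesis using proj_kernel[OF \<kappa> m that] by blast
    qed
    moreover have "\<Omega> = (f \<circ> ?q) ` (R - levi \<kappa> m)" using f(3) img by (metis image_comp)
    ultimately show "T_root_system br g t h \<Omega>" using eq by blast
  qed
qed

section \<open>Components of the Levi subsystem\<close>

lemma levi_mem: assumes \<kappa>: "\<kappa> \<in> charts" and m: "length m = n"
  shows "\<alpha> \<in> levi \<kappa> m \<longleftrightarrow> \<alpha> \<in> R \<and> \<kappa> \<alpha> \<in> cvec ` set (levi_list L m)"
proof -
  have "inj_on \<kappa> R" using \<kappa> inj_on_subset[OF _ span_superset] by (auto simp: charts_def)
  then have "\<alpha> \<in> R \<and> \<kappa> \<alpha> \<in> \<kappa> ` levi \<kappa> m \<longleftrightarrow> \<alpha> \<in> levi \<kappa> m"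
    by (auto simp: levi_def dest: inj_onD)
  then show ?thesis unfolding levi_image[OF assms] by blast
qed

lemma simple_roots_orthogonal:
  assumes \<kappa>: "\<kappa> \<in> charts" and ij: "i < n" "j < n" "i \<noteq> j"
    and n: "map2 (+) (unit_list n i) (unit_list n j) \<notin> set (coeffs L)"
      "map2 (-) (unit_list n i) (unit_list n j) \<notin> set (coeffs L)"
  shows "simple_root \<kappa> i \<bullet> simple_root \<kappa> j = 0"
proof (rule nonadjacent_roots_orthogonal)
  let ?u = "simple_root \<kappa> i" and ?v = "simple_root \<kappa> j"
  show u: "?u \<in> R" and v: "?v \<in> R" using simple_root[OF \<kappa>] ij by auto
  have lin: "linear \<kappa>" using \<kappa> by (simp add: charts_def)
  have len: "length (unit_list n k) = n" for k by (simp add: unit_list_def)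
  have cu: "cvec (unit_list n i) = \<epsilon> i" "cvec (unit_list n j) = \<epsilon> j" using cvec_unit ij n_le by auto
  have s: "\<kappa> (?u + ?v) = cvec (map2 (+) (unit_list n i) (unit_list n j))"
    using simple_root[OF \<kappa>] ij by (simp add: linear_add[OF lin] cvec_add len cu)
  have d: "\<kappa> (?u - ?v) = cvec (map2 (-) (unit_list n i) (unit_list n j))"
    using simple_root[OF \<kappa>] ij by (simp add: linear_diff[OF lin] cvec_diff len cu)
  have no: "x \<notin> R" if x: "\<kappa> x = cvec c" "c \<notin> set (coeffs L)" "length c = n" for x c
  proof
    assume "x \<in> R"
    then have "\<kappa> x \<in> cvec ` set (coeffs L)" using \<kappa> by (auto simp: charts_def)
    then obtain c' where "c' \<in> set (coeffs L)" "cvec c = cvec c'" using x(1) by auto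
    then show False using cvec_inj[of c c'] x coeffs_length[OF ok] n_le by auto
  qed
  show "?u + ?v \<notin> R" using no[OF s n(1)] len by simp
  show "?u - ?v \<notin> R" using no[OF d n(2)] len by simp
  have "\<kappa> (?u + ?v) $ of_nat i = 1" "\<kappa> (?u - ?v) $ of_nat i = 1"
    using simple_root[OF \<kappa>] ij n_le by (simp_all add: linear_add[OF lin] linear_diff[OF lin] \<epsilon>_nth)
  then show "?u + ?v \<noteq> 0" "?u - ?v \<noteq> 0" using lin by (auto simp: linear_0)
qed

text \<open>Both roots are expanded in simple roots. A term can survive only if its nodes lie in
  \<open>I\<close> and \<open>J\<close>, and there nonadjacency makes the simple roots
  orthogonal.\<close>

lemma orthogonal_masks:
  assumes \<kappa>: "\<kappa> \<in> charts" and len: "length I = n" "length J = n" and o: "orth_masks L I J"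
    and a: "\<alpha> \<in> levi \<kappa> (map Not I)" and b: "\<beta> \<in> levi \<kappa> (map Not J)"
  shows "\<alpha> \<bullet> \<beta> = 0"
proof -
  have R: "\<alpha> \<in> span R" "\<beta> \<in> span R" using a b by (auto simp: levi_def span_base)
  have "\<alpha> \<bullet> \<beta> = (\<Sum>i<n. \<kappa> \<alpha> $ of_nat i *\<^sub>R simple_root \<kappa> i) \<bullet> (\<Sum>j<n. \<kappa> \<beta> $ of_nat j *\<^sub>R simple_root \<kappa> j)"
    using chart_expand[OF \<kappa> R(1)] chart_expand[OF \<kappa> R(2)] by simp
  also have "\<dots> = (\<Sum>i<n. \<Sum>j<n. \<kappa> \<alpha> $ of_nat i * (\<kappa> \<beta> $ of_nat j * (simple_root \<kappa> i \<bullet> simple_root \<kappa> j)))"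
    unfolding inner_sum_left by (simp add: inner_sum_right sum_distrib_left mult.left_commute)
  also have "\<dots> = 0"
  proof (intro sum.neutral ballI)
    fix i j assume ij: "i \<in> {..<n}" "j \<in> {..<n}"
    show "\<kappa> \<alpha> $ of_nat i * (\<kappa> \<beta> $ of_nat j * (simple_root \<kappa> i \<bullet> simple_root \<kappa> j)) = 0"
    proof (cases "I ! i \<and> J ! j")
      case True
      then have "i \<noteq> j" "map2 (+) (unit_list n i) (unit_list n j) \<notin> set (coeffs L)"
        "map2 (-) (unit_list n i) (unit_list n j) \<notin> set (coeffs L)"
        using o ij by (auto simp: orth_masks_def Let_def list_all_iff)
      then show ?thesis using simple_roots_orthogonal[OF \<kappa>] ij by simp
    next
      case False
      then have "\<kappa> \<alpha> $ of_nat i = 0 \<or> \<kappa> \<beta> $ of_nat j = 0"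
        using a b ij len by (auto simp: levi_def masked_def)
      then show ?thesis by auto
    qed
  qed
  finally show ?thesis .
qed

end

section \<open>Types and numbers of roots\<close>

definition small_types :: "simple_type list" where
  "small_types = [TA 1, TA 2, TA 3, TA 4, TA 5, TD 4]"

lemma small_std_list: assumes "T \<in> set small_types" shows "cvec ` set (std_list T) = std_roots T"
proof -
  have "T \<in> {TA 1, TA 2, TA 3, TA 4, TA 5, TD 4}" using assms by (simp add: small_types_def)
  then show ?thesis
    by (elim insertE emptyE; simp only: std_list.simps std_roots.simps; intro cvec_A_list cvec_D_list; simp)
qed

lemma small_types_ok: "list_all (\<lambda>T. distinct (std_list T) \<and> list_all (\<lambda>c. length c = 8) (std_list T)) small_types"
  by code_simp

lemma card_small_type: assumes "T \<in> set small_types" shows "card (std_roots T) = length (std_list T)"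
proof -
  have d: "distinct (std_list T)" "\<And>c. c \<in> set (std_list T) \<Longrightarrow> length c = 8"
    using small_types_ok assms by (auto simp: list_all_iff)
  then have "inj_on cvec (set (std_list T))" by (auto intro!: inj_onI cvec_inj)
  then show ?thesis using d(1) small_std_list[OF assms] by (metis card_image distinct_card)
qed

text \<open>Orthogonal sets without zero are disjoint, and linear isomorphisms preserve cardinality;
  so the type determines the number of roots.\<close>

lemma has_type_card: assumes "has_type X S" "finite X" "0 \<notin> X" "set S \<subseteq> set small_types"
  shows "card X = sum_list (map (\<lambda>T. length (std_list T)) S)"
  using assms
proof (induction S arbitrary: X)
  case (Cons T S)
  then obtain R1 R2 where R: "X = R1 \<union> R2" "\<forall>\<alpha>\<in>R1. \<forall>\<beta>\<in>R2. \<alpha> \<bullet> \<beta> = 0"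
    "linearly_isomorphic R1 (std_roots T)" "has_type R2 S" by auto
  have "R1 \<inter> R2 = {}" using R(1,2) Cons.prems(3) by (metis Int_iff Un_iff equals0I inner_eq_zero_iff)
  then have "card X = card R1 + card R2" using R(1) Cons.prems(2) by (simp add: card_Un_disjoint)
  moreover have "card R1 = length (std_list T)"
    using linearly_isomorphic_card[OF R(3)] card_small_type[of T] Cons.prems(4) by simp
  moreover have "card R2 = sum_list (map (\<lambda>T. length (std_list T)) S)"
    using Cons.IH[OF R(4)] R(1) Cons.prems by simp
  ultimately show ?case by simp
qed simp

lemma A3_sums: "a \<in> std_roots (TA 3) \<Longrightarrow> \<exists>b\<in>std_roots (TA 3). a + b \<in> std_roots (TA 3)"
proof -
  assume a: "a \<in> std_roots (TA 3)"
  have T: "TA 3 \<in> set small_types" by (simp add: small_types_def)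
  have "list_all (\<lambda>c. list_ex (\<lambda>c'. mem (map2 (+) c c') (A_list 3)) (A_list 3)) (A_list 3)" by code_simp
  then have *: "\<And>c. c \<in> set (std_list (TA 3)) \<Longrightarrow> \<exists>c'\<in>set (std_list (TA 3)). map2 (+) c c' \<in> set (std_list (TA 3))"
    by (simp add: list_all_iff list_ex_iff)
  have len: "length c = 8" if "c \<in> set (std_list (TA 3))" for c using small_types_ok T that by (auto simp: list_all_iff)
  obtain c where c: "c \<in> set (std_list (TA 3))" "a = cvec c" using a small_std_list[OF T] by blast
  obtain c' where c': "c' \<in> set (std_list (TA 3))" "map2 (+) c c' \<in> set (std_list (TA 3))" using *[OF c(1)] by blast
  then have "cvec c' \<in> std_roots (TA 3)" "a + cvec c' \<in> std_roots (TA 3)"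
    using small_std_list[OF T] c cvec_add[of c c'] len by (metis imageI)+
  then show ?thesis by blast
qed

text \<open>This rules out \<open>A_4 A_1 A_1\<close> when the type is \<open>A_3 A_3\<close>: each
  root of \<open>A_3\<close> has a partner with which it adds up to a root, and unions of such
  components inherit this, but the roots of a summand \<open>A_1\<close> have no partner.\<close>

lemma type_A3_sums:
  assumes "has_type X S" "set S \<subseteq> {TA 3}" "a \<in> X" shows "\<exists>b\<in>X. a + b \<in> X"
  using assms
proof (induction S arbitrary: X)
  case (Cons T S)
  then obtain R1 R2 where R: "X = R1 \<union> R2" "linearly_isomorphic R1 (std_roots (TA 3))" "has_type R2 S" by auto
  show ?case
  proof (cases "a \<in> R1")
    case True
    obtain f where f: "linear f" "inj_on f (span R1)" "f ` R1 = std_roots (TA 3)"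
      using R(2) unfolding linearly_isomorphic_def by blast
    obtain b c where bc: "b \<in> R1" "c \<in> R1" "f a + f b = f c"
      using A3_sums[of "f a"] f(3) True by (metis (no_types, lifting) imageE imageI)
    then have "f (a + b) = f c" using f(1) by (simp add: linear_add)
    then have "a + b = c" using f(2) bc True by (meson inj_onD span_add span_base)
    then show ?thesis using bc R(1) by blast
  next
    case False
    then have "\<exists>b\<in>R2. a + b \<in> R2" using Cons.IH[OF R(3)] Cons.prems R(1) by auto
    then show ?thesis using R(1) by blast
  qed
qed simp

lemma table_class: assumes L: "L \<in> exceptional_types" and m: "m \<in> set (masks_of_class L j)"
  shows "j < 16" "nodes m = (if j < 13 then 2 else 3)"
    "linearly_isomorphic (cvec ` set (T_root_list L m)) (cvec ` set (canon ! j))"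
proof -
  obtain C where "(m, j, C) \<in> set (flag_table L)" using m by (auto simp: masks_of_class_def)
  then have "j < 16 \<and> nodes m = (if j < 13 then 2 else 3) \<and> iso_ok C (T_root_list L m) (canon ! j)"
    using table_ok[OF L] by (auto simp: table_ok_def list_all_iff)
  then show "j < 16" "nodes m = (if j < 13 then 2 else 3)"
    "linearly_isomorphic (cvec ` set (T_root_list L m)) (cvec ` set (canon ! j))"
    using iso_ok_isomorphic[of C "T_root_list L m" "canon ! j"] by blast+
qed

context exceptional_algebra
begin

lemma distinct_coeffs: "distinct (coeffs L)"
  using card_coeffs(2)[OF ok] std_coords_ok[OF L] by (auto simp: std_coords_ok_def split: prod.splits)

lemma card_levi: assumes "\<kappa> \<in> charts" "length m = n" shows "card (levi \<kappa> m) = length (levi_list L m)"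
proof -
  have d: "distinct (levi_list L m)"
    using distinct_coeffs unfolding levi_list_def coeffs_def Let_def
    by (auto simp: distinct_map inj_map_uminus)
  have "inj_on cvec (set (levi_list L m))"
    by (rule inj_onI, rule cvec_inj) (use coeffs_length[OF ok] n_le in \<open>auto simp: set_levi_list\<close>)
  then have "card (cvec ` set (levi_list L m)) = length (levi_list L m)"
    using d by (simp add: card_image distinct_card)
  then show ?thesis using linearly_isomorphic_card[OF levi_isomorphic[OF assms]] by simp
qed

lemma type_determines_class:
  assumes md: "modelled h \<kappa> m" and ty: "has_type (levi \<kappa> m) S" and nd: "nodes m = 2"
    and S: "set S \<subseteq> set small_types" and u: "type_unique j L S"
  shows "m \<in> set (masks_of_class L j)"
proof (rule ccontr)
  assume nm: "m \<notin> set (masks_of_class L j)"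
  have \<kappa>: "\<kappa> \<in> charts" and m: "length m = n" using md by (auto simp: modelled_def)
  have "m \<in> set (masks n)" unfolding masks_def product_lists_set using m by (auto simp: list_all2_conv_all_nth)
  then have un: "length (levi_list L m) \<noteq> sum_list (map (\<lambda>T. length (std_list T)) S) \<or>
      S = [TA 3, TA 3] \<and> isolated (levi_list L m)"
    using u nd nm by (auto simp: type_unique_def Let_def list_all_iff split: if_splits)
  have sub: "levi \<kappa> m \<subseteq> R" by (auto simp: levi_def)
  have "card (levi \<kappa> m) = sum_list (map (\<lambda>T. length (std_list T)) S)"
    using sub finite_roots root_nonzero finite_subset by (intro has_type_card[OF ty _ _ S]) blast+
  then have S3: "S = [TA 3, TA 3]" and "isolated (levi_list L m)" using un card_levi[OF \<kappa> m] by auto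
  then obtain c where c: "c \<in> set (levi_list L m)" "\<And>c'. c' \<in> set (levi_list L m) \<Longrightarrow> map2 (+) c c' \<notin> set (levi_list L m)"
    by (auto simp: isolated_def list_ex_iff list_all_iff)
  have lin: "linear \<kappa>" using \<kappa> by (simp add: charts_def)
  have len: "length c = n" if "c \<in> set (levi_list L m)" for c using that coeffs_length[OF ok] by (auto simp: set_levi_list)
  have "cvec c \<in> \<kappa> ` levi \<kappa> m" using levi_image[OF \<kappa> m] c by simp
  then obtain \<alpha> where \<alpha>: "\<alpha> \<in> levi \<kappa> m" "\<kappa> \<alpha> = cvec c" by auto
  obtain \<beta> where \<beta>: "\<beta> \<in> levi \<kappa> m" "\<alpha> + \<beta> \<in> levi \<kappa> m" using type_A3_sums[OF ty _ \<alpha>(1)] S3 by auto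
  obtain c' where c': "c' \<in> set (levi_list L m)" "\<kappa> \<beta> = cvec c'" using levi_mem[OF \<kappa> m] \<beta>(1) by blast
  obtain d where d: "d \<in> set (levi_list L m)" "\<kappa> (\<alpha> + \<beta>) = cvec d" using levi_mem[OF \<kappa> m] \<beta>(2) by blast
  \<comment> \<open>The sum of two roots becomes a sum of coefficient vectors in the list, contrary
    to the isolation of \<open>c\<close>.\<close>
  have "cvec (map2 (+) c c') = cvec d"
    using \<alpha>(2) c'(2) d(2) by (simp add: linear_add[OF lin] cvec_add len c(1) c'(1))
  then have "map2 (+) c c' = d" using cvec_inj[of "map2 (+) c c'" d] len c(1) c'(1) d(1) n_le by simp
  then show False using c(2) c'(1) d(1) by blast
qed

lemma comps_has_type:
  assumes \<kappa>: "\<kappa> \<in> charts" and o: "orth_ok L (map fst comps)"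
    and c: "\<And>I T C. (I, T, C) \<in> set comps \<Longrightarrow> length I = n \<and> iso_ok C (levi_list L (map Not I)) (std_list T) \<and> T \<in> set small_types"
  shows "has_type (\<Union>e\<in>set comps. levi \<kappa> (map Not (fst e))) (map (\<lambda>(_, T, _). T) comps)"
  using o c
proof (induction comps)
  case (Cons e comps)
  obtain I T C where e: "e = (I, T, C)" by (cases e) auto
  have I: "length I = n" "iso_ok C (levi_list L (map Not I)) (std_list T)" "T \<in> set small_types"
    using Cons.prems(2)[of I T C] e by auto
  let ?R1 = "levi \<kappa> (map Not I)" and ?R2 = "\<Union>e\<in>set comps. levi \<kappa> (map Not (fst e))"
  have 1: "linearly_isomorphic ?R1 (std_roots T)"
    using linearly_isomorphic_trans[OF levi_isomorphic[OF \<kappa>] iso_ok_isomorphic[OF I(2)]] I small_std_list[OF I(3)]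
    by simp
  have 2: "\<alpha> \<bullet> \<beta> = 0" if ab: "\<alpha> \<in> ?R1" "\<beta> \<in> ?R2" for \<alpha> \<beta>
  proof -
    obtain J T' C' where J: "(J, T', C') \<in> set comps" "\<beta> \<in> levi \<kappa> (map Not J)" using ab(2) by force
    have "orth_masks L I J" using Cons.prems(1) J(1) e by (force simp: list_all_iff)
    moreover have "length J = n" using Cons.prems(2)[of J T' C'] J(1) by auto
    ultimately show ?thesis using orthogonal_masks[OF \<kappa> I(1) _ _ ab(1) J(2)] by blast
  qed
  have 3: "has_type ?R2 (map (\<lambda>(_, T, _). T) comps)"
  proof (rule Cons.IH)
    show "orth_ok L (map fst comps)" using Cons.prems(1) by simp
    show "length I = n \<and> iso_ok C (levi_list L (map Not I)) (std_list T) \<and> T \<in> set small_types"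
      if "(I, T, C) \<in> set comps" for I T C using Cons.prems(2)[of I T C] that by simp
  qed
  have "has_type (?R1 \<union> ?R2) (T # map (\<lambda>(_, T, _). T) comps)"
    unfolding has_type.simps by (rule exI[of _ ?R1], rule exI[of _ ?R2], intro conjI ballI refl 1 2 3)
  then show ?case unfolding e by (simp del: has_type.simps)
qed simp

lemma comps_ok_has_type:
  assumes \<kappa>: "\<kappa> \<in> charts" and m: "length m = n" and ok': "comps_ok L m comps"
    and S: "set (map (\<lambda>(_, T, _). T) comps) \<subseteq> set small_types"
  shows "has_type (levi \<kappa> m) (map (\<lambda>(_, T, _). T) comps)"
proof -
  have c: "length I = n \<and> iso_ok C (levi_list L (map Not I)) (std_list T) \<and> T \<in> set small_types"
    if "(I, T, C) \<in> set comps" for I T C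
    using ok' that S by (force simp: comps_ok_def list_all_iff)
  have "set (levi_list L m) = (\<Union>e\<in>set comps. set (levi_list L (map Not (fst e))))"
    using ok' unfolding comps_ok_def Let_def list_all_iff case_prod_beta by auto
  moreover have "\<alpha> \<in> levi \<kappa> (map Not (fst e)) \<longleftrightarrow> \<alpha> \<in> R \<and> \<kappa> \<alpha> \<in> cvec ` set (levi_list L (map Not (fst e)))"
    if "e \<in> set comps" for e \<alpha>
    using c[of "fst e" "fst (snd e)" "snd (snd e)"] that by (intro levi_mem[OF \<kappa>]) auto
  ultimately have "levi \<kappa> m = (\<Union>e\<in>set comps. levi \<kappa> (map Not (fst e)))"
    using levi_mem[OF \<kappa> m] by (intro set_eqI) (simp, blast)
  moreover have "orth_ok L (map fst comps)" using ok' by (simp add: comps_ok_def)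
  ultimately show ?thesis using comps_has_type[OF \<kappa> _ c] by simp
qed

text \<open>Nonzero restrictions of positive roots have nonnegative entries, so none is the opposite
  of another, and eleven of them give more than twenty T-roots.\<close>

lemma card_T_roots: assumes m: "length m = n" and mn: "many m 10 [replicate (nodes m) 0] (rev (pos_coeffs L))"
  shows "card (cvec ` set (T_root_list L m)) > 20"
proof -
  \<comment> \<open>The inequality is strict because the search ends with a new restriction found at
    \<open>k = 0\<close>.\<close>
  have many: "card (set seen) + k < card (set seen \<union> sel m ` set cs)" if "many m k seen cs" for k seen cs
    using that
  proof (induction m k seen cs rule: many.induct)
    case (2 m k seen c cs)
    let ?x = "sel m c"
    show ?case
    proof (cases "?x \<in> set seen")
      case True
      then show ?thesis using 2 by (simp add: Let_def insert_absorb)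
    next
      case False
      show ?thesis
      proof (cases k)
        case 0
        have "card (insert ?x (set seen)) \<le> card (set seen \<union> sel m ` set (c # cs))" by (intro card_mono) auto
        then show ?thesis using False 0 by simp
      next
        case (Suc k')
        then show ?thesis using 2(2)[OF refl] False 2(3) by (simp add: Let_def)
      qed
    qed
  qed simp
  let ?Z = "replicate (nodes m) (0::int)" and ?X = "sel m ` {c \<in> set (pos_coeffs L). \<not> zero_on m c}"
  have len: "length (sel m c) = nodes m" if "c \<in> set (coeffs L)" for c
    using that coeffs_length[OF ok] m by (simp add: length_sel)
  have z: "sel m c = ?Z" if "c \<in> set (pos_coeffs L)" "zero_on m c" for c
    using that len[of c] by (auto simp: zero_on_def list_all_iff set_coeffs intro!: replicate_eqI)
  have "sel m ` set (pos_coeffs L) \<subseteq> insert ?Z ?X" using z by blast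
  then have "card ({?Z} \<union> sel m ` set (pos_coeffs L)) \<le> card (insert ?Z ?X)" by (intro card_mono) auto
  also have "\<dots> \<le> Suc (card ?X)" by (simp add: card_insert_le_m1 card_insert_if)
  finally have X: "card ?X > 10" using many[OF mn] by simp
  have T: "set (T_root_list L m) = ?X \<union> map uminus ` ?X"
    unfolding set_T_root_list
  proof (intro set_eqI iffI)
    have zu: "zero_on m (map uminus c) = zero_on m c" for c by (simp add: zero_on_def sel_map list_all_iff)
    fix x
    show "x \<in> ?X \<union> map uminus ` ?X" if "x \<in> sel m ` {c \<in> set (coeffs L). \<not> zero_on m c}"
      using that by (auto simp: set_coeffs zu sel_map)
    show "x \<in> sel m ` {c \<in> set (coeffs L). \<not> zero_on m c}" if "x \<in> ?X \<union> map uminus ` ?X"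
      using that by (auto simp: set_coeffs zu image_iff sel_map[symmetric] intro: bexI)
  qed
  have "?X \<inter> map uminus ` ?X = {}"
  proof (rule ccontr)
    assume "\<not> ?thesis"
    then obtain c c' where c: "c \<in> set (pos_coeffs L)" "c' \<in> set (pos_coeffs L)" "\<not> zero_on m c'"
      "sel m c = map uminus (sel m c')" by blast
    have ss: "set (sel m d) \<subseteq> set d" for d :: "int list" unfolding sel_def by (auto dest: set_zip_rightD)
    obtain x where x: "x \<in> set (sel m c')" "x \<noteq> 0" using c(3) by (auto simp: zero_on_def list_all_iff)
    then have "- x \<in> set (sel m c)" using c(4) by simp
    then have "- x \<ge> 0" using ss pos_coeffs_props(2)[OF ok c(1)] by blast
    moreover have "x \<ge> 0" using ss x(1) pos_coeffs_props(2)[OF ok c(2)] by blast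
    ultimately show False using x(2) by simp
  qed
  then have "card (set (T_root_list L m)) = 2 * card ?X"
    unfolding T by (subst card_Un_disjoint) (auto simp: card_image inj_map_uminus)
  moreover have "inj_on cvec (set (T_root_list L m))"
    by (rule inj_onI, rule cvec_inj) (use len nodes_le[of m] m n_le in \<open>auto simp: set_T_root_list\<close>)
  ultimately show ?thesis using X by (simp add: card_image)
qed

lemma small_systems_classified:
  assumes m: "length m = n" and nd: "nodes m \<ge> 2" and cd: "card (cvec ` set (T_root_list L m)) \<le> 20"
  shows "\<exists>j. m \<in> set (masks_of_class L j)"
proof -
  have "m \<in> set (masks n)" unfolding masks_def product_lists_set using m by (auto simp: list_all2_conv_all_nth)
  then have "m \<in> set (map fst (flag_table L)) \<or> many m 10 [replicate (nodes m) 0] (rev (pos_coeffs L))"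
    using table_complete[OF L] nd by (auto simp: table_complete_def Let_def list_all_iff split: if_splits)
  moreover have "\<not> many m 10 [replicate (nodes m) 0] (rev (pos_coeffs L))"
    using card_T_roots[OF m] cd by auto
  ultimately obtain j C where "(m, j, C) \<in> set (flag_table L)" by auto
  then show ?thesis by (force simp: masks_of_class_def)
qed

end

section \<open>The classification\<close>

definition canon_set :: "nat \<Rightarrow> (real^8) set" where "canon_set j = cvec ` set (canon ! j)"

definition canon_class :: "nat \<Rightarrow> (real^8) set set" where "canon_class j = T_iso `` {canon_set j}"

lemma canon_class_iff: "\<Omega> \<in> canon_class j \<longleftrightarrow> linearly_isomorphic (canon_set j) \<Omega>"
  by (simp add: canon_class_def T_iso_def)

lemma canon_props: assumes "j < 16"
  shows "distinct (canon ! j)" "length (canon ! j) \<le> 20"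
    "\<And>c. c \<in> set (canon ! j) \<Longrightarrow> length c = (if j < 13 then 2 else 8) \<and> (\<exists>x\<in>set c. x \<noteq> 0)"
  using canon_ok[OF assms] by (auto simp: canon_ok_def Let_def list_all_iff split: if_splits)

lemma cvec_canon_inj: assumes "j < 16" "length x = (if j < 13 then 2 else 8)" "c \<in> set (canon ! j)" "cvec x = cvec c"
  shows "x = c"
  using assms canon_props(3)[OF assms(1,3)] cvec_inj[of x c] by (auto split: if_splits)

lemma cvec_canon_mem: assumes "j < 16" "length x = (if j < 13 then 2 else 8)" "cvec x \<in> canon_set j"
  shows "x \<in> set (canon ! j)"
  using assms cvec_canon_inj unfolding canon_set_def by blast

lemma inj_on_canon: "j < 16 \<Longrightarrow> inj_on cvec (set (canon ! j))"
  using cvec_canon_inj canon_props(3) by (metis inj_onI)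

lemma card_canon_set: "j < 16 \<Longrightarrow> card (canon_set j) = length (canon ! j)"
  using inj_on_canon canon_props(1) by (simp add: canon_set_def card_image distinct_card)

lemma canon_set_nonzero: assumes "j < 16" "c \<in> set (canon ! j)" shows "cvec c \<noteq> 0"
proof
  assume "cvec c = 0"
  then have "cvec (replicate (length c) 0) = cvec c" by (intro vec8_eqI) (simp add: cvec_nth)
  then have "replicate (length c) 0 = c"
    using canon_props(3)[OF assms] by (intro cvec_canon_inj[OF assms(1) _ assms(2)]) auto
  then show False using canon_props(3)[OF assms] by (metis in_set_replicate)
qed

lemma card_canon_doubles: assumes j: "j < 16"
  shows "card {a \<in> canon_set j. 2 *\<^sub>R a \<in> canon_set j} = length (doubled (canon ! j))"
proof -
  have "2 *\<^sub>R cvec c \<in> canon_set j \<longleftrightarrow> map ((*) 2) c \<in> set (canon ! j)" if "c \<in> set (canon ! j)" for c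
  proof -
    have s: "2 *\<^sub>R cvec c = cvec (map ((*) 2) c)" by (simp add: cvec_scale)
    show ?thesis unfolding s
      using cvec_canon_mem[OF j, of "map ((*) 2) c"] canon_props(3)[OF j that] by (auto simp: canon_set_def)
  qed
  then have "{a \<in> canon_set j. 2 *\<^sub>R a \<in> canon_set j} = cvec ` set (doubled (canon ! j))"
    by (auto simp: canon_set_def doubled_def)
  moreover have "set (doubled (canon ! j)) \<subseteq> set (canon ! j)" by (auto simp: doubled_def)
  then have "inj_on cvec (set (doubled (canon ! j)))" using inj_on_canon[OF j] inj_on_subset by blast
  moreover have "distinct (doubled (canon ! j))" using canon_props(1)[OF j] by (simp add: doubled_def)
  ultimately show ?thesis by (simp add: card_image distinct_card)
qed

text \<open>
  If \<open>a\<close>, \<open>b\<close> and \<open>a + b\<close> are in \<open>\<Omega>\<close>, they lie in the same component; this connects all of \<open>\<Omega>\<close>.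
\<close>

lemma canon_irreducible: assumes j: "j < 16" shows "\<not> reducible_system (canon_set j)"
proof
  let ?Y = "canon ! j"
  assume "reducible_system (canon_set j)"
  then obtain V1 V2 where V: "subspace V1" "subspace V2" "V1 \<inter> V2 = {0}"
    "canon_set j = (canon_set j \<inter> V1) \<union> (canon_set j \<inter> V2)" "canon_set j \<inter> V1 \<noteq> {}" "canon_set j \<inter> V2 \<noteq> {}"
    unfolding reducible_system_def by (elim exE conjE) (rule that)
  have in12: "cvec x \<in> V1 \<or> cvec x \<in> V2" if "x \<in> set ?Y" for x
    using V(4) that unfolding canon_set_def by blast
  \<comment> \<open>Stated for both orders of the two subspaces, as the first vector may lie in
    either.\<close>
  have one: "\<forall>x\<in>set ?Y. cvec x \<in> V"
    if VV: "subspace V" "subspace V'" "V \<inter> V' = {0}" "\<And>x. x \<in> set ?Y \<Longrightarrow> cvec x \<in> V \<or> cvec x \<in> V'"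
      and hd: "cvec (hd ?Y) \<in> V" for V V'
  proof -
    have step: "\<forall>x\<in>set (grow ?Y S). x \<in> set ?Y \<and> cvec x \<in> V" if S: "\<forall>x\<in>set S. x \<in> set ?Y \<and> cvec x \<in> V" for S
    proof
      fix x assume "x \<in> set (grow ?Y S)"
      then have x: "x \<in> set ?Y" and c: "x \<in> set S \<or> map uminus x \<in> set S \<or> (\<exists>y\<in>set S. map2 (+) x y \<in> set ?Y)"
        by (auto simp: grow_def list_ex_iff split: if_splits)
      from c have "cvec x \<in> V"
      proof (elim disjE bexE)
        assume "x \<in> set S" then show ?thesis using S by blast
      next
        assume "map uminus x \<in> set S"
        then have "- cvec x \<in> V" using S cvec_uminus by metis
        then show ?thesis using subspace_neg[OF VV(1)] by force
      next
        fix y assume y: "y \<in> set S" "map2 (+) x y \<in> set ?Y"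
        then have yV: "y \<in> set ?Y" "cvec y \<in> V" using S by auto
        have s: "cvec (map2 (+) x y) = cvec x + cvec y"
          using canon_props(3)[OF j x] canon_props(3)[OF j yV(1)] by (intro cvec_add) simp
        show ?thesis
        proof (rule ccontr)
          assume n: "cvec x \<notin> V"
          then have xV': "cvec x \<in> V'" using VV(4)[OF x] by blast
          \<comment> \<open>With \<open>x\<close> outside \<open>V\<close>, the sum cannot lie in
            \<open>V\<close>, so it lies in \<open>V'\<close> together with \<open>x\<close>; then
            \<open>y\<close> is in both subspaces and hence zero.\<close>
          have "cvec x + cvec y \<notin> V" using n yV(2) subspace_diff[OF VV(1), of "cvec x + cvec y" "cvec y"] by auto
          then have "cvec x + cvec y \<in> V'" using VV(4)[OF y(2)] s by auto
          then have "cvec y \<in> V'" using subspace_diff[OF VV(2) _ xV', of "cvec x + cvec y"] by auto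
          then have "cvec y = 0" using yV(2) VV(3) by blast
          then show False using canon_set_nonzero[OF j yV(1)] by blast
        qed
      qed
      then show "x \<in> set ?Y \<and> cvec x \<in> V" using x by blast
    qed
    have ne: "?Y \<noteq> []" and gr: "\<And>y. y \<in> set ?Y \<Longrightarrow> y \<in> set (grow ?Y (grow ?Y (grow ?Y (grow ?Y [hd ?Y]))))"
      using canon_ok[OF j] by (auto simp: canon_ok_def Let_def list_all_iff)
    have "\<forall>x\<in>set [hd ?Y]. x \<in> set ?Y \<and> cvec x \<in> V" using hd ne by simp
    then have "\<forall>x\<in>set (grow ?Y (grow ?Y (grow ?Y (grow ?Y [hd ?Y])))). x \<in> set ?Y \<and> cvec x \<in> V"
      by (intro step)
    then show ?thesis using gr by blast
  qed
  have ne: "?Y \<noteq> []" using canon_ok[OF j] by (auto simp: canon_ok_def Let_def)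
  have no: False if t: "\<forall>x\<in>set ?Y. cvec x \<in> V" "V \<inter> V' = {0}" "canon_set j \<inter> V' \<noteq> {}" for V V'
  proof -
    obtain x where x: "x \<in> set ?Y" "cvec x \<in> V'" using t(3) by (auto simp: canon_set_def)
    then have "cvec x = 0" using t(1,2) by blast
    then show False using canon_set_nonzero[OF j x(1)] by blast
  qed
  consider "cvec (hd ?Y) \<in> V1" | "cvec (hd ?Y) \<in> V2" using in12[of "hd ?Y"] ne by auto
  then show False
  proof cases
    case 1
    show False by (rule no[OF one[OF V(1,2,3) in12 1] V(3,6)])
  next
    case 2
    have 3: "V2 \<inter> V1 = {0}" using V(3) by blast
    show False by (rule no[OF one[OF V(2,1) 3 _ 2] 3 V(5)]) (use in12 in blast)
  qed
qed

section \<open>Representatives and invariants of the sixteen classes\<close>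

definition rank_two_data :: "(nat \<times> simple_type \<times> simple_type list \<times> nat) list" where
  "rank_two_data =
    [(0, TE6, [TD 4], 3), (1, TE6, [TA 4], 4), (2, TE6, [TA 1, TA 3], 5), (3, TE6, [TA 1, TA 1, TA 2], 6),
     (4, TE7, [TA 1, TD 4], 6), (5, TE6, [TA 2, TA 2], 6), (6, TE7, [TA 2, TA 3], 7), (7, TE7, [TA 1, TA 2, TA 2], 8),
     (8, TE7, [TA 1, TA 1, TA 3], 8), (9, TE7, [TA 1, TA 1, TA 1, TA 2], 9), (10, TE8, [TA 1, TA 5], 9),
     (11, TE8, [TA 3, TA 3], 10), (12, TE8, [TA 2, TA 4], 10)]"

text \<open>Ties the certificates to the entries of the theorem, with \<open>d\<close> half the
  number of vectors of the model.\<close>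

lemma rank_two_certs_data:
  "map (\<lambda>(j, L, m, comps). (j, L, map (\<lambda>(_, T, _). T) comps, length (canon ! j) div 2)) rank_two_certs = rank_two_data"
  by code_simp

lemma rank_two_data_ok:
  "list_all (\<lambda>(j, L, S, d). j < 13 \<and> 2 * d = length (canon ! j) \<and> L \<in> {TE6, TE7, TE8} \<and> list_all (\<lambda>T. T \<in> set small_types) S) rank_two_data"
  by code_simp

lemma rank_two_dataD: assumes "(j, L, S, d) \<in> set rank_two_data"
  obtains m comps where "S = map (\<lambda>(_, T, _). T) comps" "m \<in> set (masks_of_class L j)" "length m = rk L" "comps_ok L m comps"
    "type_unique j L S" "set S \<subseteq> set small_types" "j < 13" "2 * d = length (canon ! j)" "L \<in> exceptional_types"
proof -
  have "(j, L, S, d) \<in> (\<lambda>(j, L, m, comps). (j, L, map (\<lambda>(_, T, _). T) comps, length (canon ! j) div 2)) ` set rank_two_certs"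
    using assms unfolding rank_two_certs_data[symmetric] by simp
  then obtain m comps where mc: "(j, L, m, comps) \<in> set rank_two_certs" "S = map (\<lambda>(_, T, _). T) comps"
    by (auto simp: case_prod_beta)
  have "m \<in> set (masks_of_class L j)" "length m = rk L" "comps_ok L m comps" "type_unique j L S"
    using rank_two_ok[OF mc(1)] mc(2) by (auto simp: rank_two_ok_def)
  moreover have "j < 13" "2 * d = length (canon ! j)" "L \<in> exceptional_types" "set S \<subseteq> set small_types"
    using rank_two_data_ok assms by (auto simp: list_all_iff exceptional_types_def)
  ultimately show ?thesis using that mc(2) by blast
qed

lemma rank_three_masks:
  "\<exists>m\<in>set (masks_of_class TE7 13). length m = rk TE7"
  "\<exists>m\<in>set (masks_of_class TE6 14). length m = rk TE6"
  "\<exists>m\<in>set (masks_of_class TE6 15). length m = rk TE6"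
proof -
  have "list_ex (\<lambda>m. length m = rk TE7) (masks_of_class TE7 13)" "list_ex (\<lambda>m. length m = rk TE6) (masks_of_class TE6 14)"
    "list_ex (\<lambda>m. length m = rk TE6) (masks_of_class TE6 15)" by code_simp+
  then show "\<exists>m\<in>set (masks_of_class TE7 13). length m = rk TE7"
    "\<exists>m\<in>set (masks_of_class TE6 14). length m = rk TE6"
    "\<exists>m\<in>set (masks_of_class TE6 15). length m = rk TE6" by (simp_all add: list_ex_iff)
qed

lemma class_representative: assumes "j < 16"
  shows "\<exists>L\<in>exceptional_types. \<exists>m\<in>set (masks_of_class L j). length m = rk L"
proof (cases "j < 13")
  case True
  have "map fst rank_two_data = [0..<13]" by (simp add: rank_two_data_def upt_rec)
  then have "j \<in> fst ` set rank_two_data" using True by (metis list.set_map atLeastLessThan_iff le0 set_upt)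
  then obtain L S d where "(j, L, S, d) \<in> set rank_two_data" by auto
  then show ?thesis using rank_two_dataD by metis
next
  case False
  then have "j = 13 \<or> j = 14 \<or> j = 15" using assms by auto
  then show ?thesis using rank_three_masks by (auto simp: exceptional_types_def)
qed

lemma dim_canon_set: assumes "j < 16" shows "dim (canon_set j) = (if j < 13 then 2 else 3)"
proof -
  obtain L m where Lm: "L \<in> exceptional_types" "m \<in> set (masks_of_class L j)" "length m = rk L"
    using class_representative[OF assms] by blast
  \<comment> \<open>The rank of a model is a matter of coefficient vectors alone, so the locale can
    be used with an empty set of roots.\<close>
  interpret charted_roots L "{} :: real set" by (rule charted_roots.intro[OF Lm(1)])
  show ?thesis using linearly_isomorphic_dim[OF table_class(3)[OF Lm(1,2)]] dim_T_roots[OF Lm(3)] table_class(2)[OF Lm(1,2)]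
    by (simp add: canon_set_def)
qed

lemma canon_class_props: assumes "j < 16" "\<Omega> \<in> canon_class j"
  shows "dim \<Omega> = (if j < 13 then 2 else 3)" "card \<Omega> = length (canon ! j)" "\<not> reducible_system \<Omega>"
    "card {a \<in> \<Omega>. 2 *\<^sub>R a \<in> \<Omega>} = length (doubled (canon ! j))"
proof -
  have iso: "linearly_isomorphic (canon_set j) \<Omega>" using assms canon_class_iff by blast
  show "dim \<Omega> = (if j < 13 then 2 else 3)" using linearly_isomorphic_dim[OF iso] dim_canon_set[OF assms(1)] by simp
  show "card \<Omega> = length (canon ! j)" using linearly_isomorphic_card[OF iso] card_canon_set[OF assms(1)] by simp
  show "\<not> reducible_system \<Omega>"
    using linearly_isomorphic_reducible[OF linearly_isomorphic_sym[OF iso]] canon_irreducible[OF assms(1)] by blast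
  show "card {a \<in> \<Omega>. 2 *\<^sub>R a \<in> \<Omega>} = length (doubled (canon ! j))"
    using linearly_isomorphic_doubles[OF iso] card_canon_doubles[OF assms(1)] by simp
qed

lemma canon_set_in_class: "canon_set j \<in> canon_class j"
  by (simp add: canon_class_iff linearly_isomorphic_refl)

lemma canon_class_eqD: assumes "i < 16" "j < 16" "canon_class i = canon_class j" shows "i = j"
proof -
  have m: "canon_set i \<in> canon_class j" using canon_set_in_class assms(3) by blast
  have "canon_inv i = canon_inv j"
    using canon_class_props[OF assms(2) m] canon_class_props[OF assms(1) canon_set_in_class]
    by (simp add: canon_inv_def Let_def)
  moreover have "canon_inv k = map canon_inv [0..<16] ! k" if "k < 16" for k using that by simp
  moreover have "distinct (map canon_inv [0..<16])" unfolding canon_inv_list by simp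
  ultimately show ?thesis using assms(1,2) by (metis distinct_conv_nth length_map length_upt minus_nat.diff_0)
qed

text \<open>A union of full equivalence classes has exactly these classes as its quotient. Each
  clause about a quotient is thereby reduced to identifying a set of indices.\<close>

lemma canon_class_quotient: "(\<Union>j\<in>J. canon_class j) // T_iso = canon_class ` J"
proof -
  have eq: "T_iso `` {\<Omega>} = canon_class j" if "\<Omega> \<in> canon_class j" for \<Omega> j
  proof -
    have "(canon_set j, \<Omega>) \<in> T_iso" using that by (simp add: canon_class_def)
    then show ?thesis unfolding canon_class_def by (rule equiv_class_eq[OF equiv_T_iso, symmetric])
  qed
  show ?thesis
  proof (intro set_eqI iffI)
    fix X assume "X \<in> (\<Union>j\<in>J. canon_class j) // T_iso"
    then obtain \<Omega> where "X = T_iso `` {\<Omega>}" "\<Omega> \<in> (\<Union>j\<in>J. canon_class j)" by (rule quotientE)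
    then show "X \<in> canon_class ` J" using eq by auto
  next
    fix X assume "X \<in> canon_class ` J"
    then obtain j where j: "j \<in> J" "X = T_iso `` {canon_set j}" by (auto simp: canon_class_def)
    have "canon_set j \<in> (\<Union>j\<in>J. canon_class j)" using j(1) canon_set_in_class by blast
    then show "X \<in> (\<Union>j\<in>J. canon_class j) // T_iso" unfolding j(2) by (rule quotientI)
  qed
qed

section \<open>The three systems of rank three\<close>

lemma canon_13: "canon_set 13 = std_roots (TC 3)"
proof -
  have "canon ! 13 = std_list (TC 3)" by code_simp
  then show ?thesis unfolding canon_set_def using cvec_std_C[of 3] by simp
qed

lemma canon_14: "canon_set 14 = C3_2"
proof -
  let ?a = "(replicate 8 0)[0 := 2 :: int]" and ?b = "(replicate 8 0)[0 := - 2 :: int]"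
  \<comment> \<open>The model is cut out of \<open>C_3\<close> by its first coordinate; evaluation
    shows that this removes exactly one pair of opposite long roots.\<close>
  have 1: "canon ! 14 = filter (\<lambda>x. x \<noteq> ?a \<and> x \<noteq> ?b) (std_list (TC 3))" by code_simp
  have 2: "list_all (\<lambda>x. length x = 8) (std_list (TC 3))" "mem ?a (std_list (TC 3))" "mem ?b (std_list (TC 3))" by code_simp+
  have "inj_on cvec (set (std_list (TC 3)))"
    using 2(1) unfolding list_all_iff by (auto intro!: inj_onI cvec_inj simp del: std_list.simps)
  then have "cvec ` (set (std_list (TC 3)) - {?a, ?b}) = cvec ` set (std_list (TC 3)) - cvec ` {?a, ?b}"
    using 2(2,3) by (intro inj_on_image_set_diff) (auto simp del: std_list.simps)
  moreover have "set (canon ! 14) = set (std_list (TC 3)) - {?a, ?b}" unfolding 1 set_filter by blast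
  moreover have "cvec ` {?a, ?b} = {2 *\<^sub>R \<epsilon> 0, - (2 *\<^sub>R \<epsilon> 0)}" using cvec_one[of 0 2] cvec_one[of 0 "-2"] by simp
  ultimately show ?thesis unfolding canon_set_def C3_2_def using cvec_std_C[of 3] by simp
qed

lemma canon_15: "canon_set 15 = B3_v"
proof -
  let ?v = "[1, 1, 1, 0, 0, 0, 0, 0] :: int list"
  have 1: "canon ! 15 = std_list (TB 3) @ [?v, map uminus ?v]" by code_simp
  have v: "cvec ?v = \<epsilon> 0 + \<epsilon> 1 + \<epsilon> 2"
    by (rule vec8_eqI) (auto simp: cvec_nth \<epsilon>_nth less_Suc_eq numeral_eq_Suc)
  have "canon_set 15 = cvec ` set (std_list (TB 3)) \<union> {cvec ?v, cvec (map uminus ?v)}"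
    unfolding canon_set_def 1 set_append image_Un by simp
  then show ?thesis unfolding B3_v_def Let_def cvec_uminus v using cvec_std_B[of 3] by simp
qed

section \<open>From an exceptional algebra to the sixteen classes\<close>

lemma exceptional_algebraI:
  assumes "L \<in> exceptional_types" "is_compact_simple_of_type L br g t" shows "exceptional_algebra br g t L"
  using assms unfolding is_compact_simple_of_type_def exceptional_algebra_def exceptional_algebra_axioms_def
    compact_algebra_with_torus_def compact_algebra_with_torus_axioms_def charted_roots_def by blast

context exceptional_algebra
begin

lemma T_root_system_classified:
  assumes f: "flag_isotropy br g t h" and T: "T_root_system br g t h \<Omega>" and d: "dim \<Omega> \<ge> 2" and c: "half_card \<Omega> \<le> 10"
  shows "\<exists>j<16. \<Omega> \<in> canon_class j"
proof -
  obtain \<kappa> m where md: "modelled h \<kappa> m" using flag_modelled[OF f] by blast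
  then have m: "length m = n" by (simp add: modelled_def)
  have iso: "linearly_isomorphic (cvec ` set (T_root_list L m)) \<Omega>" using T T_root_system_iff[OF md] by blast
  have "nodes m \<ge> 2" using linearly_isomorphic_dim[OF iso] dim_T_roots[OF m] d by simp
  moreover have "card (cvec ` set (T_root_list L m)) \<le> 20"
    using linearly_isomorphic_card[OF iso] c by (simp add: half_card_def)
  ultimately obtain j where j: "m \<in> set (masks_of_class L j)" using small_systems_classified[OF m] by blast
  have "linearly_isomorphic (canon_set j) \<Omega>" unfolding canon_set_def
    using linearly_isomorphic_trans[OF linearly_isomorphic_sym[OF table_class(3)[OF L j]] iso] .
  then show ?thesis using table_class(1)[OF L j] canon_class_iff by blast
qed

lemma class_realized:
  assumes m: "m \<in> set (masks_of_class L j)" "length m = n" and \<Omega>: "\<Omega> \<in> canon_class j"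
  obtains h \<kappa> where "modelled h \<kappa> m" "T_root_system br g t h \<Omega>"
proof -
  obtain h \<kappa> where md: "modelled h \<kappa> m" using modelled_exists[OF m(2)] by blast
  have "linearly_isomorphic (cvec ` set (T_root_list L m)) \<Omega>"
    using linearly_isomorphic_trans[OF table_class(3)[OF L m(1)]] \<Omega> unfolding canon_class_iff canon_set_def by blast
  then show ?thesis using T_root_system_iff[OF md] that md by blast
qed

text \<open>Several masks may share the type; all of them lie in class \<open>j\<close>, which
  confines the systems to one isomorphism class. Conversely the certified mask of class
  \<open>j\<close> has this type and realizes every member of the class.\<close>

lemma flag_systems_class:
  assumes e: "(j, L, S, d) \<in> set rank_two_data"
  shows "{\<Omega>. \<exists>h. flag_isotropy br g t h \<and> isotropy_type br t h 2 S \<and> T_root_system br g t h \<Omega>} = canon_class j"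
proof -
  obtain m comps where mc: "S = map (\<lambda>(_, T, _). T) comps" "m \<in> set (masks_of_class L j)" "length m = n" "comps_ok L m comps"
    "type_unique j L S" "set S \<subseteq> set small_types" "j < 13" using rank_two_dataD[OF e] by metis
  show ?thesis
  proof (intro set_eqI iffI)
    fix \<Omega> assume "\<Omega> \<in> {\<Omega>. \<exists>h. flag_isotropy br g t h \<and> isotropy_type br t h 2 S \<and> T_root_system br g t h \<Omega>}"
    then obtain h where h: "flag_isotropy br g t h" "isotropy_type br t h 2 S" "T_root_system br g t h \<Omega>" by blast
    obtain \<kappa> m' where md: "modelled h \<kappa> m'" using flag_modelled[OF h(1)] by blast
    have "nodes m' = 2" using center_dim[OF md] h(2) by (simp add: isotropy_type_def)
    moreover have "has_type (levi \<kappa> m') S" using h(2) md by (simp add: isotropy_type_def modelled_def)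
    ultimately have m': "m' \<in> set (masks_of_class L j)" using type_determines_class[OF md _ _ mc(6,5)] by blast
    have iso: "linearly_isomorphic (cvec ` set (T_root_list L m')) \<Omega>" using h(3) T_root_system_iff[OF md] by blast
    show "\<Omega> \<in> canon_class j" unfolding canon_class_iff canon_set_def
      using linearly_isomorphic_trans[OF linearly_isomorphic_sym[OF table_class(3)[OF L m']] iso] .
  next
    fix \<Omega> assume "\<Omega> \<in> canon_class j"
    then obtain h \<kappa> where h: "modelled h \<kappa> m" "T_root_system br g t h \<Omega>" using class_realized[OF mc(2,3)] by blast
    have "nodes m = 2" using table_class(2)[OF L mc(2)] mc(7) by simp
    then have "dim (center_algebra br h) = 2" using center_dim[OF h(1)] by simp
    moreover have "has_type (levi \<kappa> m) S"
      unfolding mc(1) using h(1) mc(1,3,4,6) by (intro comps_ok_has_type) (auto simp: modelled_def)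
    ultimately have "isotropy_type br t h 2 S" using h(1) by (simp add: isotropy_type_def modelled_def)
    then show "\<Omega> \<in> {\<Omega>. \<exists>h. flag_isotropy br g t h \<and> isotropy_type br t h 2 S \<and> T_root_system br g t h \<Omega>}"
      using h by (auto simp: modelled_def)
  qed
qed

end

theorem mainTheorem5:
  fixes br :: "simple_type \<Rightarrow> 'a::euclidean_space \<Rightarrow> 'a \<Rightarrow> 'a"
    and g t :: "simple_type \<Rightarrow> 'a set"
  assumes "\<And>L. L \<in> exceptional_types \<Longrightarrow> is_compact_simple_of_type L (br L) (g L) (t L)"
  shows
    "let
       \<A> = {\<Omega>. (\<exists>L\<in>exceptional_types. \<exists>h. flag_isotropy (br L) (g L) (t L) h \<and>
                   T_root_system (br L) (g L) (t L) h \<Omega>) \<and>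
               \<not> reducible_system \<Omega> \<and> dim \<Omega> \<ge> 2 \<and> half_card \<Omega> \<le> 10};
       flag_systems = (\<lambda>L k S. {\<Omega>. \<exists>h. flag_isotropy (br L) (g L) (t L) h \<and>
                   isotropy_type (br L) (t L) h k S \<and>
                   T_root_system (br L) (g L) (t L) h \<Omega>});
       rank_two = {(TE6, [TD 4], 3),
                   (TE6, [TA 4], 4),
                   (TE6, [TA 1, TA 3], 5),
                   (TE6, [TA 1, TA 1, TA 2], 6),
                   (TE7, [TA 1, TD 4], 6),
                   (TE6, [TA 2, TA 2], 6),
                   (TE7, [TA 2, TA 3], 7),
                   (TE7, [TA 1, TA 2, TA 2], 8),
                   (TE7, [TA 1, TA 1, TA 3], 8),
                   (TE7, [TA 1, TA 1, TA 1, TA 2], 9),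
                   (TE8, [TA 1, TA 5], 9),
                   (TE8, [TA 3, TA 3], 10),
                   (TE8, [TA 2, TA 4], 10)}
     in
       card (\<A> // T_iso) = 16 \<and>
       {\<Omega> \<in> \<A>. dim \<Omega> = 2} // T_iso = {flag_systems L 2 S | L S d. (L, S, d) \<in> rank_two} \<and>
       (\<forall>(L, S, d) \<in> rank_two. \<forall>\<Omega> \<in> flag_systems L 2 S. half_card \<Omega> = d) \<and>
       {\<Omega> \<in> \<A>. dim \<Omega> \<noteq> 2} // T_iso =
         {T_iso `` {std_roots (TC 3)}, T_iso `` {C3_2}, T_iso `` {B3_v}} \<and>
       dim B3_v = 3"
proof -
  define \<A> where "\<A> = {\<Omega>. (\<exists>L\<in>exceptional_types. \<exists>h. flag_isotropy (br L) (g L) (t L) h \<and>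
      T_root_system (br L) (g L) (t L) h \<Omega>) \<and> \<not> reducible_system \<Omega> \<and> dim \<Omega> \<ge> 2 \<and> half_card \<Omega> \<le> 10}"
  define fs where "fs = (\<lambda>L (k::nat) S. {\<Omega>. \<exists>h. flag_isotropy (br L) (g L) (t L) h \<and>
      isotropy_type (br L) (t L) h k S \<and> T_root_system (br L) (g L) (t L) h \<Omega>})"
  define rt where "rt = {(TE6, [TD 4], 3), (TE6, [TA 4], 4), (TE6, [TA 1, TA 3], 5), (TE6, [TA 1, TA 1, TA 2], 6),
      (TE7, [TA 1, TD 4], 6), (TE6, [TA 2, TA 2], 6), (TE7, [TA 2, TA 3], 7), (TE7, [TA 1, TA 2, TA 2], 8),
      (TE7, [TA 1, TA 1, TA 3], 8), (TE7, [TA 1, TA 1, TA 1, TA 2], 9), (TE8, [TA 1, TA 5], 9),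
      (TE8, [TA 3, TA 3], 10), (TE8, [TA 2, TA 4], 10 :: real)}"
  have E: "exceptional_algebra (br L) (g L) (t L) L" if "L \<in> exceptional_types" for L
    using exceptional_algebraI assms that by blast
  \<comment> \<open>The list in the statement is \<open>rank_two_data\<close> without the class
    numbers and with \<open>d\<close> read as a real number.\<close>
  have rt: "rt = (\<lambda>(j, L, S, d). (L, S, real d)) ` set rank_two_data"
    by (simp add: rt_def rank_two_data_def)
  have fs_class: "fs L 2 S = canon_class j" if "(j, L, S, d) \<in> set rank_two_data" for j L S d
  proof -
    have "L \<in> exceptional_types" using rank_two_dataD[OF that] by metis
    then interpret exceptional_algebra "br L" "g L" "t L" L by (rule E)
    show ?thesis unfolding fs_def using flag_systems_class[OF that] .
  qed
  \<comment> \<open>The quotient clauses follow from this equality by restricting the union to the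
    indices concerned.\<close>
  have A: "\<A> = (\<Union>j<16. canon_class j)"
  proof (intro set_eqI iffI)
    fix \<Omega> assume "\<Omega> \<in> \<A>"
    then obtain L h where Lh: "L \<in> exceptional_types" "flag_isotropy (br L) (g L) (t L) h"
      "T_root_system (br L) (g L) (t L) h \<Omega>" "dim \<Omega> \<ge> 2" "half_card \<Omega> \<le> 10" unfolding \<A>_def by blast
    interpret exceptional_algebra "br L" "g L" "t L" L by (rule E[OF Lh(1)])
    show "\<Omega> \<in> (\<Union>j<16. canon_class j)" using T_root_system_classified[OF Lh(2-5)] by blast
  next
    fix \<Omega> assume "\<Omega> \<in> (\<Union>j<16. canon_class j)"
    then obtain j where j: "j < 16" "\<Omega> \<in> canon_class j" by blast
    obtain L m where Lm: "L \<in> exceptional_types" "m \<in> set (masks_of_class L j)" "length m = rk L"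
      using class_representative[OF j(1)] by blast
    interpret exceptional_algebra "br L" "g L" "t L" L by (rule E[OF Lm(1)])
    obtain h \<kappa> where "modelled h \<kappa> m" "T_root_system (br L) (g L) (t L) h \<Omega>"
      using class_realized[OF Lm(2,3) j(2)] by blast
    moreover have "half_card \<Omega> \<le> 10"
      using canon_class_props(2)[OF j] canon_props(2)[OF j(1)] by (simp add: half_card_def)
    ultimately show "\<Omega> \<in> \<A>" unfolding \<A>_def modelled_def
      using Lm(1) canon_class_props(1,3)[OF j] by auto
  qed
  have inj: "inj_on canon_class {..<16}" using canon_class_eqD by (auto intro!: inj_onI)
  have "card (\<A> // T_iso) = 16" unfolding A canon_class_quotient by (simp add: card_image inj)
  moreover have "{\<Omega> \<in> \<A>. dim \<Omega> = 2} // T_iso = {fs L 2 S | L S d. (L, S, d) \<in> rt}"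
  proof -
    \<comment> \<open>Rank two means index below 13, and the remaining three indices have rank
      three.\<close>
    have "{\<Omega> \<in> \<A>. dim \<Omega> = 2} = (\<Union>j<13. canon_class j)"
    proof (intro set_eqI iffI)
      fix \<Omega> assume "\<Omega> \<in> {\<Omega> \<in> \<A>. dim \<Omega> = 2}"
      then obtain j where "j < 16" "\<Omega> \<in> canon_class j" "dim \<Omega> = 2" unfolding A by blast
      then show "\<Omega> \<in> (\<Union>j<13. canon_class j)" using canon_class_props(1) by (auto split: if_splits)
    next
      fix \<Omega> assume "\<Omega> \<in> (\<Union>j<13. canon_class j)"
      then obtain j where j: "j < 13" "\<Omega> \<in> canon_class j" by blast
      then show "\<Omega> \<in> {\<Omega> \<in> \<A>. dim \<Omega> = 2}" unfolding A using canon_class_props(1)[of j \<Omega>] by force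
    qed
    then have "{\<Omega> \<in> \<A>. dim \<Omega> = 2} // T_iso = canon_class ` {..<13}" by (simp add: canon_class_quotient)
    also have "\<dots> = {fs L 2 S | L S d. (L, S, d) \<in> rt}"
    proof (intro set_eqI iffI)
      fix X assume "X \<in> canon_class ` {..<13}"
      then obtain j where j: "j < 13" "X = canon_class j" by blast
      have "map fst rank_two_data = [0..<13]" by (simp add: rank_two_data_def upt_rec)
      then have "j \<in> fst ` set rank_two_data" using j(1) by (metis list.set_map atLeastLessThan_iff le0 set_upt)
      then obtain L S d where d: "(j, L, S, d) \<in> set rank_two_data" by auto
      have "(L, S, real d) \<in> rt" unfolding rt by (rule image_eqI[OF _ d]) simp
      moreover have "X = fs L 2 S" using fs_class[OF d] j(2) by simp
      ultimately show "X \<in> {fs L 2 S | L S d. (L, S, d) \<in> rt}" by blast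
    next
      fix X assume "X \<in> {fs L 2 S | L S d. (L, S, d) \<in> rt}"
      then obtain L S d where "X = fs L 2 S" "(L, S, d) \<in> rt" by blast
      then obtain j d' where jd: "(j, L, S, d') \<in> set rank_two_data" "X = fs L 2 S" unfolding rt by auto
      moreover have "j < 13" using rank_two_dataD[OF jd(1)] by metis
      ultimately show "X \<in> canon_class ` {..<13}" using fs_class by auto
    qed
    finally show ?thesis .
  qed
  moreover have "\<forall>(L, S, d) \<in> rt. \<forall>\<Omega> \<in> fs L 2 S. half_card \<Omega> = d"
  proof safe
    fix L S d \<Omega> assume "(L, S, d) \<in> rt" and \<Omega>: "\<Omega> \<in> fs L 2 S"
    then obtain j d' where jd: "(j, L, S, d') \<in> set rank_two_data" "d = real d'" unfolding rt by auto
    then have "j < 13" "2 * d' = length (canon ! j)" using rank_two_dataD[OF jd(1)] by metis+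
    moreover have "\<Omega> \<in> canon_class j" using fs_class[OF jd(1)] \<Omega> by simp
    ultimately have "card \<Omega> = 2 * d'" using canon_class_props(2)[of j \<Omega>] by simp
    then show "half_card \<Omega> = d" using jd(2) by (simp add: half_card_def)
  qed
  moreover have "{\<Omega> \<in> \<A>. dim \<Omega> \<noteq> 2} // T_iso =
      {T_iso `` {std_roots (TC 3)}, T_iso `` {C3_2}, T_iso `` {B3_v}}"
  proof -
    have "{\<Omega> \<in> \<A>. dim \<Omega> \<noteq> 2} = (\<Union>j\<in>{13, 14, 15}. canon_class j)"
    proof (intro set_eqI iffI)
      fix \<Omega> assume "\<Omega> \<in> {\<Omega> \<in> \<A>. dim \<Omega> \<noteq> 2}"
      then obtain j where j: "j < 16" "\<Omega> \<in> canon_class j" "dim \<Omega> \<noteq> 2" unfolding A by blast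
      then have "\<not> j < 13" using canon_class_props(1)[OF j(1,2)] by auto
      then have "j \<in> {13, 14, 15}" using j(1) by auto
      then show "\<Omega> \<in> (\<Union>j\<in>{13, 14, 15}. canon_class j)" using j(2) by blast
    next
      fix \<Omega> assume "\<Omega> \<in> (\<Union>j\<in>{13, 14, 15}. canon_class j)"
      then obtain j where j: "j \<in> {13, 14, 15}" "\<Omega> \<in> canon_class j" by blast
      then have j': "j < 16" "\<not> j < 13" by auto
      then have "dim \<Omega> = 3" using canon_class_props(1)[OF j'(1) j(2)] by simp
      then show "\<Omega> \<in> {\<Omega> \<in> \<A>. dim \<Omega> \<noteq> 2}" unfolding A using j(2) j'(1) by auto
    qed
    then have "{\<Omega> \<in> \<A>. dim \<Omega> \<noteq> 2} // T_iso = canon_class ` {13, 14, 15}" by (simp only: canon_class_quotient)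
    then show ?thesis by (simp add: canon_class_def canon_13 canon_14 canon_15)
  qed
  moreover have "dim B3_v = 3" using dim_canon_set[of 15] by (simp add: canon_15)
  ultimately have "card (\<A> // T_iso) = 16 \<and> {\<Omega> \<in> \<A>. dim \<Omega> = 2} // T_iso = {fs L 2 S | L S d. (L, S, d) \<in> rt} \<and>
      (\<forall>(L, S, d) \<in> rt. \<forall>\<Omega> \<in> fs L 2 S. half_card \<Omega> = d) \<and>
      {\<Omega> \<in> \<A>. dim \<Omega> \<noteq> 2} // T_iso = {T_iso `` {std_roots (TC 3)}, T_iso `` {C3_2}, T_iso `` {B3_v}} \<and> dim B3_v = 3"
    by blast
  then show ?thesis unfolding Let_def \<A>_def fs_def rt_def .
qed

end
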